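(* A Banach space $E$ has the polynomial property (V) if and only if the space $\mathcal{P}(^kE)$ of continuous scalar-valued $k$-homogeneous polynomials on $E$ is reflexive for every positive integer $k$.
   Context: Banach spaces are real or complex. $\mathcal{P}(^kE,F)$ is the space of continuous $k$-homogeneous polynomials from $E$ to $F$ with the norm $\|P\|=\sup_{\|x\|\le1}\|P(x)\|$, and $\mathcal{P}(^kE)=\mathcal{P}(^kE,\mathbf{K})$ with $\mathbf{K}$ the scalar field. A series $\sum x_i$ in a Banach space $E$ is weakly unconditionally Cauchy (w.u.C.) if $\sum_i|f(x_i)|<\infty$ for every $f\in E^*$; it is unconditionally converging (u.c.) if every subseries is norm convergent. $\mathcal{P}_{uc}(^kE,F)$ is the class of $P\in\mathcal{P}(^kE,F)$ such that $\sum P(x_i)$ is u.c. whenever $\sum x_i$ is w.u.C. in $E$. $\mathcal{P}_{wco}(^kE,F)$ is the class of $P\in\mathcal{P}(^kE,F)$ taking bounded subsets of $E$ into relatively weakly compact subsets of $F$. $E$ has the polynomial property (V) if $\mathcal{P}_{uc}(^kE,F)\subseteq\mathcal{P}_{wco}(^kE,F)$ for every positive integer $k$ and every Banach space $F$ (over the same scalar field). *)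

theory Defs
  imports "HOL-Analysis.Analysis" "HOL-Algebra.Module"
begin

text \<open>Banach spaces are carrier-based, because the property below quantifies over all Banach spaces
  inside a formula. The algebraic part is a module of HOL-Algebra over the field of scalars; the
  fields \<open>mult\<close> and \<open>one\<close> that its record inherits from rings play no role for vectors.\<close>

definition scalar_field :: "'k::field ring" where
  "scalar_field = \<lparr>carrier = UNIV, mult = (*), one = 1, zero = 0, add = (+)\<rparr>"

record ('k, 'a) normed_module = "('k, 'a) module" +
  vnorm :: "'a \<Rightarrow> real"

text \<open>\<^locale>\<open>Metric_space\<close> demands symmetry and nonnegativity also outside the carrier, hence the 0.\<close>

definition vdist :: "('k, 'a, 'm) normed_module_scheme \<Rightarrow> 'a \<Rightarrow> 'a \<Rightarrow> real" where
  "vdist V x y = (if x \<in> carrier V \<and> y \<in> carrier V then vnorm V (x \<ominus>\<^bsub>V\<^esub> y) else 0)"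

locale normed_space = module scalar_field V
  for V :: "('k::real_normed_field, 'a) normed_module" +
  assumes vnorm_eq_zero: "x \<in> carrier V \<Longrightarrow> vnorm V x = 0 \<longleftrightarrow> x = \<zero>\<^bsub>V\<^esub>"
    and vnorm_triangle: "\<lbrakk>x \<in> carrier V; y \<in> carrier V\<rbrakk> \<Longrightarrow> vnorm V (x \<oplus>\<^bsub>V\<^esub> y) \<le> vnorm V x + vnorm V y"
    and vnorm_smult: "x \<in> carrier V \<Longrightarrow> vnorm V (c \<odot>\<^bsub>V\<^esub> x) = norm c * vnorm V x"

locale banach_space = normed_space +
  assumes complete: "Metric_space.mcomplete (carrier V) (vdist V)"

definition norm_topology :: "('k, 'a) normed_module \<Rightarrow> 'a topology" where
  "norm_topology V = Metric_space.mtopology (carrier V) (vdist V)"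

definition unit_ball :: "('k, 'a) normed_module \<Rightarrow> 'a set" where
  "unit_ball V = {x \<in> carrier V. vnorm V x \<le> 1}"

definition scalar_space :: "('k::real_normed_field, 'k) normed_module" where
  "scalar_space = \<lparr>carrier = UNIV, mult = (*), one = 1, zero = 0, add = (+), smult = (*), vnorm = norm\<rparr>"

text \<open>A set \<open>S\<close> of maps from \<open>V\<close> to \<open>W\<close> with the pointwise operations and the supremum norm over the
  unit ball. Maps are extensional, so that equality on the carrier is equality.\<close>

definition map_space :: "('a \<Rightarrow> 'b) set \<Rightarrow> ('k, 'a) normed_module \<Rightarrow> ('k, 'b) normed_module
    \<Rightarrow> ('k, 'a \<Rightarrow> 'b) normed_module" where
  "map_space S V W =
    \<lparr>carrier = S, mult = undefined, one = undefined,
     zero = (\<lambda>x\<in>carrier V. \<zero>\<^bsub>W\<^esub>),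
     add = (\<lambda>P Q. \<lambda>x\<in>carrier V. P x \<oplus>\<^bsub>W\<^esub> Q x),
     smult = (\<lambda>c P. \<lambda>x\<in>carrier V. c \<odot>\<^bsub>W\<^esub> P x),
     vnorm = (\<lambda>P. SUP x\<in>unit_ball V. vnorm W (P x))\<rparr>"

definition linear_map :: "('k, 'a) normed_module \<Rightarrow> ('k, 'b) normed_module \<Rightarrow> ('a \<Rightarrow> 'b) \<Rightarrow> bool" where
  "linear_map V W f \<longleftrightarrow> f \<in> carrier V \<rightarrow> carrier W \<and>
    (\<forall>x\<in>carrier V. \<forall>y\<in>carrier V. f (x \<oplus>\<^bsub>V\<^esub> y) = f x \<oplus>\<^bsub>W\<^esub> f y) \<and>
    (\<forall>c. \<forall>x\<in>carrier V. f (c \<odot>\<^bsub>V\<^esub> x) = c \<odot>\<^bsub>W\<^esub> f x)"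

definition dual :: "('k::real_normed_field, 'a) normed_module \<Rightarrow> ('k, 'a \<Rightarrow> 'k) normed_module" where
  "dual V = map_space {f \<in> extensional (carrier V). linear_map V scalar_space f \<and>
    continuous_map (norm_topology V) (norm_topology scalar_space) f} V scalar_space"

definition reflexive :: "('k::real_normed_field, 'a) normed_module \<Rightarrow> bool" where
  "reflexive V \<longleftrightarrow> (\<lambda>x. \<lambda>f\<in>carrier (dual V). f x) ` carrier V = carrier (dual (dual V))"

definition weak_topology :: "('k::real_normed_field, 'a) normed_module \<Rightarrow> 'a topology" where
  "weak_topology V = topology_generated_by
    {{x \<in> carrier V. f x \<in> U} | f U. f \<in> carrier (dual V) \<and> openin (norm_topology scalar_space) U}"

definition relatively_weakly_compact :: "('k::real_normed_field, 'a) normed_module \<Rightarrow> 'a set \<Rightarrow> bool" where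
  "relatively_weakly_compact V A \<longleftrightarrow> A \<subseteq> carrier V \<and>
    compactin (weak_topology V) (weak_topology V closure_of A)"

text \<open>A \<open>k\<close>-tuple of vectors is an element of \<open>{..<k} \<rightarrow>\<^sub>E carrier V\<close>.\<close>

definition multilinear_map ::
  "nat \<Rightarrow> ('k, 'a) normed_module \<Rightarrow> ('k, 'b) normed_module \<Rightarrow> ((nat \<Rightarrow> 'a) \<Rightarrow> 'b) \<Rightarrow> bool" where
  "multilinear_map k V W A \<longleftrightarrow> A \<in> ({..<k} \<rightarrow>\<^sub>E carrier V) \<rightarrow> carrier W \<and>
    (\<forall>u \<in> {..<k} \<rightarrow>\<^sub>E carrier V. \<forall>i<k. linear_map V W (\<lambda>x. A (u(i := x))))"

definition homogeneous_polynomial ::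
  "nat \<Rightarrow> ('k, 'a) normed_module \<Rightarrow> ('k, 'b) normed_module \<Rightarrow> ('a \<Rightarrow> 'b) \<Rightarrow> bool" where
  "homogeneous_polynomial k V W P \<longleftrightarrow>
    (\<exists>A. multilinear_map k V W A \<and> (\<forall>x\<in>carrier V. P x = A (\<lambda>i\<in>{..<k}. x)))"

definition poly_space ::
  "nat \<Rightarrow> ('k, 'a) normed_module \<Rightarrow> ('k, 'b) normed_module \<Rightarrow> ('k, 'a \<Rightarrow> 'b) normed_module" where
  "poly_space k V W = map_space {P \<in> extensional (carrier V). homogeneous_polynomial k V W P \<and>
    continuous_map (norm_topology V) (norm_topology W) P} V W"

definition weakly_unconditionally_Cauchy ::
  "('k::real_normed_field, 'a) normed_module \<Rightarrow> (nat \<Rightarrow> 'a) \<Rightarrow> bool" where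
  "weakly_unconditionally_Cauchy V x \<longleftrightarrow> range x \<subseteq> carrier V \<and>
    (\<forall>f\<in>carrier (dual V). summable (\<lambda>i. norm (f (x i))))"

definition unconditionally_converging :: "('k, 'a) normed_module \<Rightarrow> (nat \<Rightarrow> 'a) \<Rightarrow> bool" where
  "unconditionally_converging V x \<longleftrightarrow> range x \<subseteq> carrier V \<and>
    (\<forall>r. strict_mono r \<longrightarrow>
      (\<exists>s. limitin (norm_topology V) (\<lambda>n. \<Oplus>\<^bsub>V\<^esub>i\<in>{..<n}. x (r i)) s sequentially))"

definition poly_uc ::
  "nat \<Rightarrow> ('k::real_normed_field, 'a) normed_module \<Rightarrow> ('k, 'b) normed_module \<Rightarrow> ('a \<Rightarrow> 'b) set" where
  "poly_uc k V W = {P \<in> carrier (poly_space k V W).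
    \<forall>x. weakly_unconditionally_Cauchy V x \<longrightarrow> unconditionally_converging W (\<lambda>i. P (x i))}"

definition poly_wco ::
  "nat \<Rightarrow> ('k::real_normed_field, 'a) normed_module \<Rightarrow> ('k, 'b) normed_module \<Rightarrow> ('a \<Rightarrow> 'b) set" where
  "poly_wco k V W = {P \<in> carrier (poly_space k V W).
    \<forall>B. B \<subseteq> carrier V \<and> Metric_space.mbounded (carrier V) (vdist V) B \<longrightarrow>
      relatively_weakly_compact W (P ` B)}"

text \<open>The Banach spaces \<open>F\<close> range over all those whose underlying set is a set of elements of the
  type \<open>'f\<close>, since a formula cannot quantify over types.\<close>

definition polynomial_property_V :: "'f itself \<Rightarrow> ('k::real_normed_field, 'a) normed_module \<Rightarrow> bool" where
  "polynomial_property_V (_ :: 'f itself) E \<longleftrightarrow>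
    (\<forall>k\<ge>1. \<forall>F :: ('k, 'f) normed_module. banach_space F \<longrightarrow> poly_uc k E F \<subseteq> poly_wco k E F)"

text \<open>The types of points for \<open>F\<close>. As \<open>'u\<close> is arbitrary, every Banach space is isometric to one in such
  a universe. The left summand ensures that, however small \<open>'u\<close> is, the dual of each space of
  scalar-valued functions on \<open>'e\<close> has an isometric copy in it.\<close>

type_synonym ('k, 'e, 'u) universe = "(('e \<Rightarrow> 'k) \<Rightarrow> 'k) + 'u"

end

theory Submission
  imports Defs
begin

text \<open>Write \<open>X\<close> for the space of \<open>k\<close>-homogeneous scalar polynomials on \<open>E\<close> and \<open>\<delta>\<^sub>x\<close> for the evaluation at
  \<open>x\<close>, an element of the dual \<open>X\<^sup>*\<close>. By polarization \<open>x \<mapsto> \<delta>\<^sub>x\<close> is itself a continuous homogeneous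
  polynomial, and every \<open>P\<close> in \<open>\<P>(\<^sup>kE,F)\<close> is \<open>\<delta>\<close> followed by a linear map from \<open>X\<^sup>*\<close> into the bidual of \<open>F\<close>.

  Suppose that \<open>X\<close> is reflexive. Then the point evaluations span a dense subspace of \<open>X\<^sup>*\<close>, because a
  functional that vanishes on them is evaluation at the zero polynomial. As \<open>F\<close> is complete, the linear
  map takes all its values in \<open>F\<close> (\<open>reflexive_bidual_transpose\<close>). It is continuous from the pointwise
  topology of \<open>X\<^sup>*\<close> to the weak topology of \<open>F\<close>, so it takes the pointwise compact balls of \<open>X\<^sup>*\<close> to weakly
  compact sets, which contain the images of balls under \<open>P\<close> (\<open>reflexive_imp_weakly_compact\<close>).

  Suppose that \<open>E\<close> has the polynomial property (V), and let \<open>f\<close> be a functional with \<open>f e = 1\<close>. The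
  \<open>(k + 1)\<close>-homogeneous polynomial \<open>x \<mapsto> f x \<cdot> \<delta>\<^sub>x\<close> into \<open>X\<^sup>*\<close> takes weakly unconditionally Cauchy series to
  absolutely convergent ones, so it is weakly compact. On the hyperplane \<open>f x = 1\<close> it is \<open>x \<mapsto> \<delta>\<^sub>x\<close>. Hence the
  set \<open>K\<close> of all \<open>\<delta>\<^sub>x\<close> with \<open>f x = 1\<close> and \<open>x\<close> in a large ball is relatively weakly compact
  (\<open>point_evaluations_cluster\<close>), and \<open>K\<close> norms \<open>X\<close> up to a constant (\<open>hyperplane_norming\<close>). Given a
  functional \<open>\<Phi>\<close> on \<open>X\<^sup>*\<close>, the map \<open>x \<mapsto> \<Phi> \<delta>\<^sub>x\<close> is a polynomial \<open>P\<close> in \<open>X\<close>, and \<open>\<Phi>\<close> agrees with evaluation at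
  \<open>P\<close> on \<open>K\<close>. It remains to see that a functional on \<open>X\<^sup>*\<close> that vanishes on \<open>K\<close> is zero.

  This is the core, \<open>norming_weakly_compact_total\<close>. It follows from Krein's theorem that the closed convex
  hull of a weakly compact set is weakly compact; the proof here takes a direct way. If \<open>\<Phi> \<psi> = 1\<close> while \<open>\<Phi>\<close>
  vanishes on \<open>K\<close>, then Goldstine's theorem yields a bounded sequence of \<open>Q\<^sub>n\<close> in \<open>X\<close> for which \<open>\<psi> Q\<^sub>n\<close> is
  close to \<open>1\<close>, and which tends to \<open>0\<close> at any countable set of points of \<open>K\<close> fixed along the way. The
  Hahn-Banach theorem dominates \<open>\<psi>\<close> by a finitely additive mean on \<open>K\<close>, so the sets where
  \<open>\<bar>Q\<^sub>n\<bar> \<ge> \<epsilon> / 2\<close> all have mean at least a positive constant, and some subsequence of them has nonempty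
  finite intersections (\<open>finitely_additive_intersections\<close>). Points \<open>\<kappa>\<^sub>i\<close> in these intersections have a weak
  cluster point \<open>\<kappa>\<close>, and the subsequence of the \<open>Q\<^sub>n\<close> has a cluster point \<open>\<Psi>\<close> in the bidual of \<open>X\<close>. Taking
  the limits in one order gives \<open>\<Psi> \<kappa> = 0\<close>, in the other order \<open>\<bar>\<Psi> \<kappa>\<bar> \<ge> \<epsilon> / 2\<close>.\<close>

section \<open>Normed spaces\<close>

lemma scalar_field_simps [simp]:
  "carrier scalar_field = UNIV" "mult scalar_field = (*)" "one scalar_field = 1"
  "zero scalar_field = 0" "add scalar_field = (+)"
  by (simp_all add: scalar_field_def)

lemma scalar_space_simps [simp]:
  "carrier scalar_space = UNIV" "zero scalar_space = 0" "add scalar_space = (+)"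
  "smult scalar_space = (*)" "vnorm scalar_space = norm"
  by (simp_all add: scalar_space_def)

lemma cring_scalar_field: "cring (scalar_field :: 'k::field ring)"
proof (rule cringI)
  show "abelian_group (scalar_field :: 'k ring)"
    by (rule abelian_groupI) (auto intro: exI[of _ "- x" for x] simp: add.assoc add.commute)
  show "comm_monoid (scalar_field :: 'k ring)"
    by (rule comm_monoidI) (auto simp: mult.assoc mult.commute)
qed (auto simp: distrib_right)

lemma abelian_group_scalar_space: "abelian_group (scalar_space :: ('k::real_normed_field,'k) normed_module)"
proof (rule abelian_groupI)
  show "\<exists>y\<in>carrier scalar_space. y \<oplus>\<^bsub>scalar_space\<^esub> x = \<zero>\<^bsub>scalar_space\<^esub>" for x :: 'k
    by (rule bexI[of _ "-x"]) auto
qed (auto simp: add.assoc add.commute)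

lemma scalar_minus [simp]: "\<ominus>\<^bsub>scalar_space\<^esub> (x::'k::real_normed_field) = - x"
  by (rule abelian_group.minus_equality[OF abelian_group_scalar_space]) simp_all

lemma normed_space_scalar_space: "normed_space (scalar_space :: ('k::real_normed_field,'k) normed_module)"
proof -
  have "module scalar_field (scalar_space :: ('k,'k) normed_module)"
    by (rule moduleI[OF cring_scalar_field abelian_group_scalar_space])
       (auto simp: algebra_simps)
  then show ?thesis
    by (simp add: normed_space_def normed_space_axioms_def norm_mult norm_triangle_ineq)
qed

lemma scalar_space_diff [simp]: "(x::'k::real_normed_field) \<ominus>\<^bsub>scalar_space\<^esub> y = x - y"
  by (simp add: a_minus_def)

lemma norm_topology_scalar_space [simp]:
  "norm_topology (scalar_space :: ('k::real_normed_field,'k) normed_module) = euclidean"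
proof -
  have "vdist (scalar_space :: ('k,'k) normed_module) = dist"
    by (auto simp: fun_eq_iff vdist_def dist_norm)
  then show ?thesis by (simp add: norm_topology_def)
qed

context normed_space
begin

lemma smult_simps [simp]:
  "x \<in> carrier V \<Longrightarrow> 0 \<odot>\<^bsub>V\<^esub> x = \<zero>\<^bsub>V\<^esub>"
  "x \<in> carrier V \<Longrightarrow> 1 \<odot>\<^bsub>V\<^esub> x = x"
  "c \<odot>\<^bsub>V\<^esub> \<zero>\<^bsub>V\<^esub> = \<zero>\<^bsub>V\<^esub>"
  "x \<in> carrier V \<Longrightarrow> c \<odot>\<^bsub>V\<^esub> x \<in> carrier V"
  using smult_l_null[of x] smult_one[of x] smult_r_null[of c] smult_closed[of c x] by simp_all

lemma smult_add: "x \<in> carrier V \<Longrightarrow> y \<in> carrier V \<Longrightarrow> c \<odot>\<^bsub>V\<^esub> (x \<oplus>\<^bsub>V\<^esub> y) = c \<odot>\<^bsub>V\<^esub> x \<oplus>\<^bsub>V\<^esub> c \<odot>\<^bsub>V\<^esub> y"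
  using smult_r_distr[of c x y] by simp

lemma add_smult: "x \<in> carrier V \<Longrightarrow> (a + b) \<odot>\<^bsub>V\<^esub> x = a \<odot>\<^bsub>V\<^esub> x \<oplus>\<^bsub>V\<^esub> b \<odot>\<^bsub>V\<^esub> x"
  using smult_l_distr[of a b x] by simp

lemma smult_smult: "x \<in> carrier V \<Longrightarrow> a \<odot>\<^bsub>V\<^esub> (b \<odot>\<^bsub>V\<^esub> x) = (a * b) \<odot>\<^bsub>V\<^esub> x"
  using smult_assoc1[of a b x] by simp

lemma minus_eq_smult: "x \<in> carrier V \<Longrightarrow> \<ominus>\<^bsub>V\<^esub> x = (-1) \<odot>\<^bsub>V\<^esub> x"
proof -
  assume x: "x \<in> carrier V"
  have "x \<oplus>\<^bsub>V\<^esub> (-1) \<odot>\<^bsub>V\<^esub> x = \<zero>\<^bsub>V\<^esub>" using add_smult[OF x, of 1 "-1"] x by simp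
  then show ?thesis using x by (simp add: M.minus_equality M.a_comm)
qed

lemma diff_eq_smult: "x \<in> carrier V \<Longrightarrow> y \<in> carrier V \<Longrightarrow> x \<ominus>\<^bsub>V\<^esub> y = x \<oplus>\<^bsub>V\<^esub> (-1) \<odot>\<^bsub>V\<^esub> y"
  by (simp add: a_minus_def minus_eq_smult)

lemma diff_zero [simp]: "x \<in> carrier V \<Longrightarrow> x \<ominus>\<^bsub>V\<^esub> \<zero>\<^bsub>V\<^esub> = x"
  by (simp add: diff_eq_smult)

lemma vnorm_zero [simp]: "vnorm V \<zero>\<^bsub>V\<^esub> = 0"
  using vnorm_eq_zero by simp

lemma vnorm_neg: "x \<in> carrier V \<Longrightarrow> vnorm V (\<ominus>\<^bsub>V\<^esub> x) = vnorm V x"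
  by (simp add: minus_eq_smult vnorm_smult)

lemma vnorm_nonneg [simp]: "x \<in> carrier V \<Longrightarrow> 0 \<le> vnorm V x"
  using vnorm_triangle[of x "\<ominus>\<^bsub>V\<^esub> x"] by (simp add: vnorm_neg M.r_neg)

lemma vnorm_diff_le: "x \<in> carrier V \<Longrightarrow> y \<in> carrier V \<Longrightarrow> vnorm V (x \<ominus>\<^bsub>V\<^esub> y) \<le> vnorm V x + vnorm V y"
  using vnorm_triangle[of x "\<ominus>\<^bsub>V\<^esub> y"] by (simp add: vnorm_neg a_minus_def)

lemma diff_swap: "x \<in> carrier V \<Longrightarrow> y \<in> carrier V \<Longrightarrow> \<ominus>\<^bsub>V\<^esub> (x \<ominus>\<^bsub>V\<^esub> y) = y \<ominus>\<^bsub>V\<^esub> x"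
  by (simp add: a_minus_def M.minus_add M.a_comm)

lemma vnorm_diff_commute: "x \<in> carrier V \<Longrightarrow> y \<in> carrier V \<Longrightarrow> vnorm V (x \<ominus>\<^bsub>V\<^esub> y) = vnorm V (y \<ominus>\<^bsub>V\<^esub> x)"
  by (metis M.minus_closed diff_swap vnorm_neg)

lemma add_diff_cancel: "x \<in> carrier V \<Longrightarrow> y \<in> carrier V \<Longrightarrow> y \<oplus>\<^bsub>V\<^esub> (x \<ominus>\<^bsub>V\<^esub> y) = x"
  by (simp add: a_minus_def M.a_lcomm M.r_neg)

lemma diff_split: "x \<in> carrier V \<Longrightarrow> y \<in> carrier V \<Longrightarrow> z \<in> carrier V \<Longrightarrow>
    x \<ominus>\<^bsub>V\<^esub> z = (x \<ominus>\<^bsub>V\<^esub> y) \<oplus>\<^bsub>V\<^esub> (y \<ominus>\<^bsub>V\<^esub> z)"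
  by (simp add: a_minus_def M.a_assoc M.r_neg2 M.r_neg1)

lemma vnorm_diff_triangle: "x \<in> carrier V \<Longrightarrow> y \<in> carrier V \<Longrightarrow> z \<in> carrier V \<Longrightarrow>
    vnorm V (x \<ominus>\<^bsub>V\<^esub> z) \<le> vnorm V (x \<ominus>\<^bsub>V\<^esub> y) + vnorm V (y \<ominus>\<^bsub>V\<^esub> z)"
  by (metis M.minus_closed diff_split vnorm_triangle)

lemma vnorm_le_diff: "x \<in> carrier V \<Longrightarrow> y \<in> carrier V \<Longrightarrow> vnorm V x \<le> vnorm V y + vnorm V (x \<ominus>\<^bsub>V\<^esub> y)"
  by (metis M.minus_closed add_diff_cancel vnorm_triangle)

lemma vnorm_diff_eq_zero: "x \<in> carrier V \<Longrightarrow> y \<in> carrier V \<Longrightarrow> vnorm V (x \<ominus>\<^bsub>V\<^esub> y) = 0 \<longleftrightarrow> x = y"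
  by (metis M.minus_closed M.r_neg M.r_zero a_minus_def add_diff_cancel vnorm_eq_zero)

lemma Metric_space_vdist: "Metric_space (carrier V) (vdist V)"
proof
  fix x y
  show "0 \<le> vdist V x y" by (simp add: vdist_def)
  show "vdist V x y = vdist V y x" by (simp add: vdist_def vnorm_diff_commute)
qed (auto simp: vdist_def vnorm_diff_eq_zero vnorm_diff_triangle)

lemma topspace_norm_topology [simp]: "topspace (norm_topology V) = carrier V"
  by (simp add: norm_topology_def Metric_space.topspace_mtopology[OF Metric_space_vdist])

lemma limitin_norm_topology:
  assumes "range s \<subseteq> carrier V"
  shows "limitin (norm_topology V) s l sequentially \<longleftrightarrow>
    l \<in> carrier V \<and> (\<lambda>n. vnorm V (s n \<ominus>\<^bsub>V\<^esub> l)) \<longlonglongrightarrow> 0"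
proof -
  have "s n \<in> carrier V" for n using assms by auto
  then show ?thesis
    unfolding norm_topology_def Metric_space.limit_metric_sequentially[OF Metric_space_vdist] LIMSEQ_iff
    by (auto simp: vdist_def)
qed

lemma MCauchy_vdist:
  assumes "range s \<subseteq> carrier V"
  shows "Metric_space.MCauchy (carrier V) (vdist V) s \<longleftrightarrow>
    (\<forall>e>0. \<exists>N. \<forall>m\<ge>N. \<forall>n\<ge>N. vnorm V (s m \<ominus>\<^bsub>V\<^esub> s n) < e)"
proof -
  have "s n \<in> carrier V" for n using assms by auto
  then show ?thesis
    using assms by (auto simp: Metric_space.MCauchy_def[OF Metric_space_vdist] vdist_def)
qed

lemma continuous_map_norm_topology:
  assumes W: "normed_space W" and f: "f \<in> carrier V \<rightarrow> carrier W"
  shows "continuous_map (norm_topology V) (norm_topology W) f \<longleftrightarrow>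
    (\<forall>x\<in>carrier V. \<forall>e>0. \<exists>d>0. \<forall>y\<in>carrier V. vnorm V (y \<ominus>\<^bsub>V\<^esub> x) < d \<longrightarrow> vnorm W (f y \<ominus>\<^bsub>W\<^esub> f x) < e)"
proof -
  interpret W: normed_space W by fact
  have fW: "x \<in> carrier V \<Longrightarrow> f x \<in> carrier W" for x using f by auto
  have "continuous_map (norm_topology V) (norm_topology W) f \<longleftrightarrow>
    (\<forall>x\<in>carrier V. \<forall>e>0. \<exists>d>0. \<forall>y. y \<in> carrier V \<and> vdist V x y < d \<longrightarrow> vdist W (f x) (f y) < e)"
    unfolding norm_topology_def
    by (subst Metric_space.metric_continuous_map[OF Metric_space_vdist W.Metric_space_vdist])
       (use f in auto)
  also have "\<dots> \<longleftrightarrow> (\<forall>x\<in>carrier V. \<forall>e>0. \<exists>d>0. \<forall>y\<in>carrier V. vnorm V (y \<ominus>\<^bsub>V\<^esub> x) < d \<longrightarrow> vnorm W (f y \<ominus>\<^bsub>W\<^esub> f x) < e)"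
    by (simp add: vdist_def fW vnorm_diff_commute W.vnorm_diff_commute cong: conj_cong ball_cong)
       (simp add: Ball_def imp_conjL vnorm_diff_commute)
  finally show ?thesis .
qed

lemma mbounded_imp_vnorm_bounded:
  assumes "Metric_space.mbounded (carrier V) (vdist V) B"
  obtains r where "r > 0" "\<And>x. x \<in> B \<Longrightarrow> vnorm V x \<le> r"
proof -
  interpret Metric_space "carrier V" "vdist V" by (rule Metric_space_vdist)
  obtain y b where b: "\<And>x. x \<in> B \<Longrightarrow> x \<in> carrier V \<and> vdist V y x \<le> b" "B = {} \<or> y \<in> carrier V"
    using assms unfolding mbounded by blast
  have "vnorm V x \<le> \<bar>vnorm V y\<bar> + \<bar>b\<bar> + 1" if "x \<in> B" for x
  proof -
    have xy: "x \<in> carrier V" "y \<in> carrier V" "vdist V y x \<le> b" using b that by auto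
    then show ?thesis using vnorm_le_diff[of x y] by (simp add: vdist_def vnorm_diff_commute)
  qed
  then show thesis by (intro that[of "\<bar>vnorm V y\<bar> + \<bar>b\<bar> + 1"]) auto
qed

end

text \<open>Continuity at zero bounds \<open>P\<close> on a small ball, and homogeneity scales the bound to all vectors.\<close>

lemma (in normed_space) homogeneous_continuous_imp_bounded:
  fixes W :: "('k::real_normed_field, 'b) normed_module"
  assumes W: "normed_space W" and P: "P \<in> carrier V \<rightarrow> carrier W" and k: "k \<ge> 1"
    and hom: "\<And>c x. x \<in> carrier V \<Longrightarrow> P (c \<odot>\<^bsub>V\<^esub> x) = (c ^ k) \<odot>\<^bsub>W\<^esub> P x"
    and cont: "continuous_map (norm_topology V) (norm_topology W) P"
  obtains C where "C \<ge> 0" "\<And>x. x \<in> carrier V \<Longrightarrow> vnorm W (P x) \<le> C * vnorm V x ^ k"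
proof -
  interpret W: normed_space W by fact
  have PW: "x \<in> carrier V \<Longrightarrow> P x \<in> carrier W" for x using P by auto
  have P0: "P \<zero>\<^bsub>V\<^esub> = \<zero>\<^bsub>W\<^esub>"
    using hom[of "\<zero>\<^bsub>V\<^esub>" 0] k PW by (simp add: power_0_left)
  obtain d where d0: "d > 0"
    and d1: "\<forall>y\<in>carrier V. vnorm V (y \<ominus>\<^bsub>V\<^esub> \<zero>\<^bsub>V\<^esub>) < d \<longrightarrow> vnorm W (P y \<ominus>\<^bsub>W\<^esub> P \<zero>\<^bsub>V\<^esub>) < 1"
    using cont[unfolded continuous_map_norm_topology[OF W P], rule_format, of "\<zero>\<^bsub>V\<^esub>" 1] by auto
  have d: "d > 0" "\<And>y. y \<in> carrier V \<Longrightarrow> vnorm V y < d \<Longrightarrow> vnorm W (P y) < 1"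
    using d0 d1 by (simp_all add: P0 PW)
  have "vnorm W (P x) \<le> (2 / d) ^ k * vnorm V x ^ k" if x: "x \<in> carrier V" for x
  proof (cases "vnorm V x = 0")
    case True
    then show ?thesis using x P0 k d(1) by (simp add: vnorm_eq_zero power_0_left)
  next
    case False
    then have pos: "vnorm V x > 0" using x by (simp add: less_le)
    let ?c = "of_real (d / (2 * vnorm V x)) :: 'k"
    have "vnorm V (?c \<odot>\<^bsub>V\<^esub> x) < d"
      using pos d(1) x by (simp add: vnorm_smult norm_divide norm_mult)
    then have "vnorm W (P (?c \<odot>\<^bsub>V\<^esub> x)) < 1" using d(2) x by simp
    then have "(d / (2 * vnorm V x)) ^ k * vnorm W (P x) < 1"
      using pos d(1) x by (simp add: hom W.vnorm_smult PW norm_power norm_divide norm_mult)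
    then show ?thesis using pos d(1) by (simp add: field_simps power_mult_distrib power_divide)
  qed
  then show thesis using d(1) by (intro that[of "(2 / d) ^ k"]) auto
qed

section \<open>Spaces of scalar maps and the dual space\<close>

lemma map_space_simps [simp]:
  "carrier (map_space S V W) = S"
  "zero (map_space S V W) = (\<lambda>x\<in>carrier V. \<zero>\<^bsub>W\<^esub>)"
  "add (map_space S V W) P Q = (\<lambda>x\<in>carrier V. P x \<oplus>\<^bsub>W\<^esub> Q x)"
  "smult (map_space S V W) c P = (\<lambda>x\<in>carrier V. c \<odot>\<^bsub>W\<^esub> P x)"
  "vnorm (map_space S V W) P = (SUP x\<in>unit_ball V. vnorm W (P x))"
  by (simp_all add: map_space_def)

text \<open>The common shape of continuous linear functionals and of continuous homogeneous polynomials,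
  on which the supremum norm is finite.\<close>

definition bounded_homogeneous :: "nat \<Rightarrow> ('k::real_normed_field, 'a) normed_module \<Rightarrow> ('a \<Rightarrow> 'k) \<Rightarrow> bool" where
  "bounded_homogeneous k V P \<longleftrightarrow> (\<forall>c. \<forall>x\<in>carrier V. P (c \<odot>\<^bsub>V\<^esub> x) = c ^ k * P x) \<and>
     (\<exists>C\<ge>0. \<forall>x\<in>carrier V. norm (P x) \<le> C * vnorm V x ^ k)"

context normed_space
begin

lemma zero_in_unit_ball: "\<zero>\<^bsub>V\<^esub> \<in> unit_ball V"
  by (simp add: unit_ball_def)

lemma sup_norm_least:
  assumes "\<And>x. x \<in> unit_ball V \<Longrightarrow> norm (P x) \<le> c"
  shows "(SUP x\<in>unit_ball V. norm (P x)) \<le> c"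
  using assms zero_in_unit_ball by (intro cSUP_least) auto

lemma sup_norm_upper:
  assumes P: "bounded_homogeneous k V P" and x: "x \<in> unit_ball V"
  shows "norm (P x) \<le> (SUP x\<in>unit_ball V. norm (P x))"
proof (rule cSUP_upper[OF x])
  obtain C where C: "C \<ge> 0" "\<And>x. x \<in> carrier V \<Longrightarrow> norm (P x) \<le> C * vnorm V x ^ k"
    using P by (auto simp: bounded_homogeneous_def)
  have "norm (P y) \<le> C" if "y \<in> unit_ball V" for y
  proof -
    have y: "y \<in> carrier V" "vnorm V y \<le> 1" using that by (auto simp: unit_ball_def)
    then have "C * vnorm V y ^ k \<le> C * 1"
      using C(1) by (intro mult_left_mono power_le_one) auto
    then show ?thesis using C(2)[OF y(1)] by simp
  qed
  then show "bdd_above ((\<lambda>x. norm (P x)) ` unit_ball V)" by (auto intro!: bdd_aboveI2)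
qed

lemma sup_norm_nonneg:
  assumes P: "bounded_homogeneous k V P"
  shows "0 \<le> (SUP x\<in>unit_ball V. norm (P x))"
  using sup_norm_upper[OF P zero_in_unit_ball] norm_ge_zero[of "P \<zero>\<^bsub>V\<^esub>"] by linarith

lemma normalize_vector:
  assumes "x \<in> carrier V" "vnorm V x \<noteq> 0"
  shows "of_real (inverse (vnorm V x)) \<odot>\<^bsub>V\<^esub> x \<in> unit_ball V"
  using assms vnorm_nonneg[of x] by (simp add: unit_ball_def vnorm_smult norm_inverse)

lemma norm_le_sup_norm:
  assumes P: "bounded_homogeneous k V P" and x: "x \<in> carrier V"
  shows "norm (P x) \<le> (SUP x\<in>unit_ball V. norm (P x)) * vnorm V x ^ k"
proof (cases "vnorm V x = 0")
  case True
  obtain C where C: "C \<ge> 0" "\<And>x. x \<in> carrier V \<Longrightarrow> norm (P x) \<le> C * vnorm V x ^ k"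
    using P by (auto simp: bounded_homogeneous_def)
  show ?thesis
  proof (cases "k = 0")
    case True
    have "x \<in> unit_ball V" using x \<open>vnorm V x = 0\<close> by (simp add: unit_ball_def)
    then show ?thesis using sup_norm_upper[OF P, of x] True by simp
  next
    case False
    then show ?thesis using C(2)[OF x] \<open>vnorm V x = 0\<close> by (simp add: power_0_left)
  qed
next
  case False
  then have pos: "vnorm V x > 0" using x by (simp add: less_le)
  let ?c = "of_real (inverse (vnorm V x)) :: 'k"
  have "norm (P (?c \<odot>\<^bsub>V\<^esub> x)) \<le> (SUP x\<in>unit_ball V. norm (P x))"
    by (rule sup_norm_upper[OF P normalize_vector[OF x False]])
  moreover have "P (?c \<odot>\<^bsub>V\<^esub> x) = ?c ^ k * P x"
    using P x by (simp add: bounded_homogeneous_def)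
  ultimately have "inverse (vnorm V x) ^ k * norm (P x) \<le> (SUP x\<in>unit_ball V. norm (P x))"
    using pos by (simp add: norm_mult norm_power norm_inverse)
  then show ?thesis using pos by (simp add: field_simps power_inverse)
qed

lemma normed_space_map_space:
  assumes ext: "S \<subseteq> extensional (carrier V)"
    and zero: "(\<lambda>x\<in>carrier V. 0) \<in> S"
    and add: "\<And>P Q. P \<in> S \<Longrightarrow> Q \<in> S \<Longrightarrow> (\<lambda>x\<in>carrier V. P x + Q x) \<in> S"
    and smult: "\<And>c P. P \<in> S \<Longrightarrow> (\<lambda>x\<in>carrier V. c * P x) \<in> S"
    and bh: "\<And>P. P \<in> S \<Longrightarrow> bounded_homogeneous k V P"
  shows "normed_space (map_space S V scalar_space)"
proof -
  let ?M = "map_space S V scalar_space"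
  have eqI: "P = Q" if "P \<in> extensional (carrier V)" "Q \<in> extensional (carrier V)"
    "\<And>x. x \<in> carrier V \<Longrightarrow> P x = Q x" for P Q :: "'a \<Rightarrow> 'k"
    using that by (rule extensionalityI)
  have group: "abelian_group ?M"
  proof (rule abelian_groupI)
    fix P assume P: "P \<in> carrier ?M"
    show "\<exists>Q\<in>carrier ?M. Q \<oplus>\<^bsub>?M\<^esub> P = \<zero>\<^bsub>?M\<^esub>"
    proof (rule bexI)
      show "(\<lambda>x\<in>carrier V. (-1) * P x) \<in> carrier ?M" using smult[of P "-1"] P by simp
    qed (auto simp: fun_eq_iff)
    show "\<zero>\<^bsub>?M\<^esub> \<oplus>\<^bsub>?M\<^esub> P = P"
      using P ext by (intro eqI) auto
  qed (use zero add in \<open>auto simp: fun_eq_iff add.assoc add.commute\<close>)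
  have "module scalar_field ?M"
  proof (rule moduleI[OF cring_scalar_field group])
    fix P assume P: "P \<in> carrier ?M"
    show "\<one>\<^bsub>scalar_field\<^esub> \<odot>\<^bsub>?M\<^esub> P = P" using P ext by (intro eqI) auto
  qed (use smult in \<open>auto simp: fun_eq_iff algebra_simps\<close>)
  moreover have "normed_space_axioms ?M"
  proof
    fix P assume P: "P \<in> carrier ?M"
    have up: "norm (P x) \<le> (SUP x\<in>unit_ball V. norm (P x)) * vnorm V x ^ k" if "x \<in> carrier V" for x
      using norm_le_sup_norm[OF bh that] P by simp
    show "vnorm ?M P = 0 \<longleftrightarrow> P = \<zero>\<^bsub>?M\<^esub>"
    proof
      assume "vnorm ?M P = 0"
      then have "P x = 0" if "x \<in> carrier V" for x using up[OF that] by simp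
      then show "P = \<zero>\<^bsub>?M\<^esub>" using P ext by (intro eqI) auto
    next
      assume z: "P = \<zero>\<^bsub>?M\<^esub>"
      have "(SUP x\<in>unit_ball V. norm (P x)) \<le> 0" by (rule sup_norm_least) (auto simp: z unit_ball_def)
      then show "vnorm ?M P = 0" using sup_norm_nonneg[OF bh] P by (simp add: order_antisym)
    qed
    show "vnorm ?M (c \<odot>\<^bsub>?M\<^esub> P) = norm c * vnorm ?M P" for c
    proof -
      have cP: "(\<lambda>x\<in>carrier V. c * P x) \<in> S" using smult P by simp
      have 1: "vnorm ?M (c \<odot>\<^bsub>?M\<^esub> P) \<le> norm c * vnorm ?M P"
        unfolding map_space_simps scalar_space_simps
        by (rule sup_norm_least)
           (use sup_norm_upper[OF bh, of P] P in \<open>auto simp: norm_mult unit_ball_def intro!: mult_left_mono\<close>)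
      show ?thesis
      proof (cases "c = 0")
        case True
        then show ?thesis using 1 sup_norm_nonneg[OF bh[OF cP]] by simp
      next
        case False
        have "vnorm ?M P \<le> vnorm ?M (c \<odot>\<^bsub>?M\<^esub> P) / norm c"
          unfolding map_space_simps scalar_space_simps
        proof (rule sup_norm_least)
          fix x assume x: "x \<in> unit_ball V"
          have "norm c * norm (P x) \<le> (SUP x\<in>unit_ball V. norm ((\<lambda>x\<in>carrier V. c * P x) x))"
            using sup_norm_upper[OF bh[OF cP] x] x by (simp add: norm_mult unit_ball_def)
          then show "norm (P x) \<le> (SUP x\<in>unit_ball V. norm ((\<lambda>x\<in>carrier V. c * P x) x)) / norm c"
            using False by (simp add: field_simps)
        qed
        then show ?thesis using 1 False by (simp add: field_simps)
      qed
    qed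
    fix Q assume Q: "Q \<in> carrier ?M"
    show "vnorm ?M (P \<oplus>\<^bsub>?M\<^esub> Q) \<le> vnorm ?M P + vnorm ?M Q"
      unfolding map_space_simps scalar_space_simps
    proof (rule sup_norm_least)
      fix x assume x: "x \<in> unit_ball V"
      then show "norm ((\<lambda>x\<in>carrier V. P x + Q x) x) \<le>
          (SUP x\<in>unit_ball V. norm (P x)) + (SUP x\<in>unit_ball V. norm (Q x))"
        using sup_norm_upper[OF bh x, of P] sup_norm_upper[OF bh x, of Q] P Q
          norm_triangle_ineq[of "P x" "Q x"] by (simp add: unit_ball_def)
    qed
  qed
  ultimately show ?thesis by (simp add: normed_space_def)
qed

end

lemma linear_mapD:
  assumes "linear_map V W f"
  shows "x \<in> carrier V \<Longrightarrow> f x \<in> carrier W"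
    and "x \<in> carrier V \<Longrightarrow> y \<in> carrier V \<Longrightarrow> f (x \<oplus>\<^bsub>V\<^esub> y) = f x \<oplus>\<^bsub>W\<^esub> f y"
    and "x \<in> carrier V \<Longrightarrow> f (c \<odot>\<^bsub>V\<^esub> x) = c \<odot>\<^bsub>W\<^esub> f x"
  using assms by (auto simp: linear_map_def)

context normed_space
begin

lemma linear_map_diff:
  assumes f: "linear_map V W f" and W: "normed_space W" and x: "x \<in> carrier V" "y \<in> carrier V"
  shows "f (x \<ominus>\<^bsub>V\<^esub> y) = f x \<ominus>\<^bsub>W\<^esub> f y"
proof -
  interpret W: normed_space W by fact
  show ?thesis using x linear_mapD[OF f] by (simp add: diff_eq_smult W.diff_eq_smult)
qed

lemma linear_map_zero:
  assumes f: "linear_map V W f" and W: "normed_space W"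
  shows "f \<zero>\<^bsub>V\<^esub> = \<zero>\<^bsub>W\<^esub>"
proof -
  interpret W: normed_space W by fact
  show ?thesis using linear_mapD(3)[OF f, of "\<zero>\<^bsub>V\<^esub>" 0] linear_mapD(1)[OF f, of "\<zero>\<^bsub>V\<^esub>"] by simp
qed

lemma linear_map_finsum:
  assumes f: "linear_map V W f" and W: "normed_space W" and u: "u \<in> I \<rightarrow> carrier V"
    and I: "finite I"
  shows "f (\<Oplus>\<^bsub>V\<^esub>i\<in>I. u i) = (\<Oplus>\<^bsub>W\<^esub>i\<in>I. f (u i))"
proof -
  interpret W: normed_space W by fact
  show ?thesis using I u
  proof (induction I)
    case empty
    then show ?case by (simp add: linear_map_zero[OF f W])
  next
    case (insert i I)
    have c: "u \<in> I \<rightarrow> carrier V" "u i \<in> carrier V" using insert.prems by auto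
    have d: "(\<lambda>i. f (u i)) \<in> I \<rightarrow> carrier W" "f (u i) \<in> carrier W"
      using c linear_mapD(1)[OF f] by auto
    show ?case using insert c d
      by (simp add: M.finsum_insert W.M.finsum_insert linear_mapD(2)[OF f] M.finsum_closed)
  qed
qed

lemma linear_bounded_imp_continuous:
  assumes f: "linear_map V W f" and W: "normed_space W"
    and C: "\<And>x. x \<in> carrier V \<Longrightarrow> vnorm W (f x) \<le> C * vnorm V x"
  shows "continuous_map (norm_topology V) (norm_topology W) f"
proof -
  interpret W: normed_space W by fact
  have fW: "f \<in> carrier V \<rightarrow> carrier W" using f by (simp add: linear_map_def)
  show ?thesis unfolding continuous_map_norm_topology[OF W fW]
  proof (intro ballI allI impI)
    fix x and e :: real assume x: "x \<in> carrier V" and e: "e > 0"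
    show "\<exists>d>0. \<forall>y\<in>carrier V. vnorm V (y \<ominus>\<^bsub>V\<^esub> x) < d \<longrightarrow> vnorm W (f y \<ominus>\<^bsub>W\<^esub> f x) < e"
    proof (intro exI[of _ "e / (\<bar>C\<bar> + 1)"] conjI ballI impI)
      show "e / (\<bar>C\<bar> + 1) > 0" using e by simp
      fix y assume y: "y \<in> carrier V" and d: "vnorm V (y \<ominus>\<^bsub>V\<^esub> x) < e / (\<bar>C\<bar> + 1)"
      have "vnorm W (f y \<ominus>\<^bsub>W\<^esub> f x) \<le> C * vnorm V (y \<ominus>\<^bsub>V\<^esub> x)"
        using C[of "y \<ominus>\<^bsub>V\<^esub> x"] x y by (simp add: linear_map_diff[OF f W])
      also have "\<dots> \<le> (\<bar>C\<bar> + 1) * vnorm V (y \<ominus>\<^bsub>V\<^esub> x)"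
        using x y by (intro mult_right_mono) auto
      also have "\<dots> < e" using d by (simp add: field_simps)
      finally show "vnorm W (f y \<ominus>\<^bsub>W\<^esub> f x) < e" .
    qed
  qed
qed

end

lemma finsum_scalar_space [simp]:
  "finite I \<Longrightarrow> finsum (scalar_space :: ('k::real_normed_field,'k) normed_module) u I = (\<Sum>i\<in>I. u i)"
proof (induction I rule: finite_induct)
  case empty
  interpret normed_space "scalar_space :: ('k,'k) normed_module" by (rule normed_space_scalar_space)
  show ?case using M.finsum_empty by simp
next
  case (insert i I)
  interpret normed_space "scalar_space :: ('k,'k) normed_module" by (rule normed_space_scalar_space)
  show ?case using insert M.finsum_insert[of I i u] by simp
qed

context normed_space
begin

lemma in_dual_iff: "f \<in> carrier (dual V) \<longleftrightarrow> f \<in> extensional (carrier V) \<and>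
    linear_map V scalar_space f \<and> (\<exists>C. \<forall>x\<in>carrier V. norm (f x) \<le> C * vnorm V x)"
proof -
  have "continuous_map (norm_topology V) (norm_topology scalar_space) f \<longleftrightarrow>
      (\<exists>C. \<forall>x\<in>carrier V. norm (f x) \<le> C * vnorm V x)" if f: "linear_map V scalar_space f"
  proof
    assume cont: "continuous_map (norm_topology V) (norm_topology scalar_space) f"
    obtain C where "C \<ge> 0" "\<And>x. x \<in> carrier V \<Longrightarrow> vnorm scalar_space (f x) \<le> C * vnorm V x ^ 1"
      by (rule homogeneous_continuous_imp_bounded[OF normed_space_scalar_space _ _ _ cont, of 1])
         (use linear_mapD[OF f] in auto)
    then show "\<exists>C. \<forall>x\<in>carrier V. norm (f x) \<le> C * vnorm V x" by auto
  next
    assume "\<exists>C. \<forall>x\<in>carrier V. norm (f x) \<le> C * vnorm V x"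
    then show "continuous_map (norm_topology V) (norm_topology scalar_space) f"
      using linear_bounded_imp_continuous[OF f normed_space_scalar_space] by auto
  qed
  then show ?thesis by (auto simp: dual_def)
qed

lemma dual_linear: "f \<in> carrier (dual V) \<Longrightarrow> linear_map V scalar_space f"
  by (simp add: in_dual_iff)

lemma dual_add: "f \<in> carrier (dual V) \<Longrightarrow> x \<in> carrier V \<Longrightarrow> y \<in> carrier V \<Longrightarrow> f (x \<oplus>\<^bsub>V\<^esub> y) = f x + f y"
  using linear_mapD(2)[OF dual_linear, of f x y] by simp

lemma dual_smult: "f \<in> carrier (dual V) \<Longrightarrow> x \<in> carrier V \<Longrightarrow> f (c \<odot>\<^bsub>V\<^esub> x) = c * f x"
  using linear_mapD(3)[OF dual_linear, of f x c] by simp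

lemma dual_diff: "f \<in> carrier (dual V) \<Longrightarrow> x \<in> carrier V \<Longrightarrow> y \<in> carrier V \<Longrightarrow> f (x \<ominus>\<^bsub>V\<^esub> y) = f x - f y"
  using linear_map_diff[OF dual_linear normed_space_scalar_space, of f x y] by simp

lemma dual_zero: "f \<in> carrier (dual V) \<Longrightarrow> f \<zero>\<^bsub>V\<^esub> = 0"
  using linear_map_zero[OF dual_linear normed_space_scalar_space, of f] by simp

lemma dual_finsum: "f \<in> carrier (dual V) \<Longrightarrow> finite I \<Longrightarrow> u \<in> I \<rightarrow> carrier V \<Longrightarrow>
    f (\<Oplus>\<^bsub>V\<^esub>i\<in>I. u i) = (\<Sum>i\<in>I. f (u i))"
  using linear_map_finsum[OF dual_linear normed_space_scalar_space, of f u I] by simp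

lemma dual_bounded_homogeneous: "f \<in> carrier (dual V) \<Longrightarrow> bounded_homogeneous 1 V f"
proof -
  assume f: "f \<in> carrier (dual V)"
  obtain C where C: "\<And>x. x \<in> carrier V \<Longrightarrow> norm (f x) \<le> C * vnorm V x"
    using f by (auto simp: in_dual_iff)
  have "norm (f x) \<le> \<bar>C\<bar> * vnorm V x" if "x \<in> carrier V" for x
    using C[OF that] mult_right_mono[OF abs_ge_self[of C] vnorm_nonneg[OF that]] by linarith
  then show ?thesis using dual_smult[OF f] by (auto simp: bounded_homogeneous_def intro!: exI[of _ "\<bar>C\<bar>"])
qed

lemma dual_simps:
  "\<zero>\<^bsub>dual V\<^esub> = (\<lambda>x\<in>carrier V. 0)"
  "f \<oplus>\<^bsub>dual V\<^esub> g = (\<lambda>x\<in>carrier V. f x + g x)"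
  "c \<odot>\<^bsub>dual V\<^esub> f = (\<lambda>x\<in>carrier V. c * f x)"
  "vnorm (dual V) f = (SUP x\<in>unit_ball V. norm (f x))"
  by (simp_all add: dual_def)

lemma normed_space_dual: "normed_space (dual V)"
proof -
  have carr: "dual V = map_space (carrier (dual V)) V scalar_space" by (simp add: dual_def)
  show ?thesis
  proof (subst carr, rule normed_space_map_space[where k = 1])
    show "(\<lambda>x\<in>carrier V. 0) \<in> carrier (dual V)"
      by (auto simp: in_dual_iff linear_map_def intro!: exI[of _ 0])
  next
    fix f g assume fg: "f \<in> carrier (dual V)" "g \<in> carrier (dual V)"
    obtain C where C: "\<And>x. x \<in> carrier V \<Longrightarrow> norm (f x) \<le> C * vnorm V x"
      using fg(1) by (auto simp: in_dual_iff)
    obtain D where D: "\<And>x. x \<in> carrier V \<Longrightarrow> norm (g x) \<le> D * vnorm V x"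
      using fg(2) by (auto simp: in_dual_iff)
    have "norm (f x + g x) \<le> (C + D) * vnorm V x" if "x \<in> carrier V" for x
      using C[OF that] D[OF that] norm_triangle_ineq[of "f x" "g x"] by (simp add: distrib_right)
    then show "(\<lambda>x\<in>carrier V. f x + g x) \<in> carrier (dual V)"
      using fg by (auto simp: in_dual_iff linear_map_def algebra_simps intro!: exI[of _ "C + D"])
  next
    fix c f assume f: "f \<in> carrier (dual V)"
    obtain C where C: "\<And>x. x \<in> carrier V \<Longrightarrow> norm (f x) \<le> C * vnorm V x"
      using f by (auto simp: in_dual_iff)
    have "norm (c * f x) \<le> (norm c * C) * vnorm V x" if "x \<in> carrier V" for x
      using mult_left_mono[OF C[OF that], of "norm c"] by (simp add: norm_mult)
    then show "(\<lambda>x\<in>carrier V. c * f x) \<in> carrier (dual V)"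
      using f by (auto simp: in_dual_iff linear_map_def algebra_simps intro!: exI[of _ "norm c * C"])
  next
    show "carrier (dual V) \<subseteq> extensional (carrier V)" by (auto simp: in_dual_iff)
  qed (rule dual_bounded_homogeneous)
qed

lemma dual_norm_le: "f \<in> carrier (dual V) \<Longrightarrow> x \<in> carrier V \<Longrightarrow> norm (f x) \<le> vnorm (dual V) f * vnorm V x"
  using norm_le_sup_norm[OF dual_bounded_homogeneous, of f x] by (simp add: dual_simps)

lemma dual_norm_least: "(\<And>x. x \<in> unit_ball V \<Longrightarrow> norm (f x) \<le> c) \<Longrightarrow> vnorm (dual V) f \<le> c"
  using sup_norm_least[of f c] by (simp add: dual_simps)

lemma dualI:
  assumes "\<And>x y. x \<in> carrier V \<Longrightarrow> y \<in> carrier V \<Longrightarrow> f (x \<oplus>\<^bsub>V\<^esub> y) = f x + f y"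
    and "\<And>c x. x \<in> carrier V \<Longrightarrow> f (c \<odot>\<^bsub>V\<^esub> x) = c * f x"
    and "\<And>x. x \<in> carrier V \<Longrightarrow> norm (f x) \<le> C * vnorm V x"
  shows "(\<lambda>x\<in>carrier V. f x) \<in> carrier (dual V)"
  using assms by (auto simp: in_dual_iff linear_map_def intro!: exI[of _ C])

lemma dual_diff_apply:
  "f \<in> carrier (dual V) \<Longrightarrow> g \<in> carrier (dual V) \<Longrightarrow> x \<in> carrier V \<Longrightarrow> (f \<ominus>\<^bsub>dual V\<^esub> g) x = f x - g x"
  using normed_space.diff_eq_smult[OF normed_space_dual, of f g] by (simp add: dual_simps)

lemma eval_in_bidual:
  assumes x: "x \<in> carrier V"
  shows "(\<lambda>f\<in>carrier (dual V). f x) \<in> carrier (dual (dual V))"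
proof -
  interpret D: normed_space "dual V" by (rule normed_space_dual)
  show ?thesis
  proof (rule D.dualI)
    show "norm (f x) \<le> vnorm V x * vnorm (dual V) f" if "f \<in> carrier (dual V)" for f
      using dual_norm_le[OF that x] by (simp add: mult.commute)
  qed (simp_all add: dual_simps x)
qed

end

text \<open>The Cauchy condition is uniform on the unit ball, so it passes to the pointwise limit of a
  sequence of functionals and makes that limit a limit in norm.\<close>

lemma (in normed_space) banach_space_dual:
  assumes complete_scalars: "complete (UNIV :: 'k set)"
  shows "banach_space (dual V)"
proof -
  interpret D: normed_space "dual V" by (rule normed_space_dual)
  have "\<exists>f. limitin (norm_topology (dual V)) s f sequentially"
    if s: "Metric_space.MCauchy (carrier (dual V)) (vdist (dual V)) s" for s
  proof -
    have ran: "range s \<subseteq> carrier (dual V)"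
      using s by (simp add: Metric_space.MCauchy_def[OF D.Metric_space_vdist])
    then have sD: "s n \<in> carrier (dual V)" for n by auto
    have cau: "\<exists>N. \<forall>m\<ge>N. \<forall>n\<ge>N. vnorm (dual V) (s m \<ominus>\<^bsub>dual V\<^esub> s n) < e" if "e > 0" for e
      using s that unfolding D.MCauchy_vdist[OF ran] by blast
    have le: "norm (s m x - s n x) \<le> vnorm (dual V) (s m \<ominus>\<^bsub>dual V\<^esub> s n) * vnorm V x"
      if "x \<in> carrier V" for m n x
      using dual_norm_le[of "s m \<ominus>\<^bsub>dual V\<^esub> s n" x] that sD by (simp add: dual_diff_apply)
    define f where "f = (\<lambda>x. lim (\<lambda>n. s n x))"
    have lim: "(\<lambda>n. s n x) \<longlonglongrightarrow> f x" if x: "x \<in> carrier V" for x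
    proof -
      have "Cauchy (\<lambda>n. s n x)"
      proof (rule CauchyI)
        fix e :: real assume e: "e > 0"
        have "e / (vnorm V x + 1) > 0" using e x by (simp add: add_nonneg_pos)
        from cau[OF this] obtain N where
          N: "\<And>m n. m \<ge> N \<Longrightarrow> n \<ge> N \<Longrightarrow> vnorm (dual V) (s m \<ominus>\<^bsub>dual V\<^esub> s n) < e / (vnorm V x + 1)" by blast
        have "norm (s m x - s n x) < e" if "m \<ge> N" "n \<ge> N" for m n
        proof -
          have "norm (s m x - s n x) \<le> vnorm (dual V) (s m \<ominus>\<^bsub>dual V\<^esub> s n) * (vnorm V x + 1)"
            using le[OF x, of m n] sD by (simp add: distrib_left add_increasing2)
          also have "\<dots> < e" using N[OF that] x by (simp add: pos_less_divide_eq add_nonneg_pos)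
          finally show ?thesis .
        qed
        then show "\<exists>M. \<forall>m\<ge>M. \<forall>n\<ge>M. norm (s m x - s n x) < e" by blast
      qed
      then have "convergent (\<lambda>n. s n x)"
        using complete_scalars by (auto simp: complete_def convergent_def)
      then show ?thesis by (simp add: f_def convergent_LIMSEQ_iff)
    qed
    have tail: "norm (s n x - f x) \<le> e * vnorm V x"
      if N: "\<And>m n. m \<ge> N \<Longrightarrow> n \<ge> N \<Longrightarrow> vnorm (dual V) (s m \<ominus>\<^bsub>dual V\<^esub> s n) < e"
        and n: "n \<ge> N" and x: "x \<in> carrier V" for N e n x
    proof (rule LIMSEQ_le_const2)
      show "(\<lambda>m. norm (s n x - s m x)) \<longlonglongrightarrow> norm (s n x - f x)"
        by (intro tendsto_intros lim x)
      have "norm (s n x - s m x) \<le> e * vnorm V x" if "m \<ge> N" for m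
        using le[OF x, of n m] mult_right_mono[OF less_imp_le[OF N[OF n that]] vnorm_nonneg[OF x]]
        by linarith
      then show "\<exists>N. \<forall>m\<ge>N. norm (s n x - s m x) \<le> e * vnorm V x" by blast
    qed
    have fD: "(\<lambda>x\<in>carrier V. f x) \<in> carrier (dual V)"
    proof -
      obtain N where N: "\<And>m n. m \<ge> N \<Longrightarrow> n \<ge> N \<Longrightarrow> vnorm (dual V) (s m \<ominus>\<^bsub>dual V\<^esub> s n) < 1"
        using cau[of 1] by auto
      show ?thesis
      proof (rule dualI)
        fix x y assume xy: "x \<in> carrier V" "y \<in> carrier V"
        have "(\<lambda>n. s n (x \<oplus>\<^bsub>V\<^esub> y)) \<longlonglongrightarrow> f x + f y"
          using tendsto_add[OF lim[OF xy(1)] lim[OF xy(2)]] xy sD by (simp add: dual_add)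
        then show "f (x \<oplus>\<^bsub>V\<^esub> y) = f x + f y" using LIMSEQ_unique lim[of "x \<oplus>\<^bsub>V\<^esub> y"] xy by simp blast
      next
        fix c x assume x: "x \<in> carrier V"
        have "(\<lambda>n. s n (c \<odot>\<^bsub>V\<^esub> x)) \<longlonglongrightarrow> c * f x"
          using tendsto_mult_left[OF lim[OF x], of c] x sD by (simp add: dual_smult)
        then show "f (c \<odot>\<^bsub>V\<^esub> x) = c * f x" using LIMSEQ_unique lim[of "c \<odot>\<^bsub>V\<^esub> x"] x by simp blast
      next
        fix x assume x: "x \<in> carrier V"
        have "norm (f x) \<le> norm (s N x) + norm (s N x - f x)"
          using norm_triangle_ineq4[of "s N x" "s N x - f x"] by simp
        also have "\<dots> \<le> vnorm (dual V) (s N) * vnorm V x + 1 * vnorm V x"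
          using tail[OF N order_refl x] dual_norm_le[OF sD[of N] x] by (intro add_mono) auto
        finally show "norm (f x) \<le> (vnorm (dual V) (s N) + 1) * vnorm V x" by (simp add: distrib_right)
      qed
    qed
    have "(\<lambda>n. vnorm (dual V) (s n \<ominus>\<^bsub>dual V\<^esub> (\<lambda>x\<in>carrier V. f x))) \<longlonglongrightarrow> 0"
    proof (rule LIMSEQ_I)
      fix e :: real assume e: "e > 0"
      obtain N where N: "\<And>m n. m \<ge> N \<Longrightarrow> n \<ge> N \<Longrightarrow> vnorm (dual V) (s m \<ominus>\<^bsub>dual V\<^esub> s n) < e / 2"
        using cau[of "e / 2"] e by auto
      have "vnorm (dual V) (s n \<ominus>\<^bsub>dual V\<^esub> (\<lambda>x\<in>carrier V. f x)) \<le> e / 2" if "n \<ge> N" for n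
      proof (rule dual_norm_least)
        fix x assume x: "x \<in> unit_ball V"
        then have xV: "x \<in> carrier V" "vnorm V x \<le> 1" by (auto simp: unit_ball_def)
        have "norm (s n x - f x) \<le> e / 2"
          using tail[OF N that xV(1)] mult_left_mono[OF xV(2), of "e / 2"] e by linarith
        then show "norm ((s n \<ominus>\<^bsub>dual V\<^esub> (\<lambda>x\<in>carrier V. f x)) x) \<le> e / 2"
          using xV sD fD by (simp add: dual_diff_apply)
      qed
      then have "norm (vnorm (dual V) (s n \<ominus>\<^bsub>dual V\<^esub> (\<lambda>x\<in>carrier V. f x)) - 0) < e" if "n \<ge> N" for n
        using that e D.vnorm_nonneg[of "s n \<ominus>\<^bsub>dual V\<^esub> (\<lambda>x\<in>carrier V. f x)"] sD fD
        by (fastforce intro: le_less_trans)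
      then show "\<exists>no. \<forall>n\<ge>no. norm (vnorm (dual V) (s n \<ominus>\<^bsub>dual V\<^esub> (\<lambda>x\<in>carrier V. f x)) - 0) < e" by blast
    qed
    then show ?thesis using D.limitin_norm_topology[OF ran] fD by blast
  qed
  then show ?thesis
    unfolding banach_space_def banach_space_axioms_def Metric_space.mcomplete_def[OF D.Metric_space_vdist]
    using normed_space_dual by (auto simp: norm_topology_def)
qed

section \<open>Hahn-Banach\<close>

text \<open>A minimal sublinear functional is linear, and Zorn's lemma finds a minimal one below any given one.
  All functionals here are defined on the whole space: prescribed values are imposed by first lowering
  the sublinear functional.\<close>

definition sublinear :: "(real, 'a, 'm) module_scheme \<Rightarrow> ('a \<Rightarrow> real) \<Rightarrow> bool" where
  "sublinear W p \<longleftrightarrow> (\<forall>x\<in>carrier W. \<forall>y\<in>carrier W. p (x \<oplus>\<^bsub>W\<^esub> y) \<le> p x + p y) \<and>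
     (\<forall>t\<ge>0. \<forall>x\<in>carrier W. p (t \<odot>\<^bsub>W\<^esub> x) = t * p x)"

locale real_module = module scalar_field W for W :: "(real, 'a, 'm) module_scheme"
begin

lemma smult_simps [simp]:
  "x \<in> carrier W \<Longrightarrow> 0 \<odot>\<^bsub>W\<^esub> x = \<zero>\<^bsub>W\<^esub>"
  "x \<in> carrier W \<Longrightarrow> 1 \<odot>\<^bsub>W\<^esub> x = x"
  "c \<odot>\<^bsub>W\<^esub> \<zero>\<^bsub>W\<^esub> = \<zero>\<^bsub>W\<^esub>"
  "x \<in> carrier W \<Longrightarrow> c \<odot>\<^bsub>W\<^esub> x \<in> carrier W"
  using smult_l_null[of x] smult_one[of x] smult_r_null[of c] smult_closed[of c x] by simp_all

lemma smult_add: "x \<in> carrier W \<Longrightarrow> y \<in> carrier W \<Longrightarrow> c \<odot>\<^bsub>W\<^esub> (x \<oplus>\<^bsub>W\<^esub> y) = c \<odot>\<^bsub>W\<^esub> x \<oplus>\<^bsub>W\<^esub> c \<odot>\<^bsub>W\<^esub> y"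
  using smult_r_distr[of c x y] by simp

lemma add_smult: "x \<in> carrier W \<Longrightarrow> (a + b) \<odot>\<^bsub>W\<^esub> x = a \<odot>\<^bsub>W\<^esub> x \<oplus>\<^bsub>W\<^esub> b \<odot>\<^bsub>W\<^esub> x"
  using smult_l_distr[of a b x] by simp

lemma smult_smult: "x \<in> carrier W \<Longrightarrow> a \<odot>\<^bsub>W\<^esub> (b \<odot>\<^bsub>W\<^esub> x) = (a * b) \<odot>\<^bsub>W\<^esub> x"
  using smult_assoc1[of a b x] by simp

lemma minus_smult: "x \<in> carrier W \<Longrightarrow> (- c) \<odot>\<^bsub>W\<^esub> x = \<ominus>\<^bsub>W\<^esub> (c \<odot>\<^bsub>W\<^esub> x)"
  using add_smult[of x c "- c"] by (simp add: M.minus_equality[symmetric] M.a_comm)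

lemma sublinearD:
  assumes "sublinear W p"
  shows "x \<in> carrier W \<Longrightarrow> y \<in> carrier W \<Longrightarrow> p (x \<oplus>\<^bsub>W\<^esub> y) \<le> p x + p y"
    and "0 \<le> t \<Longrightarrow> x \<in> carrier W \<Longrightarrow> p (t \<odot>\<^bsub>W\<^esub> x) = t * p x"
    and "p \<zero>\<^bsub>W\<^esub> = 0"
    and "x \<in> carrier W \<Longrightarrow> - p (\<ominus>\<^bsub>W\<^esub> x) \<le> p x"
proof -
  show 1: "x \<in> carrier W \<Longrightarrow> y \<in> carrier W \<Longrightarrow> p (x \<oplus>\<^bsub>W\<^esub> y) \<le> p x + p y"
    and "0 \<le> t \<Longrightarrow> x \<in> carrier W \<Longrightarrow> p (t \<odot>\<^bsub>W\<^esub> x) = t * p x" for x y t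
    using assms by (auto simp: sublinear_def)
  show 0: "p \<zero>\<^bsub>W\<^esub> = 0"
    using assms unfolding sublinear_def by (metis M.zero_closed mult_zero_left order_refl smult_simps(1))
  show "x \<in> carrier W \<Longrightarrow> - p (\<ominus>\<^bsub>W\<^esub> x) \<le> p x"
    using 1[of x "\<ominus>\<^bsub>W\<^esub> x"] 0 by (simp add: M.r_neg)
qed

lemma sublinearI:
  assumes add: "\<And>x y. x \<in> carrier W \<Longrightarrow> y \<in> carrier W \<Longrightarrow> p (x \<oplus>\<^bsub>W\<^esub> y) \<le> p x + p y"
    and zero: "p \<zero>\<^bsub>W\<^esub> = 0"
    and smult: "\<And>t x. 0 < t \<Longrightarrow> x \<in> carrier W \<Longrightarrow> p (t \<odot>\<^bsub>W\<^esub> x) \<le> t * p x"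
  shows "sublinear W p"
proof -
  have "p (t \<odot>\<^bsub>W\<^esub> x) = t * p x" if t: "t \<ge> 0" and x: "x \<in> carrier W" for t x
  proof (cases "t = 0")
    case False
    then have t: "t > 0" using t by simp
    have "p x \<le> inverse t * p (t \<odot>\<^bsub>W\<^esub> x)"
      using smult[of "inverse t" "t \<odot>\<^bsub>W\<^esub> x"] t x by (simp add: smult_smult)
    then show ?thesis using smult[OF t x] t by (simp add: field_simps)
  qed (use zero x in simp)
  then show ?thesis using add by (simp add: sublinear_def)
qed

text \<open>Any linear functional below the lowered \<open>q\<close> is at least \<open>\<alpha>\<close> at \<open>u\<close> for each pair of the cone. The
  hypothesis \<open>\<alpha> \<le> p u\<close> keeps the infimum that defines \<open>q\<close> finite.\<close>

lemma sublinear_below_cone: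
  assumes p: "sublinear W p"
    and P: "\<And>u \<alpha>. (u, \<alpha>) \<in> P \<Longrightarrow> u \<in> carrier W" "\<And>u \<alpha>. (u, \<alpha>) \<in> P \<Longrightarrow> \<alpha> \<le> p u"
    and P_zero: "(\<zero>\<^bsub>W\<^esub>, 0) \<in> P"
    and P_add: "\<And>u \<alpha> v \<beta>. (u, \<alpha>) \<in> P \<Longrightarrow> (v, \<beta>) \<in> P \<Longrightarrow> (u \<oplus>\<^bsub>W\<^esub> v, \<alpha> + \<beta>) \<in> P"
    and P_smult: "\<And>t u \<alpha>. 0 < t \<Longrightarrow> (u, \<alpha>) \<in> P \<Longrightarrow> (t \<odot>\<^bsub>W\<^esub> u, t * \<alpha>) \<in> P"
  obtains q where "sublinear W q" "\<And>x. x \<in> carrier W \<Longrightarrow> q x \<le> p x"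
    "\<And>u \<alpha>. (u, \<alpha>) \<in> P \<Longrightarrow> q (\<ominus>\<^bsub>W\<^esub> u) \<le> - \<alpha>"
proof -
  define q where "q x = (INF (u, \<alpha>)\<in>P. p (x \<oplus>\<^bsub>W\<^esub> u) - \<alpha>)" for x
  have low: "- p (\<ominus>\<^bsub>W\<^esub> x) \<le> p (x \<oplus>\<^bsub>W\<^esub> u) - \<alpha>" if "(u, \<alpha>) \<in> P" "x \<in> carrier W" for u \<alpha> x
  proof -
    have u: "u \<in> carrier W" "\<alpha> \<le> p u" using P that by auto
    have "u = (x \<oplus>\<^bsub>W\<^esub> u) \<oplus>\<^bsub>W\<^esub> \<ominus>\<^bsub>W\<^esub> x"
      using that u by (simp add: M.a_ac M.r_neg2 M.r_neg)
    then have "\<alpha> \<le> p (x \<oplus>\<^bsub>W\<^esub> u) + p (\<ominus>\<^bsub>W\<^esub> x)"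
      using sublinearD(1)[OF p, of "x \<oplus>\<^bsub>W\<^esub> u" "\<ominus>\<^bsub>W\<^esub> x"] that u by simp
    then show ?thesis by simp
  qed
  have le: "q x \<le> p (x \<oplus>\<^bsub>W\<^esub> u) - \<alpha>" if "(u, \<alpha>) \<in> P" "x \<in> carrier W" for u \<alpha> x
  proof -
    have "bdd_below ((\<lambda>(u, \<alpha>). p (x \<oplus>\<^bsub>W\<^esub> u) - \<alpha>) ` P)"
      using low that(2) by (auto intro!: bdd_belowI2[where m = "- p (\<ominus>\<^bsub>W\<^esub> x)"])
    from cINF_lower[OF this that(1)] show ?thesis by (simp add: q_def)
  qed
  have ge: "c \<le> q x" if "\<And>u \<alpha>. (u, \<alpha>) \<in> P \<Longrightarrow> c \<le> p (x \<oplus>\<^bsub>W\<^esub> u) - \<alpha>" for c x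
    unfolding q_def using that P_zero by (intro cINF_greatest) auto
  have "sublinear W q"
  proof (rule sublinearI)
    fix x y assume xy: "x \<in> carrier W" "y \<in> carrier W"
    have *: "q (x \<oplus>\<^bsub>W\<^esub> y) \<le> (p (x \<oplus>\<^bsub>W\<^esub> u) - \<alpha>) + (p (y \<oplus>\<^bsub>W\<^esub> v) - \<beta>)"
      if uv: "(u, \<alpha>) \<in> P" "(v, \<beta>) \<in> P" for u \<alpha> v \<beta>
    proof -
      have uvW: "u \<in> carrier W" "v \<in> carrier W" using P uv by auto
      have "(x \<oplus>\<^bsub>W\<^esub> y) \<oplus>\<^bsub>W\<^esub> (u \<oplus>\<^bsub>W\<^esub> v) = (x \<oplus>\<^bsub>W\<^esub> u) \<oplus>\<^bsub>W\<^esub> (y \<oplus>\<^bsub>W\<^esub> v)"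
        using xy uvW by (simp add: M.a_ac)
      then show ?thesis
        using le[OF P_add[OF uv], of "x \<oplus>\<^bsub>W\<^esub> y"] sublinearD(1)[OF p, of "x \<oplus>\<^bsub>W\<^esub> u" "y \<oplus>\<^bsub>W\<^esub> v"] xy uvW
        by simp
    qed
    have "q (x \<oplus>\<^bsub>W\<^esub> y) - (p (x \<oplus>\<^bsub>W\<^esub> u) - \<alpha>) \<le> q y" if "(u, \<alpha>) \<in> P" for u \<alpha>
      by (rule ge) (use *[OF that] in \<open>simp add: algebra_simps\<close>)
    then have "q (x \<oplus>\<^bsub>W\<^esub> y) - q y \<le> q x"
      by (intro ge) (simp add: algebra_simps)
    then show "q (x \<oplus>\<^bsub>W\<^esub> y) \<le> q x + q y" by simp
  next
    have "q \<zero>\<^bsub>W\<^esub> \<le> 0" using le[OF P_zero, of "\<zero>\<^bsub>W\<^esub>"] sublinearD(3)[OF p] by simp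
    moreover have "0 \<le> q \<zero>\<^bsub>W\<^esub>" by (rule ge) (use P in simp)
    ultimately show "q \<zero>\<^bsub>W\<^esub> = 0" by simp
  next
    fix c :: real and x assume c: "c > 0" and x: "x \<in> carrier W"
    have "q (c \<odot>\<^bsub>W\<^esub> x) / c \<le> q x"
    proof (rule ge)
      fix u \<alpha> assume u: "(u, \<alpha>) \<in> P"
      have "c \<odot>\<^bsub>W\<^esub> x \<oplus>\<^bsub>W\<^esub> c \<odot>\<^bsub>W\<^esub> u = c \<odot>\<^bsub>W\<^esub> (x \<oplus>\<^bsub>W\<^esub> u)"
        using x P(1)[OF u] by (simp add: smult_add)
      then have "q (c \<odot>\<^bsub>W\<^esub> x) \<le> c * p (x \<oplus>\<^bsub>W\<^esub> u) - c * \<alpha>"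
        using le[OF P_smult[OF c u], of "c \<odot>\<^bsub>W\<^esub> x"] sublinearD(2)[OF p, of c "x \<oplus>\<^bsub>W\<^esub> u"] x P(1)[OF u] c
        by simp
      then show "q (c \<odot>\<^bsub>W\<^esub> x) / c \<le> p (x \<oplus>\<^bsub>W\<^esub> u) - \<alpha>"
        using c by (simp add: field_simps)
    qed
    then show "q (c \<odot>\<^bsub>W\<^esub> x) \<le> c * q x" using c by (simp add: field_simps)
  qed
  moreover have "q x \<le> p x" if "x \<in> carrier W" for x using le[OF P_zero, of x] that by simp
  moreover have "q (\<ominus>\<^bsub>W\<^esub> u) \<le> - \<alpha>" if "(u, \<alpha>) \<in> P" for u \<alpha>
    using le[OF that, of "\<ominus>\<^bsub>W\<^esub> u"] P(1)[OF that] sublinearD(3)[OF p] by (simp add: M.l_neg)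
  ultimately show thesis by (rule that)
qed

text \<open>For the ray through \<open>x0\<close>, with the values of \<open>p\<close> as bounds, a linear functional below \<open>q\<close> attains \<open>p\<close>
  at \<open>x0\<close>.\<close>

lemma sublinear_shift:
  assumes p: "sublinear W p" and x0: "x0 \<in> carrier W"
  obtains q where "sublinear W q" "\<And>x. x \<in> carrier W \<Longrightarrow> q x \<le> p x" "q (\<ominus>\<^bsub>W\<^esub> x0) \<le> - p x0"
proof -
  define P where "P = (\<lambda>t. (t \<odot>\<^bsub>W\<^esub> x0, t * p x0)) ` {0..}"
  have mem: "(t \<odot>\<^bsub>W\<^esub> x0, t * p x0) \<in> P" if "t \<ge> 0" for t
    unfolding P_def by (rule imageI) (use that in simp)
  obtain q where "sublinear W q" "\<And>x. x \<in> carrier W \<Longrightarrow> q x \<le> p x"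
    "\<And>u \<alpha>. (u, \<alpha>) \<in> P \<Longrightarrow> q (\<ominus>\<^bsub>W\<^esub> u) \<le> - \<alpha>"
  proof (rule sublinear_below_cone[OF p, of P])
    show "(\<zero>\<^bsub>W\<^esub>, 0) \<in> P" using mem[of 0] x0 by simp
    show "(u \<oplus>\<^bsub>W\<^esub> v, \<alpha> + \<beta>) \<in> P" if "(u, \<alpha>) \<in> P" "(v, \<beta>) \<in> P" for u \<alpha> v \<beta>
      using that mem x0 by (auto simp: P_def image_iff add_smult[symmetric] distrib_right[symmetric])
    show "(t \<odot>\<^bsub>W\<^esub> u, t * \<alpha>) \<in> P" if t: "0 < t" and u: "(u, \<alpha>) \<in> P" for t u \<alpha>
    proof -
      obtain s where "s \<ge> 0" "u = s \<odot>\<^bsub>W\<^esub> x0" "\<alpha> = s * p x0" using u by (auto simp: P_def)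
      then show ?thesis using mem[of "t * s"] t x0 by (simp add: smult_smult mult.assoc)
    qed
  qed (use x0 sublinearD(2)[OF p] in \<open>auto simp: P_def\<close>)
  then show thesis using that mem[of 1] x0 by simp
qed

lemma minimal_sublinear:
  assumes p: "sublinear W p"
  obtains m where "sublinear W m" "\<And>x. x \<in> carrier W \<Longrightarrow> m x \<le> p x"
    "\<And>q x. sublinear W q \<Longrightarrow> (\<And>x. x \<in> carrier W \<Longrightarrow> q x \<le> m x) \<Longrightarrow> x \<in> carrier W \<Longrightarrow> q x = m x"
proof -
  define A where "A = {q. sublinear W q \<and> (\<forall>x\<in>carrier W. q x \<le> p x) \<and> (\<forall>x. x \<notin> carrier W \<longrightarrow> q x = 0)}"
  have cut: "(\<lambda>x. if x \<in> carrier W then q x else 0) \<in> A"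
    if "sublinear W q" "\<And>x. x \<in> carrier W \<Longrightarrow> q x \<le> p x" for q
    using that by (auto simp: A_def sublinear_def)
  \<comment> \<open>Members of \<open>A\<close> are zero off the carrier, so that the pointwise order is antisymmetric on \<open>A\<close>.\<close>
  have "\<exists>m\<in>A. \<forall>a\<in>A. a \<le> m \<longrightarrow> a = m"
  proof (rule predicate_Zorn)
    show "partial_order_on A (relation_of (\<lambda>a b. b \<le> a) A)"
      by (auto simp: partial_order_on_def preorder_on_def refl_on_def trans_def antisym_def relation_of_def)
  next
    fix Ch assume "Ch \<in> Chains (relation_of (\<lambda>a b. b \<le> a) A)"
    then have sub: "Ch \<subseteq> A" and chain: "\<And>a b. a \<in> Ch \<Longrightarrow> b \<in> Ch \<Longrightarrow> a \<le> b \<or> b \<le> a"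
      by (auto simp: Chains_def relation_of_def)
    show "\<exists>u\<in>A. \<forall>a\<in>Ch. u \<le> a"
    proof (cases "Ch = {}")
      case True
      then show ?thesis using cut[OF p] by auto
    next
      case False
      define u where "u x = (INF q\<in>Ch. q x)" for x
      have ch: "sublinear W q" "x \<in> carrier W \<Longrightarrow> q x \<le> p x" "x \<notin> carrier W \<Longrightarrow> q x = 0" if "q \<in> Ch" for q x
        using sub that by (auto simp: A_def)
      have low: "- p (\<ominus>\<^bsub>W\<^esub> x) \<le> q x" if "x \<in> carrier W" "q \<in> Ch" for x q
        using sublinearD(4)[OF ch(1)[OF that(2)] that(1)] ch(2)[OF that(2), of "\<ominus>\<^bsub>W\<^esub> x"] that(1) by simp
      have le: "u x \<le> q x" if "q \<in> Ch" for x q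
      proof (cases "x \<in> carrier W")
        case True
        then show ?thesis unfolding u_def using that low by (intro cINF_lower) (auto intro!: bdd_belowI2)
      next
        case False
        then show ?thesis unfolding u_def using that
          by (intro cINF_lower bdd_belowI2[where m = 0]) (simp_all add: ch(3)[OF _ False])
      qed
      have ge: "c \<le> u x" if "\<And>q. q \<in> Ch \<Longrightarrow> c \<le> q x" for c x
        unfolding u_def using that False by (intro cINF_greatest) auto
      have "sublinear W u"
      proof (rule sublinearI)
        fix x y assume xy: "x \<in> carrier W" "y \<in> carrier W"
        have *: "u (x \<oplus>\<^bsub>W\<^esub> y) \<le> a x + b y" if ab: "a \<in> Ch" "b \<in> Ch" for a b
        proof -
          obtain q where q: "q \<in> Ch" "q x \<le> a x" "q y \<le> b y"
            using chain[OF ab] ab by (auto simp: le_fun_def)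
          then show ?thesis using le[OF q(1), of "x \<oplus>\<^bsub>W\<^esub> y"] sublinearD(1)[OF ch(1)[OF q(1)] xy] by linarith
        qed
        have "u (x \<oplus>\<^bsub>W\<^esub> y) - a x \<le> u y" if "a \<in> Ch" for a
          by (rule ge) (use *[OF that] in \<open>simp add: algebra_simps\<close>)
        then have "u (x \<oplus>\<^bsub>W\<^esub> y) - u y \<le> u x"
          by (intro ge) (simp add: algebra_simps)
        then show "u (x \<oplus>\<^bsub>W\<^esub> y) \<le> u x + u y" by simp
      next
        show "u \<zero>\<^bsub>W\<^esub> = 0" 
        proof -
          have "u \<zero>\<^bsub>W\<^esub> = (INF q\<in>Ch. 0)" unfolding u_def
            by (rule INF_cong[OF refl]) (simp add: sublinearD(3)[OF ch(1)])
          then show ?thesis using False by simp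
        qed
      next
        fix c :: real and x assume c: "c > 0" and x: "x \<in> carrier W"
        have "u (c \<odot>\<^bsub>W\<^esub> x) / c \<le> u x"
        proof (rule ge)
          fix q assume q: "q \<in> Ch"
          then show "u (c \<odot>\<^bsub>W\<^esub> x) / c \<le> q x"
            using le[OF q, of "c \<odot>\<^bsub>W\<^esub> x"] sublinearD(2)[OF ch(1)[OF q], of c x] c x by (simp add: field_simps)
        qed
        then show "u (c \<odot>\<^bsub>W\<^esub> x) \<le> c * u x" using c by (simp add: field_simps)
      qed
      moreover have "u x \<le> p x" if "x \<in> carrier W" for x
        using False le ch(2) that by (meson ex_in_conv order_trans)
      moreover have "u x = 0" if "x \<notin> carrier W" for x
      proof -
        have "u x = (INF q\<in>Ch. 0)" unfolding u_def
          by (rule INF_cong[OF refl]) (simp add: ch(3) that)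
        then show ?thesis using False by simp
      qed
      ultimately show ?thesis using le by (auto simp: A_def le_fun_def intro!: bexI[of _ u])
    qed
  qed
  then obtain m where m: "m \<in> A" "\<And>a. a \<in> A \<Longrightarrow> a \<le> m \<Longrightarrow> a = m" by blast
  show thesis
  proof (rule that[of m])
    show "sublinear W m" "\<And>x. x \<in> carrier W \<Longrightarrow> m x \<le> p x" using m by (auto simp: A_def)
    fix q x assume q: "sublinear W q" "\<And>x. x \<in> carrier W \<Longrightarrow> q x \<le> m x" and x: "x \<in> carrier W"
    have "(\<lambda>x. if x \<in> carrier W then q x else 0) = m"
    proof (rule m(2)[OF cut[OF q(1)]])
      show "q x \<le> p x" if "x \<in> carrier W" for x
        using q(2)[OF that] m(1) that by (auto simp: A_def intro: order_trans)
      show "(\<lambda>x. if x \<in> carrier W then q x else 0) \<le> m"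
        using q(2) m(1) by (auto simp: A_def le_fun_def)
    qed
    from fun_cong[OF this, of x] show "q x = m x" using x by simp
  qed
qed

text \<open>Shifting a minimal \<open>m\<close> along \<open>x\<close> changes nothing, which forces \<open>m (- x) = - m x\<close>.\<close>

theorem linear_below_sublinear:
  assumes p: "sublinear W p"
  obtains f where "\<And>x y. x \<in> carrier W \<Longrightarrow> y \<in> carrier W \<Longrightarrow> f (x \<oplus>\<^bsub>W\<^esub> y) = f x + f y"
    "\<And>t x. x \<in> carrier W \<Longrightarrow> f (t \<odot>\<^bsub>W\<^esub> x) = t * f x"
    "\<And>x. x \<in> carrier W \<Longrightarrow> f x \<le> p x"
proof -
  obtain m where m: "sublinear W m" "\<And>x. x \<in> carrier W \<Longrightarrow> m x \<le> p x"
    and min: "\<And>q x. sublinear W q \<Longrightarrow> (\<And>x. x \<in> carrier W \<Longrightarrow> q x \<le> m x) \<Longrightarrow> x \<in> carrier W \<Longrightarrow> q x = m x"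
    using minimal_sublinear[OF p] by blast
  have neg: "m (\<ominus>\<^bsub>W\<^esub> x) = - m x" if x: "x \<in> carrier W" for x
  proof -
    obtain q where q: "sublinear W q" "\<And>x. x \<in> carrier W \<Longrightarrow> q x \<le> m x" "q (\<ominus>\<^bsub>W\<^esub> x) \<le> - m x"
      using sublinear_shift[OF m(1) x] by blast
    then have "m (\<ominus>\<^bsub>W\<^esub> x) \<le> - m x" using min[OF q(1,2), of "\<ominus>\<^bsub>W\<^esub> x"] x by simp
    then show ?thesis using sublinearD(4)[OF m(1) x] by simp
  qed
  show thesis
  proof (rule that[of m])
    fix x y assume xy: "x \<in> carrier W" "y \<in> carrier W"
    have "m ((x \<oplus>\<^bsub>W\<^esub> y) \<oplus>\<^bsub>W\<^esub> \<ominus>\<^bsub>W\<^esub> y) \<le> m (x \<oplus>\<^bsub>W\<^esub> y) - m y"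
      using sublinearD(1)[OF m(1), of "x \<oplus>\<^bsub>W\<^esub> y" "\<ominus>\<^bsub>W\<^esub> y"] xy neg by simp
    then have "m x \<le> m (x \<oplus>\<^bsub>W\<^esub> y) - m y" using xy by (simp add: M.a_assoc M.r_neg)
    then show "m (x \<oplus>\<^bsub>W\<^esub> y) = m x + m y" using sublinearD(1)[OF m(1) xy] by simp
  next
    fix t x assume x: "x \<in> carrier W"
    show "m (t \<odot>\<^bsub>W\<^esub> x) = t * m x"
    proof (cases "t \<ge> 0")
      case False
      then have "m ((- t) \<odot>\<^bsub>W\<^esub> x) = (- t) * m x" using sublinearD(2)[OF m(1), of "- t" x] x by simp
      then show ?thesis using x neg[of "t \<odot>\<^bsub>W\<^esub> x"] by (simp add: minus_smult)
    qed (use sublinearD(2)[OF m(1)] x in simp)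
  qed (rule m(2))
qed

end

text \<open>Real and complex scalars are treated at once, as normed fields that are Euclidean spaces. The real
  part of \<open>c\<close> is then \<open>c \<bullet> 1\<close>. The pairing \<open>(t * c) \<bullet> 1\<close> is nondegenerate, since \<open>t\<close> can be the inverse of
  \<open>c\<close>, and in finite dimension this makes every real-linear functional of \<open>t\<close> a pairing with some \<open>c\<close>.\<close>

lemma inner_one_representation:
  fixes \<rho> :: "'k::{real_normed_field, euclidean_space} \<Rightarrow> real"
  assumes "linear \<rho>"
  obtains c where "\<And>t. \<rho> t = (t * c) \<bullet> 1"
proof -
  let ?L = "\<lambda>c::'k. adjoint (\<lambda>t. t * c) 1"
  have lin: "linear (\<lambda>t. t * c)" for c :: 'k by (rule bounded_linear.linear) (rule bounded_linear_mult_left)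
  have L: "t \<bullet> ?L c = (t * c) \<bullet> 1" for t c :: 'k
    using adjoint_works[OF lin, of t c 1] by simp
  have "linear ?L"
  proof (rule linearI)
    fix a b :: 'k and r :: real
    have "x \<bullet> ?L (a + b) = x \<bullet> (?L a + ?L b)" for x
      unfolding inner_add_right L by (simp add: distrib_left inner_add_left)
    then show "?L (a + b) = ?L a + ?L b" using vector_eq_ldot by blast
    have "x \<bullet> ?L (r *\<^sub>R a) = x \<bullet> (r *\<^sub>R ?L a)" for x
      unfolding inner_scaleR_right L by simp
    then show "?L (r *\<^sub>R a) = r *\<^sub>R ?L a" using vector_eq_ldot by blast
  qed
  moreover have "inj ?L"
  proof (subst linear_injective_0[OF \<open>linear ?L\<close>], intro allI impI)
    fix c assume "?L c = 0"
    then have "(inverse c * c) \<bullet> 1 = 0" using L[of "inverse c" c] by simp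
    then show "c = 0" by (rule contrapos_pp) (simp add: inner_eq_zero_iff)
  qed
  ultimately have "surj ?L" by (rule linear_inj_imp_surj)
  then obtain c where c: "?L c = adjoint \<rho> 1" using surjD[of ?L "adjoint \<rho> 1"] by auto
  have "\<rho> t = (t * c) \<bullet> 1" for t
    using adjoint_works[OF assms, of t 1] L[of t c] c by simp
  then show thesis by (rule that)
qed

lemma eq_if_inner_one_eq:
  fixes c d :: "'k::{real_normed_field, euclidean_space}"
  assumes "\<And>t. (t * c) \<bullet> 1 = (t * d) \<bullet> 1"
  shows "c = d"
proof (rule ccontr)
  assume "c \<noteq> d"
  have "(inverse (c - d) * (c - d)) \<bullet> 1 = 0"
    using assms[of "inverse (c - d)"] by (simp add: right_diff_distrib inner_diff_left)
  then show False using \<open>c \<noteq> d\<close> by simp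
qed

lemma inner_one_one [simp]: "(1 :: 'k::{real_normed_field, euclidean_space}) \<bullet> 1 = 1"
  by (simp add: dot_square_norm)

lemma of_real_inner_one [simp]: "(of_real r :: 'k::{real_normed_field, euclidean_space}) \<bullet> 1 = r"
  by (simp add: of_real_def)

context normed_space
begin

text \<open>Hahn-Banach is applied to \<open>V\<close> as a vector space over the reals.\<close>

definition real_restriction :: "(real, 'a) module" where
  "real_restriction = \<lparr>carrier = carrier V, mult = undefined, one = undefined, zero = \<zero>\<^bsub>V\<^esub>,
     add = (\<oplus>\<^bsub>V\<^esub>), smult = (\<lambda>t. (\<odot>\<^bsub>V\<^esub>) (of_real t))\<rparr>"

lemma real_restriction_simps [simp]:
  "carrier real_restriction = carrier V" "zero real_restriction = \<zero>\<^bsub>V\<^esub>"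
  "add real_restriction = (\<oplus>\<^bsub>V\<^esub>)" "smult real_restriction t = (\<odot>\<^bsub>V\<^esub>) (of_real t)"
  by (simp_all add: real_restriction_def)

lemma real_module_real_restriction: "real_module real_restriction"
proof -
  have "abelian_group real_restriction"
  proof (rule abelian_groupI)
    fix x assume "x \<in> carrier real_restriction"
    then show "\<exists>y\<in>carrier real_restriction. y \<oplus>\<^bsub>real_restriction\<^esub> x = \<zero>\<^bsub>real_restriction\<^esub>"
      by (intro bexI[of _ "\<ominus>\<^bsub>V\<^esub> x"]) (auto simp: M.l_neg)
  qed (auto simp: M.a_ac)
  then have "module scalar_field real_restriction"
    by (intro moduleI[OF cring_scalar_field]) (auto simp: add_smult smult_add smult_smult)
  then show ?thesis by (simp add: real_module_def)
qed

end

text \<open>The sort captures what the real and the complex numbers share: a multiplicative norm that comes from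
  an inner product in finite dimension.\<close>

locale RC_normed_space = normed_space V
  for V :: "('k::{real_normed_field, euclidean_space}, 'a) normed_module"
begin

text \<open>A real-linear functional \<open>g\<close> below \<open>p\<close> with \<open>g x0 = p x0\<close> is the real part of a unique scalar-valued
  one. Rotating \<open>x\<close> so that the value at it becomes real and nonnegative bounds the absolute value by
  \<open>p\<close>. At \<open>x0\<close> the real part already exhausts that bound, so the value there is real.\<close>

theorem functional_below_seminorm:
  assumes add: "\<And>x y. x \<in> carrier V \<Longrightarrow> y \<in> carrier V \<Longrightarrow> p (x \<oplus>\<^bsub>V\<^esub> y) \<le> p x + p y"
    and smult: "\<And>c x. x \<in> carrier V \<Longrightarrow> p (c \<odot>\<^bsub>V\<^esub> x) = norm c * p x"
    and le: "\<And>x. x \<in> carrier V \<Longrightarrow> p x \<le> C * vnorm V x"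
    and x0: "x0 \<in> carrier V"
  obtains f where "f \<in> carrier (dual V)" "\<And>x. x \<in> carrier V \<Longrightarrow> norm (f x) \<le> p x" "f x0 = of_real (p x0)"
proof -
  interpret R: real_module real_restriction by (rule real_module_real_restriction)
  have "sublinear real_restriction p" using add smult by (simp add: sublinear_def)
  then obtain q where q: "sublinear real_restriction q" "\<And>x. x \<in> carrier V \<Longrightarrow> q x \<le> p x"
    "q (\<ominus>\<^bsub>real_restriction\<^esub> x0) \<le> - p x0"
    using R.sublinear_shift[of p x0] x0 by auto
  obtain g where g: "\<And>x y. x \<in> carrier V \<Longrightarrow> y \<in> carrier V \<Longrightarrow> g (x \<oplus>\<^bsub>V\<^esub> y) = g x + g y"
    "\<And>t x. x \<in> carrier V \<Longrightarrow> g (of_real t \<odot>\<^bsub>V\<^esub> x) = t * g x" "\<And>x. x \<in> carrier V \<Longrightarrow> g x \<le> q x"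
  proof (rule R.linear_below_sublinear[OF q(1)], unfold real_restriction_simps)
    fix g :: "'a \<Rightarrow> real"
    assume g: "\<And>x y. x \<in> carrier V \<Longrightarrow> y \<in> carrier V \<Longrightarrow> g (x \<oplus>\<^bsub>V\<^esub> y) = g x + g y"
      "\<And>t x. x \<in> carrier V \<Longrightarrow> g (of_real t \<odot>\<^bsub>V\<^esub> x) = t * g x" "\<And>x. x \<in> carrier V \<Longrightarrow> g x \<le> q x"
    show thesis by (rule that[OF g])
  qed
  have gp: "g x \<le> p x" if "x \<in> carrier V" for x using g(3)[OF that] q(2)[OF that] by simp
  have "\<ominus>\<^bsub>real_restriction\<^esub> x0 = of_real (-1) \<odot>\<^bsub>V\<^esub> x0"
    using R.minus_smult[of x0 1] x0 by simp
  then have "p x0 \<le> g x0" using q(3) g(3)[of "of_real (-1) \<odot>\<^bsub>V\<^esub> x0"] g(2)[OF x0, of "-1"] x0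
    by simp
  then have gx0: "g x0 = p x0" using gp[OF x0] by simp
  have "\<exists>c. \<forall>t. g (t \<odot>\<^bsub>V\<^esub> x) = (t * c) \<bullet> 1" if x: "x \<in> carrier V" for x
  proof -
    have "g ((r *\<^sub>R t) \<odot>\<^bsub>V\<^esub> x) = r * g (t \<odot>\<^bsub>V\<^esub> x)" for r t
      using g(2)[of "t \<odot>\<^bsub>V\<^esub> x" r] x by (simp add: smult_smult scaleR_conv_of_real)
    then have "linear (\<lambda>t. g (t \<odot>\<^bsub>V\<^esub> x))"
      using g(1) x by (intro linearI) (simp_all add: add_smult)
    then show ?thesis using inner_one_representation by blast
  qed
  then obtain f where f: "\<And>x t. x \<in> carrier V \<Longrightarrow> g (t \<odot>\<^bsub>V\<^esub> x) = (t * f x) \<bullet> 1" by metis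
  have f1: "g x = f x \<bullet> 1" if "x \<in> carrier V" for x using f[OF that, of 1] that by simp
  have bound: "norm (f x) \<le> p x" if x: "x \<in> carrier V" for x
  proof (cases "f x = 0")
    case True
    have "0 \<le> p x" using add[OF x, of "(-1) \<odot>\<^bsub>V\<^esub> x"] smult[OF x, of 0] smult[OF x, of "-1"] x add_smult[OF x, of 1 "-1"]
      by simp
    then show ?thesis using True by simp
  next
    case False
    \<comment> \<open>the unit scalar that rotates \<open>f x\<close> to \<open>norm (f x)\<close>\<close>
    let ?t = "of_real (norm (f x)) / f x"
    have "norm (f x) = g (?t \<odot>\<^bsub>V\<^esub> x)" using f[OF x, of ?t] False by simp
    also have "\<dots> \<le> p (?t \<odot>\<^bsub>V\<^esub> x)" using gp x by simp
    also have "\<dots> = p x" using smult[OF x, of ?t] False by (simp add: norm_divide)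
    finally show ?thesis .
  qed
  have fadd: "f (x \<oplus>\<^bsub>V\<^esub> y) = f x + f y" if "x \<in> carrier V" "y \<in> carrier V" for x y
    by (rule eq_if_inner_one_eq)
       (use that g(1) in \<open>simp add: f[symmetric] smult_add distrib_left inner_add_left\<close>)
  have fsmult: "f (c \<odot>\<^bsub>V\<^esub> x) = c * f x" if "x \<in> carrier V" for c x
    by (rule eq_if_inner_one_eq)
       (use that in \<open>simp add: f[symmetric] smult_smult flip: mult.assoc\<close>)
  show thesis
  proof (rule that)
    show "(\<lambda>x\<in>carrier V. f x) \<in> carrier (dual V)"
      by (rule dualI[where C = C]) (simp_all add: fadd fsmult order_trans[OF bound le])
    have "(norm (f x0 - of_real (p x0)))\<^sup>2 \<le> 0"
    proof -
      have "(norm (f x0 - of_real (p x0)))\<^sup>2 = (norm (f x0))\<^sup>2 - 2 * p x0 * (f x0 \<bullet> 1) + (p x0)\<^sup>2"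
        unfolding power2_norm_eq_inner inner_diff_left inner_diff_right
        by (simp add: of_real_def inner_commute[of 1 "f x0"] power2_eq_square)
      moreover have "(norm (f x0))\<^sup>2 \<le> (p x0)\<^sup>2" using bound[OF x0] by (simp add: power_mono)
      ultimately show ?thesis using f1[OF x0] gx0 by (simp add: power2_eq_square)
    qed
    then show "(\<lambda>x\<in>carrier V. f x) x0 = of_real (p x0)" using x0 by simp
  qed (use bound in simp)
qed

lemma norming_functional:
  assumes "x0 \<in> carrier V"
  obtains f where "f \<in> carrier (dual V)" "vnorm (dual V) f \<le> 1" "f x0 = of_real (vnorm V x0)"
proof -
  obtain f where f: "f \<in> carrier (dual V)" "\<And>x. x \<in> carrier V \<Longrightarrow> norm (f x) \<le> vnorm V x"
    "f x0 = of_real (vnorm V x0)"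
    using functional_below_seminorm[of "vnorm V" 1 x0] assms vnorm_triangle vnorm_smult by auto
  have "vnorm (dual V) f \<le> 1"
    by (rule dual_norm_least) (use f(2) in \<open>fastforce simp: unit_ball_def\<close>)
  then show thesis using f by (intro that)
qed

lemma dual_separates:
  assumes "x \<in> carrier V" "y \<in> carrier V" "\<And>f. f \<in> carrier (dual V) \<Longrightarrow> f x = f y"
  shows "x = y"
proof -
  obtain f where "f \<in> carrier (dual V)" "f (x \<ominus>\<^bsub>V\<^esub> y) = of_real (vnorm V (x \<ominus>\<^bsub>V\<^esub> y))"
    using norming_functional[of "x \<ominus>\<^bsub>V\<^esub> y"] assms by auto
  then have "(of_real (vnorm V (x \<ominus>\<^bsub>V\<^esub> y)) :: 'k) = 0" using assms dual_diff by (metis diff_self)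
  then have "vnorm V (x \<ominus>\<^bsub>V\<^esub> y) = 0" by simp
  then show ?thesis using assms vnorm_diff_eq_zero by simp
qed

lemma vnorm_le_if_dual_le:
  assumes "x \<in> carrier V" "\<And>f. f \<in> carrier (dual V) \<Longrightarrow> vnorm (dual V) f \<le> 1 \<Longrightarrow> norm (f x) \<le> c"
  shows "vnorm V x \<le> c"
  using norming_functional[OF assms(1)] assms by (metis abs_of_nonneg norm_of_real vnorm_nonneg)

text \<open>The distance to \<open>M\<close> is a seminorm below the norm. It is zero on \<open>M\<close> and positive at \<open>x0\<close>.\<close>

lemma functional_vanishing_on_subspace:
  assumes M: "M \<subseteq> carrier V" "\<zero>\<^bsub>V\<^esub> \<in> M" "\<And>x y. x \<in> M \<Longrightarrow> y \<in> M \<Longrightarrow> x \<oplus>\<^bsub>V\<^esub> y \<in> M"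
      "\<And>c x. x \<in> M \<Longrightarrow> c \<odot>\<^bsub>V\<^esub> x \<in> M"
    and x0: "x0 \<in> carrier V" and \<delta>: "\<delta> > 0" "\<And>m. m \<in> M \<Longrightarrow> \<delta> \<le> vnorm V (x0 \<ominus>\<^bsub>V\<^esub> m)"
  obtains f where "f \<in> carrier (dual V)" "\<And>m. m \<in> M \<Longrightarrow> f m = 0" "f x0 \<noteq> 0"
proof -
  define p where "p x = (INF m\<in>M. vnorm V (x \<ominus>\<^bsub>V\<^esub> m))" for x
  have le: "p x \<le> vnorm V (x \<ominus>\<^bsub>V\<^esub> m)" if "x \<in> carrier V" "m \<in> M" for x m
    unfolding p_def using that M(1)
    by (intro cINF_lower) (auto intro!: bdd_belowI2[where m = 0] vnorm_nonneg M.minus_closed)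
  have ge: "c \<le> p x" if "\<And>m. m \<in> M \<Longrightarrow> c \<le> vnorm V (x \<ominus>\<^bsub>V\<^esub> m)" for c x
    unfolding p_def using that M(2) by (intro cINF_greatest) auto
  have smult_le: "p (c \<odot>\<^bsub>V\<^esub> x) \<le> norm c * p x" if "x \<in> carrier V" "c \<noteq> 0" for c x
  proof -
    have "p (c \<odot>\<^bsub>V\<^esub> x) / norm c \<le> p x"
    proof (rule ge)
      fix m assume m: "m \<in> M"
      then have mV: "m \<in> carrier V" using M(1) by auto
      have "c \<odot>\<^bsub>V\<^esub> x \<ominus>\<^bsub>V\<^esub> c \<odot>\<^bsub>V\<^esub> m = c \<odot>\<^bsub>V\<^esub> (x \<ominus>\<^bsub>V\<^esub> m)"
        using that mV by (simp add: diff_eq_smult smult_add smult_smult)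
      then have "p (c \<odot>\<^bsub>V\<^esub> x) \<le> norm c * vnorm V (x \<ominus>\<^bsub>V\<^esub> m)"
        using le[of "c \<odot>\<^bsub>V\<^esub> x" "c \<odot>\<^bsub>V\<^esub> m"] M(4)[OF m] that mV by (simp add: vnorm_smult)
      then show "p (c \<odot>\<^bsub>V\<^esub> x) / norm c \<le> vnorm V (x \<ominus>\<^bsub>V\<^esub> m)" using that by (simp add: field_simps)
    qed
    then show ?thesis using that by (simp add: field_simps)
  qed
  have p0: "p m = 0" if "m \<in> M" for m
  proof (rule order_antisym)
    show "p m \<le> 0" using le[of m m] that M(1) vnorm_diff_eq_zero[of m m] by auto
    show "0 \<le> p m" using that M(1) by (intro ge vnorm_nonneg M.minus_closed) auto
  qed
  have smult: "p (c \<odot>\<^bsub>V\<^esub> x) = norm c * p x" if x: "x \<in> carrier V" for c x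
  proof (cases "c = 0")
    case True
    then show ?thesis using p0[OF M(2)] x by simp
  next
    case False
    then show ?thesis
      using smult_le[OF x False] smult_le[of "c \<odot>\<^bsub>V\<^esub> x" "inverse c"] x
      by (simp add: smult_smult norm_inverse) (simp add: field_simps)
  qed
  have add: "p (x \<oplus>\<^bsub>V\<^esub> y) \<le> p x + p y" if xy: "x \<in> carrier V" "y \<in> carrier V" for x y
  proof -
    have *: "p (x \<oplus>\<^bsub>V\<^esub> y) \<le> vnorm V (x \<ominus>\<^bsub>V\<^esub> m) + vnorm V (y \<ominus>\<^bsub>V\<^esub> n)" if "m \<in> M" "n \<in> M" for m n
    proof -
      have mn: "m \<in> carrier V" "n \<in> carrier V" using that M(1) by auto
      have "(x \<oplus>\<^bsub>V\<^esub> y) \<ominus>\<^bsub>V\<^esub> (m \<oplus>\<^bsub>V\<^esub> n) = (x \<ominus>\<^bsub>V\<^esub> m) \<oplus>\<^bsub>V\<^esub> (y \<ominus>\<^bsub>V\<^esub> n)"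
        using xy mn by (simp add: a_minus_def M.minus_add M.a_ac)
      then show ?thesis
        using le[of "x \<oplus>\<^bsub>V\<^esub> y" "m \<oplus>\<^bsub>V\<^esub> n"] M(3)[OF that] vnorm_triangle[of "x \<ominus>\<^bsub>V\<^esub> m" "y \<ominus>\<^bsub>V\<^esub> n"] xy mn
        by simp
    qed
    have "p (x \<oplus>\<^bsub>V\<^esub> y) - vnorm V (x \<ominus>\<^bsub>V\<^esub> m) \<le> p y" if "m \<in> M" for m
      by (rule ge) (use *[OF that] in \<open>simp add: algebra_simps\<close>)
    then have "p (x \<oplus>\<^bsub>V\<^esub> y) - p y \<le> p x"
      by (intro ge) (simp add: algebra_simps)
    then show ?thesis by simp
  qed
  have "p x \<le> 1 * vnorm V x" if "x \<in> carrier V" for x using le[OF that M(2)] that by simp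
  then obtain f where f: "f \<in> carrier (dual V)" "\<And>x. x \<in> carrier V \<Longrightarrow> norm (f x) \<le> p x"
    "f x0 = of_real (p x0)"
    using functional_below_seminorm[of p 1 x0] add smult x0 by blast
  show thesis
  proof (rule that[OF f(1)])
    show "f m = 0" if "m \<in> M" for m using f(2)[of m] p0[OF that] that M(1) by auto
    show "f x0 \<noteq> 0" using f(3) ge[of \<delta> x0] \<delta> by auto
  qed
qed

end

section \<open>Boundedness and compactness\<close>

lemma (in banach_space) MCauchy_imp_limit:
  assumes "range s \<subseteq> carrier V" "\<And>e. e > 0 \<Longrightarrow> \<exists>N. \<forall>m\<ge>N. \<forall>n\<ge>N. vnorm V (s m \<ominus>\<^bsub>V\<^esub> s n) < e"
  obtains l where "l \<in> carrier V" "(\<lambda>n. vnorm V (s n \<ominus>\<^bsub>V\<^esub> l)) \<longlonglongrightarrow> 0"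
proof -
  have "Metric_space.MCauchy (carrier V) (vdist V) s" using assms by (simp add: MCauchy_vdist)
  then obtain l where "limitin (norm_topology V) s l sequentially"
    using complete unfolding norm_topology_def Metric_space.mcomplete_def[OF Metric_space_vdist] by blast
  then have "l \<in> carrier V \<and> (\<lambda>n. vnorm V (s n \<ominus>\<^bsub>V\<^esub> l)) \<longlonglongrightarrow> 0"
    using assms(1) by (simp add: limitin_norm_topology)
  then show thesis by (intro that[of l]) auto
qed

lemma (in banach_space) absolutely_summable_imp_unconditionally_converging:
  assumes y: "range y \<subseteq> carrier V" and sum: "summable (\<lambda>i. vnorm V (y i))"
  shows "unconditionally_converging V y"
  unfolding unconditionally_converging_def
proof (intro conjI allI impI y)
  fix r :: "nat \<Rightarrow> nat" assume r: "strict_mono r"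
  have yV: "y i \<in> carrier V" for i using y by auto
  let ?s = "\<lambda>n. \<Oplus>\<^bsub>V\<^esub>i\<in>{..<n}. y (r i)"
  have sV: "?s n \<in> carrier V" for n using yV by (intro M.finsum_closed) auto
  have sumr: "summable (\<lambda>i. vnorm V (y (r i)))"
    using summable_reindex[OF sum strict_mono_imp_inj_on[OF r]] yV by (simp add: comp_def)
  have diff: "vnorm V (?s (m + k) \<ominus>\<^bsub>V\<^esub> ?s m) \<le> (\<Sum>i\<in>{m..<m + k}. vnorm V (y (r i)))" for m k
  proof (induction k)
    case 0
    show ?case using vnorm_diff_eq_zero[OF sV sV, of m m] by simp
  next
    case (Suc k)
    have "?s (m + Suc k) = ?s (m + k) \<oplus>\<^bsub>V\<^esub> y (r (m + k))"
      using yV sV by (simp add: lessThan_Suc M.finsum_insert M.a_comm)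
    then have "?s (m + Suc k) \<ominus>\<^bsub>V\<^esub> ?s m = (?s (m + k) \<ominus>\<^bsub>V\<^esub> ?s m) \<oplus>\<^bsub>V\<^esub> y (r (m + k))"
      using yV sV by (simp add: a_minus_def M.a_ac)
    then have "vnorm V (?s (m + Suc k) \<ominus>\<^bsub>V\<^esub> ?s m) \<le> vnorm V (?s (m + k) \<ominus>\<^bsub>V\<^esub> ?s m) + vnorm V (y (r (m + k)))"
      using vnorm_triangle yV sV by simp
    then show ?case using Suc by simp
  qed
  obtain l where "l \<in> carrier V" "(\<lambda>n. vnorm V (?s n \<ominus>\<^bsub>V\<^esub> l)) \<longlonglongrightarrow> 0"
  proof (rule MCauchy_imp_limit[of ?s])
    fix e :: real assume e: "e > 0"
    obtain N where N: "\<And>m n. m \<ge> N \<Longrightarrow> norm (\<Sum>i\<in>{m..<n}. vnorm V (y (r i))) < e"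
      using sumr e unfolding summable_Cauchy by blast
    have *: "vnorm V (?s n \<ominus>\<^bsub>V\<^esub> ?s m) < e" if "m \<ge> N" "n \<ge> m" for m n
      using diff[of m "n - m"] N[of m n] that by simp
    have "vnorm V (?s m \<ominus>\<^bsub>V\<^esub> ?s n) < e" if "m \<ge> N" "n \<ge> N" for m n
      using *[of m n] *[of n m] that vnorm_diff_commute[OF sV sV, of m n] by (cases "n \<ge> m") auto
    then show "\<exists>N. \<forall>m\<ge>N. \<forall>n\<ge>N. vnorm V (?s m \<ominus>\<^bsub>V\<^esub> ?s n) < e" by blast
  qed (use sV in auto)
  then show "\<exists>s. limitin (norm_topology V) ?s s sequentially"
    using limitin_norm_topology[of ?s] sV by auto
qed

text \<open>Uniform boundedness: the sets of functionals bounded by \<open>n\<close> on the sequence are closed and cover the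
  dual, which is complete. By Baire's theorem one of them contains a ball, and differences from the
  center of the ball bound all functionals of norm one.\<close>

lemma (in RC_normed_space) pointwise_bounded_imp_bounded:
  fixes x :: "nat \<Rightarrow> 'a"
  assumes x: "range x \<subseteq> carrier V"
    and bdd: "\<And>f. f \<in> carrier (dual V) \<Longrightarrow> \<exists>c. \<forall>i. norm (f (x i)) \<le> c"
  obtains c where "\<And>i. vnorm V (x i) \<le> c"
proof -
  have xV: "x i \<in> carrier V" for i using x by auto
  interpret D: banach_space "dual V" by (rule banach_space_dual[OF complete_UNIV])
  interpret MS: Metric_space "carrier (dual V)" "vdist (dual V)" by (rule D.Metric_space_vdist)
  define F where "F n = {f \<in> carrier (dual V). \<forall>i. norm (f (x i)) \<le> real n}" for n :: nat
  have closed: "closedin MS.mtopology (F n)" for n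
  proof -
    have "closedin (norm_topology (dual V)) {f \<in> carrier (dual V). f (x i) \<in> cball 0 (real n)}" for i
    proof -
      have "continuous_map (norm_topology (dual V)) euclidean (\<lambda>f\<in>carrier (dual V). f (x i))"
        using eval_in_bidual[OF xV, of i] by (simp add: dual_def[of "dual V"])
      then have "continuous_map (norm_topology (dual V)) euclidean (\<lambda>f. f (x i))"
        by (rule continuous_map_eq) simp
      from closedin_continuous_map_preimage[OF this, of "cball 0 (real n)"] show ?thesis by simp
    qed
    then have "closedin (norm_topology (dual V)) (\<Inter>i. {f \<in> carrier (dual V). f (x i) \<in> cball 0 (real n)})"
      by (intro closedin_Inter) auto
    moreover have "(\<Inter>i. {f \<in> carrier (dual V). f (x i) \<in> cball 0 (real n)}) = F n"
      by (auto simp: F_def)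
    ultimately show ?thesis by (simp add: norm_topology_def)
  qed
  have "carrier (dual V) \<subseteq> (\<Union>n. F n)"
  proof
    fix f assume f: "f \<in> carrier (dual V)"
    then obtain c where c: "\<And>i. norm (f (x i)) \<le> c" using bdd by blast
    obtain n where "c \<le> real n" using real_arch_simple by blast
    then have "f \<in> F n" using f c by (auto simp: F_def intro: order_trans)
    then show "f \<in> (\<Union>n. F n)" by blast
  qed
  then have union: "(\<Union>n. F n) = carrier (dual V)" by (auto simp: F_def)
  have "\<not> (\<forall>n. MS.mtopology interior_of F n = {})"
  proof
    assume "\<forall>n. MS.mtopology interior_of F n = {}"
    then have "MS.mtopology interior_of \<Union>(range F) = {}"
      using closed D.complete by (intro MS.metric_Baire_category_alt) auto
    then show False using union interior_of_topspace[of MS.mtopology] D.M.zero_closed by auto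
  qed
  then obtain n f0 where "f0 \<in> MS.mtopology interior_of F n" by blast
  then obtain T where T: "openin MS.mtopology T" "f0 \<in> T" "T \<subseteq> F n"
    unfolding interior_of_def by blast
  then have f0: "f0 \<in> carrier (dual V)" by (auto simp: MS.openin_mtopology)
  obtain e where e: "e > 0" "MS.mball f0 e \<subseteq> F n"
    using T unfolding MS.openin_mtopology by (meson subset_trans)
  have "vnorm V (x i) \<le> 4 * real n / e" for i
  proof (rule vnorm_le_if_dual_le[OF xV])
    fix f assume f: "f \<in> carrier (dual V)" "vnorm (dual V) f \<le> 1"
    let ?h = "of_real (e / 2) \<odot>\<^bsub>dual V\<^esub> f"
    have h: "?h \<in> carrier (dual V)" "f0 \<oplus>\<^bsub>dual V\<^esub> ?h \<in> carrier (dual V)" using f f0 by auto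
    have "f0 \<oplus>\<^bsub>dual V\<^esub> ?h \<ominus>\<^bsub>dual V\<^esub> f0 = ?h"
      using D.M.a_comm[OF f0 h(1)] h(1) f0 by (simp add: a_minus_def D.M.a_assoc D.M.r_neg)
    moreover have "vnorm (dual V) ?h < e"
      using f e mult_left_le[of "vnorm (dual V) f" "e / 2"] by (simp add: D.vnorm_smult norm_divide)
    ultimately have "vdist (dual V) f0 (f0 \<oplus>\<^bsub>dual V\<^esub> ?h) < e"
      using f0 h D.vnorm_diff_commute[of f0 "f0 \<oplus>\<^bsub>dual V\<^esub> ?h"] by (simp add: vdist_def)
    then have "f0 \<oplus>\<^bsub>dual V\<^esub> ?h \<in> MS.mball f0 e" unfolding MS.in_mball using f0 h(2) by blast
    then have 1: "norm ((f0 \<oplus>\<^bsub>dual V\<^esub> ?h) (x i)) \<le> real n"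
      using e(2) unfolding F_def by blast
    have 2: "norm (f0 (x i)) \<le> real n" using e f0 by (auto simp: F_def)
    have "norm (of_real (e / 2) * f (x i)) \<le> 2 * real n"
      using 1 2 norm_triangle_ineq4[of "f0 (x i) + of_real (e / 2) * f (x i)" "f0 (x i)"] xV
      by (simp add: dual_simps)
    then show "norm (f (x i)) \<le> 4 * real n / e" using e by (simp add: norm_mult norm_divide field_simps)
  qed
  then show thesis by (rule that)
qed

lemma compactin_cluster_point:
  fixes y :: "nat \<Rightarrow> 'x"
  assumes C: "compactin T C" and y: "range y \<subseteq> C"
  obtains z where "z \<in> C" "\<And>U m. openin T U \<Longrightarrow> z \<in> U \<Longrightarrow> \<exists>n\<ge>m. y n \<in> U"
proof -
  have "\<exists>z\<in>C. \<forall>U m. openin T U \<longrightarrow> z \<in> U \<longrightarrow> (\<exists>n\<ge>m. y n \<in> U)"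
  proof (rule ccontr)
    assume "\<not> ?thesis"
    then have "\<forall>z\<in>C. \<exists>U m. openin T U \<and> z \<in> U \<and> (\<forall>n\<ge>m. y n \<notin> U)" by simp
    then obtain U m where U: "\<And>z. z \<in> C \<Longrightarrow> openin T (U z) \<and> z \<in> U z \<and> (\<forall>n\<ge>m z. y n \<notin> U z)"
      by metis
    have "C \<subseteq> \<Union>(U ` C)" using U by blast
    moreover have "\<forall>S\<in>U ` C. openin T S" using U by blast
    ultimately obtain \<F> where F: "finite \<F>" "\<F> \<subseteq> U ` C" "C \<subseteq> \<Union>\<F>"
      using C unfolding compactin_def by meson
    then obtain Z where Z: "finite Z" "Z \<subseteq> C" "\<F> = U ` Z" by (metis finite_subset_image)
    define N where "N = Max (insert 0 (m ` Z))"
    have "y N \<in> C" using y by auto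
    then obtain z where z: "z \<in> Z" "y N \<in> U z" using F Z by auto
    then have "m z \<le> N" using Z by (simp add: N_def)
    then show False using U[of z] z Z by auto
  qed
  then show thesis using that by blast
qed

lemma openin_weak_topology:
  assumes "f \<in> carrier (dual V)" "open U"
  shows "openin (weak_topology V) {x \<in> carrier V. f x \<in> U}"
  unfolding weak_topology_def using assms by (intro topology_generated_by_Basis) auto

context normed_space
begin

lemma topspace_weak_topology [simp]: "topspace (weak_topology V) = carrier V"
proof -
  interpret D: normed_space "dual V" by (rule normed_space_dual)
  have "carrier V \<subseteq> topspace (weak_topology V)"
    using openin_subset[OF openin_weak_topology[OF D.M.zero_closed, of UNIV]] by simp
  then show ?thesis by (auto simp: weak_topology_def)
qed

text \<open>The form in which weak compactness enters: sequences, tested against one functional at a time.\<close>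

lemma weak_cluster_point:
  fixes y :: "nat \<Rightarrow> 'a"
  assumes A: "relatively_weakly_compact V A" and y: "range y \<subseteq> A"
  obtains z where "z \<in> carrier V"
    "\<And>f m. f \<in> carrier (dual V) \<Longrightarrow> f z \<in> closure ((\<lambda>n. f (y n)) ` {m..})"
proof -
  have "A \<subseteq> weak_topology V closure_of A"
    using A by (intro closure_of_subset) (simp add: relatively_weakly_compact_def)
  obtain z where z: "z \<in> weak_topology V closure_of A"
    "\<And>U m. openin (weak_topology V) U \<Longrightarrow> z \<in> U \<Longrightarrow> \<exists>n\<ge>m. y n \<in> U"
  proof (rule compactin_cluster_point[of "weak_topology V" "weak_topology V closure_of A" y])
    show "compactin (weak_topology V) (weak_topology V closure_of A)"
      using A by (simp add: relatively_weakly_compact_def)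
    show "range y \<subseteq> weak_topology V closure_of A" using y \<open>A \<subseteq> weak_topology V closure_of A\<close> by blast
  qed blast
  have zV: "z \<in> carrier V" using z(1) closure_of_subset_topspace[of "weak_topology V" A] by auto
  have "f z \<in> closure ((\<lambda>n. f (y n)) ` {m..})" if fD: "f \<in> carrier (dual V)" for f m
    unfolding closure_iff_nhds_not_empty
  proof (intro allI impI)
    fix S U :: "'k set" assume "U \<subseteq> S" "open U" "f z \<in> U"
    then obtain n where "n \<ge> m" "y n \<in> {x \<in> carrier V. f x \<in> U}"
      using z(2)[OF openin_weak_topology[OF fD], of U m] zV by auto
    then show "(\<lambda>n. f (y n)) ` {m..} \<inter> S \<noteq> {}" using \<open>U \<subseteq> S\<close> by auto
  qed
  with zV show thesis by (rule that)
qed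

end

context RC_normed_space
begin

text \<open>By Tychonoff's theorem the product of the discs of radius \<open>r * vnorm V x\<close> is compact. Linearity is a
  closed condition, and the linear members of the product are the functionals of norm at most \<open>r\<close>.\<close>

theorem Banach_Alaoglu:
  assumes r: "r \<ge> 0"
  shows "compactin (product_topology (\<lambda>_. euclidean) (carrier V)) {f \<in> carrier (dual V). vnorm (dual V) f \<le> r}"
proof -
  let ?T = "product_topology (\<lambda>_. euclidean :: 'k topology) (carrier V)"
  define B where "B = (\<Pi>\<^sub>E x\<in>carrier V. cball (0::'k) (r * vnorm V x))"
  have B: "compactin ?T B" by (simp add: B_def compactin_PiE)
  define L where "L = (\<Inter>x\<in>carrier V. \<Inter>y\<in>carrier V. \<Inter>c.
    {f \<in> topspace ?T. f (x \<oplus>\<^bsub>V\<^esub> y) - f x - f y \<in> {0}} \<inter> {f \<in> topspace ?T. f (c \<odot>\<^bsub>V\<^esub> x) - c * f x \<in> {0}})"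
  have coord: "continuous_map ?T euclidean (\<lambda>f. f x)" if "x \<in> carrier V" for x
    using continuous_map_product_projection[of x "carrier V" "\<lambda>_. euclidean"] that by simp
  have "closedin ?T L"
    unfolding L_def
  proof (intro closedin_INT closedin_Int)
    fix x y c assume x: "x \<in> carrier V" and y: "y \<in> carrier V"
    show "closedin ?T {f \<in> topspace ?T. f (x \<oplus>\<^bsub>V\<^esub> y) - f x - f y \<in> {0}}"
      by (rule closedin_continuous_map_preimage[where Y = euclidean])
         (intro continuous_map_diff coord x y M.a_closed, simp)
    show "closedin ?T {f \<in> topspace ?T. f (c \<odot>\<^bsub>V\<^esub> x) - c * f x \<in> {0}}"
    proof (rule closedin_continuous_map_preimage[where Y = euclidean])
      have "continuous_map ?T euclidean (\<lambda>f. c * f x)"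
        using continuous_map_compose[OF coord[OF x], of euclidean "(*) c"]
        by (simp add: comp_def continuous_on_mult_left)
      then show "continuous_map ?T euclidean (\<lambda>f. f (c \<odot>\<^bsub>V\<^esub> x) - c * f x)"
        using x by (intro continuous_map_diff coord) auto
    qed simp
  qed (use M.zero_closed in auto)
  then have "compactin ?T (L \<inter> B)" by (rule closed_Int_compactin) (rule B)
  moreover have "L \<inter> B = {f \<in> carrier (dual V). vnorm (dual V) f \<le> r}"
  proof (intro equalityI subsetI)
    fix f assume f: "f \<in> L \<inter> B"
    then have ext: "f \<in> extensional (carrier V)" by (auto simp: B_def PiE_def)
    have lin: "f (x \<oplus>\<^bsub>V\<^esub> y) = f x + f y" "f (c \<odot>\<^bsub>V\<^esub> x) = c * f x"
      if "x \<in> carrier V" "y \<in> carrier V" for x y c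
    proof -
      have "f (x \<oplus>\<^bsub>V\<^esub> y) - f x - f y \<in> {0} \<and> f (c \<odot>\<^bsub>V\<^esub> x) - c * f x \<in> {0}"
        using f that unfolding L_def by blast
      then show "f (x \<oplus>\<^bsub>V\<^esub> y) = f x + f y" "f (c \<odot>\<^bsub>V\<^esub> x) = c * f x" by (simp_all add: algebra_simps)
    qed
    have bd: "norm (f x) \<le> r * vnorm V x" if "x \<in> carrier V" for x
      using f that by (auto simp: B_def PiE_iff)
    have "restrict f (carrier V) \<in> carrier (dual V)"
      by (rule dualI[where C = r]) (use lin bd in auto)
    then have fD: "f \<in> carrier (dual V)" using ext by (simp add: extensional_restrict)
    have "vnorm (dual V) f \<le> r"
    proof (rule dual_norm_least)
      fix x assume x: "x \<in> unit_ball V"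
      then show "norm (f x) \<le> r"
        using bd[of x] mult_left_le[OF _ r, of "vnorm V x"] by (simp add: unit_ball_def)
    qed
    then show "f \<in> {f \<in> carrier (dual V). vnorm (dual V) f \<le> r}" using fD by simp
  next
    fix f assume "f \<in> {f \<in> carrier (dual V). vnorm (dual V) f \<le> r}"
    then have f: "f \<in> carrier (dual V)" "vnorm (dual V) f \<le> r" by auto
    have "norm (f x) \<le> r * vnorm V x" if x: "x \<in> carrier V" for x
      using dual_norm_le[OF f(1) x] mult_right_mono[OF f(2) vnorm_nonneg[OF x]] by linarith
    then have "f \<in> B" using f(1) by (auto simp: B_def PiE_iff in_dual_iff)
    moreover have "f \<in> L"
      using f(1) by (auto simp: L_def dual_add dual_smult in_dual_iff[of f] PiE_iff)
    ultimately show "f \<in> L \<inter> B" by simp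
  qed
  ultimately show ?thesis by simp
qed

text \<open>Goldstine's theorem, for finitely many functionals at a time, by minimization. Let \<open>N x\<close> be the
  squared distance between the values of \<open>\<Phi>\<close> and those of \<open>x\<close> on \<open>T\<close>, and \<open>d\<close> its infimum over the ball. If
  \<open>d\<close> is positive, then moving from an almost-minimizer \<open>x0\<close> towards other points of the ball shows that
  the combination \<open>g\<close> of \<open>T\<close> whose coefficients are the conjugates of the errors at \<open>x0\<close> almost attains
  its maximal real part over the ball at \<open>x0\<close>. As \<open>\<Phi> g\<close> is bounded by \<open>r\<close> times the norm of \<open>g\<close>, this
  makes \<open>N x0\<close> at most \<open>d / 2\<close>.\<close>

theorem Goldstine:
  assumes \<Phi>: "\<Phi> \<in> carrier (dual (dual V))" and T: "finite T" "T \<subseteq> carrier (dual V)"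
    and r: "r > 0" "vnorm (dual (dual V)) \<Phi> \<le> r" and \<eta>: "\<eta> > 0"
  obtains x where "x \<in> carrier V" "vnorm V x \<le> r" "\<And>\<psi>. \<psi> \<in> T \<Longrightarrow> norm (\<Phi> \<psi> - \<psi> x) < \<eta>"
proof -
  interpret D: normed_space "dual V" by (rule normed_space_dual)
  interpret DD: normed_space "dual (dual V)" by (rule D.normed_space_dual)
  define N where "N x = (\<Sum>\<psi>\<in>T. (norm (\<Phi> \<psi> - \<psi> x))\<^sup>2)" for x
  define B where "B = {x \<in> carrier V. vnorm V x \<le> r}"
  define d where "d = (INF x\<in>B. N x)"
  have TD: "\<psi> \<in> carrier (dual V)" if "\<psi> \<in> T" for \<psi> using T that by auto
  have zero: "\<zero>\<^bsub>V\<^esub> \<in> B" using r by (simp add: B_def)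
  have N0: "0 \<le> N x" for x by (simp add: N_def sum_nonneg)
  have d_le: "d \<le> N x" if "x \<in> B" for x
    unfolding d_def using that N0 by (intro cINF_lower) (auto intro!: bdd_belowI2)
  have "d \<le> 0"
  proof (rule ccontr)
    assume "\<not> d \<le> 0"
    then have d: "d > 0" by simp
    define M where "M = (\<Sum>\<psi>\<in>T. (2 * r * vnorm (dual V) \<psi>)\<^sup>2) + 1"
    have M: "M > 0" unfolding M_def by (intro add_nonneg_pos sum_nonneg) auto
    \<comment> \<open>the length of the step away from \<open>x0\<close>, short enough to make the quadratic term at most \<open>t * d / 2\<close>\<close>
    define t where "t = min 1 (d / (2 * M))"
    have t: "t > 0" "t \<le> 1" "t * M \<le> d / 2"
    proof -
      show "t > 0" "t \<le> 1" using d M by (auto simp: t_def)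
      have "t * M \<le> d / (2 * M) * M" using M by (intro mult_right_mono) (auto simp: t_def)
      then show "t * M \<le> d / 2" using M by simp
    qed
    have "\<exists>x\<in>B. N x < d + t * d / 2"
    proof (rule ccontr)
      assume "\<not> ?thesis"
      then have "d + t * d / 2 \<le> d" unfolding d_def using zero by (intro cINF_greatest) (auto simp: not_less d_def)
      then show False using mult_pos_pos[OF t(1) d] by simp
    qed
    then obtain x0 where x0: "x0 \<in> B" "N x0 < d + t * d / 2" by blast
    have x0V: "x0 \<in> carrier V" "vnorm V x0 \<le> r" using x0 by (auto simp: B_def)
    define w where "w \<psi> = \<Phi> \<psi> - \<psi> x0" for \<psi>
    define S where "S x = (\<Sum>\<psi>\<in>T. (\<psi> x - \<psi> x0) \<bullet> w \<psi>)" for x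
    have S_le: "S x \<le> d / 2" if x: "x \<in> B" for x
    proof -
      have xV: "x \<in> carrier V" "vnorm V x \<le> r" using x by (auto simp: B_def)
      define z where "z = x0 \<oplus>\<^bsub>V\<^esub> of_real t \<odot>\<^bsub>V\<^esub> (x \<ominus>\<^bsub>V\<^esub> x0)"
      have z_eq: "z = of_real (1 - t) \<odot>\<^bsub>V\<^esub> x0 \<oplus>\<^bsub>V\<^esub> of_real t \<odot>\<^bsub>V\<^esub> x"
      proof -
        have "of_real (1 - t) \<odot>\<^bsub>V\<^esub> x0 = x0 \<oplus>\<^bsub>V\<^esub> (- of_real t) \<odot>\<^bsub>V\<^esub> x0"
          using add_smult[OF x0V(1), of 1 "- of_real t"] x0V by simp
        then show ?thesis using xV x0V by (simp add: z_def diff_eq_smult smult_add smult_smult M.a_ac)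
      qed
      have "vnorm V z \<le> (1 - t) * vnorm V x0 + t * vnorm V x"
        using vnorm_triangle[of "of_real (1 - t) \<odot>\<^bsub>V\<^esub> x0" "of_real t \<odot>\<^bsub>V\<^esub> x"] xV x0V t
        unfolding z_eq by (simp add: vnorm_smult del: of_real_diff)
      also have "\<dots> \<le> (1 - t) * r + t * r" using t xV x0V by (intro add_mono mult_left_mono) auto
      finally have zB: "z \<in> B" using xV x0V by (simp add: B_def z_def algebra_simps)
      have summand: "(norm (\<Phi> \<psi> - \<psi> z))\<^sup>2 \<le> (norm (w \<psi>))\<^sup>2 - 2 * t * ((\<psi> x - \<psi> x0) \<bullet> w \<psi>) + t\<^sup>2 * (2 * r * vnorm (dual V) \<psi>)\<^sup>2"
        if \<psi>: "\<psi> \<in> T" for \<psi>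
      proof -
        have "\<Phi> \<psi> - \<psi> z = w \<psi> - t *\<^sub>R (\<psi> x - \<psi> x0)"
          using TD[OF \<psi>] xV x0V by (simp add: z_def w_def dual_add dual_smult dual_diff scaleR_conv_of_real)
        then have "(norm (\<Phi> \<psi> - \<psi> z))\<^sup>2 = (norm (w \<psi>))\<^sup>2 - 2 * t * ((\<psi> x - \<psi> x0) \<bullet> w \<psi>) + t\<^sup>2 * (norm (\<psi> x - \<psi> x0))\<^sup>2"
          unfolding power2_norm_eq_inner
          by (simp only: inner_diff_left[of "w \<psi>"] inner_diff_right[of _ "w \<psi>"] inner_scaleR_left inner_scaleR_right
              inner_commute[of "w \<psi>" "\<psi> x - \<psi> x0"]) (simp add: power2_eq_square algebra_simps)
        moreover have "norm (\<psi> x - \<psi> x0) \<le> 2 * r * vnorm (dual V) \<psi>"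
        proof -
          have "norm (\<psi> x - \<psi> x0) \<le> vnorm (dual V) \<psi> * vnorm V (x \<ominus>\<^bsub>V\<^esub> x0)"
            using dual_norm_le[OF TD[OF \<psi>], of "x \<ominus>\<^bsub>V\<^esub> x0"] TD[OF \<psi>] xV x0V by (simp add: dual_diff)
          also have "\<dots> \<le> vnorm (dual V) \<psi> * (2 * r)"
            using vnorm_diff_le[of x x0] xV x0V TD[OF \<psi>] by (intro mult_left_mono) auto
          finally show ?thesis by (simp add: mult.commute)
        qed
        then have "t\<^sup>2 * (norm (\<psi> x - \<psi> x0))\<^sup>2 \<le> t\<^sup>2 * (2 * r * vnorm (dual V) \<psi>)\<^sup>2"
          by (intro mult_left_mono power_mono) auto
        ultimately show ?thesis by linarith
      qed
      have "N z \<le> (\<Sum>\<psi>\<in>T. (norm (w \<psi>))\<^sup>2 - 2 * t * ((\<psi> x - \<psi> x0) \<bullet> w \<psi>) + t\<^sup>2 * (2 * r * vnorm (dual V) \<psi>)\<^sup>2)"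
        unfolding N_def by (rule sum_mono) (rule summand)
      also have "\<dots> = N x0 - 2 * t * S x + t\<^sup>2 * (M - 1)"
        by (simp add: N_def S_def M_def w_def sum.distrib sum_subtractf sum_distrib_left)
      finally have "d \<le> N x0 - 2 * t * S x + t\<^sup>2 * M" using d_le[OF zB] zero_le_power2[of t] unfolding right_diff_distrib by linarith
      then have "t * (2 * S x) \<le> t * (d / 2 + t * M)" using x0(2) by (simp add: algebra_simps power2_eq_square)
      then have "2 * S x \<le> d / 2 + t * M" using t(1) by simp
      then show ?thesis using t(3) by simp
    qed
    \<comment> \<open>\<open>c \<psi>\<close> is the conjugate of \<open>w \<psi>\<close>\<close>
    obtain c where c: "\<And>\<psi> a. a \<bullet> w \<psi> = (a * c \<psi>) \<bullet> 1"
    proof -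
      have "\<exists>c. \<forall>a. a \<bullet> w \<psi> = (a * c) \<bullet> 1" for \<psi>
        using inner_one_representation[of "\<lambda>a. a \<bullet> w \<psi>"] bounded_linear.linear[OF bounded_linear_inner_left] by metis
      then show thesis using that by metis
    qed
    define g where "g = (\<Oplus>\<^bsub>dual V\<^esub>\<psi>\<in>T. c \<psi> \<odot>\<^bsub>dual V\<^esub> \<psi>)"
    have cT: "(\<lambda>\<psi>. c \<psi> \<odot>\<^bsub>dual V\<^esub> \<psi>) \<in> T \<rightarrow> carrier (dual V)" using TD by auto
    have gD: "g \<in> carrier (dual V)" unfolding g_def by (rule D.M.finsum_closed[OF cT])
    have g_bidual: "\<Psi> g \<bullet> 1 = (\<Sum>\<psi>\<in>T. \<Psi> \<psi> \<bullet> w \<psi>)" if "\<Psi> \<in> carrier (dual (dual V))" for \<Psi>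
      unfolding g_def D.dual_finsum[OF that T(1) cT] inner_sum_left
      by (rule sum.cong) (simp_all add: D.dual_smult[OF that TD] c mult.commute)
    have g_eval: "g x \<bullet> 1 = (\<Sum>\<psi>\<in>T. \<psi> x \<bullet> w \<psi>)" if "x \<in> carrier V" for x
      using g_bidual[OF eval_in_bidual[OF that]] gD TD by (simp cong: sum.cong)
    define s where "s = d / 2 + g x0 \<bullet> 1"
    have gs: "g x \<bullet> 1 \<le> s" if "x \<in> B" for x
      using S_le[OF that] that x0V
      by (simp add: S_def s_def g_eval B_def inner_diff_left sum_subtractf)
    have "vnorm (dual V) g \<le> s / r"
    proof (rule dual_norm_least)
      fix x assume x: "x \<in> unit_ball V"
      then have xV: "x \<in> carrier V" "vnorm V x \<le> 1" by (auto simp: unit_ball_def)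
      show "norm (g x) \<le> s / r"
      proof (cases "g x = 0")
        case True
        have "0 \<le> s" using gs[OF zero] dual_zero[OF gD] by simp
        then show ?thesis using True r by simp
      next
        case False
        let ?t = "of_real r * (of_real (norm (g x)) / g x)"
        have "vnorm V (?t \<odot>\<^bsub>V\<^esub> x) \<le> r"
          using xV r False by (simp add: vnorm_smult norm_mult norm_divide)
        then have "g (?t \<odot>\<^bsub>V\<^esub> x) \<bullet> 1 \<le> s" using gs xV by (simp add: B_def)
        moreover have "g (?t \<odot>\<^bsub>V\<^esub> x) = of_real (r * norm (g x))"
          using False by (simp add: dual_smult[OF gD xV(1)])
        ultimately have "r * norm (g x) \<le> s" by (simp del: of_real_mult)
        then show ?thesis using r by (simp add: field_simps)
      qed
    qed
    then have "r * vnorm (dual V) g \<le> s" using r by (simp add: field_simps)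
    moreover have "\<Phi> g \<bullet> 1 \<le> r * vnorm (dual V) g"
    proof -
      have "\<Phi> g \<bullet> 1 \<le> norm (\<Phi> g) * norm (1::'k)" by (rule norm_cauchy_schwarz)
      also have "\<dots> \<le> vnorm (dual (dual V)) \<Phi> * vnorm (dual V) g" using D.dual_norm_le[OF \<Phi> gD] by simp
      also have "\<dots> \<le> r * vnorm (dual V) g" using r gD by (intro mult_right_mono) auto
      finally show ?thesis .
    qed
    ultimately have "(\<Sum>\<psi>\<in>T. \<Phi> \<psi> \<bullet> w \<psi>) \<le> d / 2 + (\<Sum>\<psi>\<in>T. \<psi> x0 \<bullet> w \<psi>)"
      using g_bidual[OF \<Phi>] g_eval[OF x0V(1)] by (simp add: s_def)
    moreover have "N x0 = (\<Sum>\<psi>\<in>T. \<Phi> \<psi> \<bullet> w \<psi>) - (\<Sum>\<psi>\<in>T. \<psi> x0 \<bullet> w \<psi>)"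
      by (simp add: N_def w_def power2_norm_eq_inner inner_diff_left flip: sum_subtractf)
    ultimately show False using d_le[OF x0(1)] d by simp
  qed
  have "\<exists>x\<in>B. N x < \<eta>\<^sup>2"
  proof (rule ccontr)
    assume "\<not> ?thesis"
    then have "\<eta>\<^sup>2 \<le> d" unfolding d_def using zero by (intro cINF_greatest) (auto simp: not_less)
    then show False using \<open>d \<le> 0\<close> zero_less_power[OF \<eta>, of 2] by linarith
  qed
  then obtain x where x: "x \<in> B" "N x < \<eta>\<^sup>2" by blast
  show thesis
  proof (rule that[of x])
    fix \<psi> assume "\<psi> \<in> T"
    then have "(norm (\<Phi> \<psi> - \<psi> x))\<^sup>2 \<le> N x" unfolding N_def using T by (intro member_le_sum) auto
    then have "(norm (\<Phi> \<psi> - \<psi> x))\<^sup>2 < \<eta>\<^sup>2" using x by simp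
    then show "norm (\<Phi> \<psi> - \<psi> x) < \<eta>" using \<eta> by (simp add: power2_less_imp_less)
  qed (use x in \<open>auto simp: B_def\<close>)
qed

text \<open>The evaluations at \<open>x n\<close> lie in a ball of the bidual, which is compact pointwise.\<close>

lemma bidual_cluster_point:
  fixes x :: "nat \<Rightarrow> 'a"
  assumes x: "\<And>n. x n \<in> carrier V" "\<And>n. vnorm V (x n) \<le> r"
  obtains \<Psi> where "\<Psi> \<in> carrier (dual (dual V))"
    "\<And>f m. f \<in> carrier (dual V) \<Longrightarrow> \<Psi> f \<in> closure ((\<lambda>n. f (x n)) ` {m..})"
proof -
  interpret D: RC_normed_space "dual V" by (simp add: RC_normed_space_def normed_space_dual)
  let ?T = "product_topology (\<lambda>_. euclidean :: 'k topology) (carrier (dual V))"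
  have r: "r \<ge> 0" using x(2)[of 0] vnorm_nonneg[OF x(1)[of 0]] by linarith
  let ?e = "\<lambda>n. \<lambda>f\<in>carrier (dual V). f (x n)"
  have "vnorm (dual (dual V)) (?e n) \<le> r" for n
  proof (rule D.dual_norm_least)
    fix f assume "f \<in> unit_ball (dual V)"
    then have f: "f \<in> carrier (dual V)" "vnorm (dual V) f \<le> 1" by (auto simp: unit_ball_def)
    have "norm (f (x n)) \<le> 1 * vnorm V (x n)"
      using dual_norm_le[OF f(1) x(1)[of n]] mult_right_mono[OF f(2) vnorm_nonneg[OF x(1)[of n]]] by simp
    then show "norm (?e n f) \<le> r" using f x(2)[of n] by simp
  qed
  then have e: "range ?e \<subseteq> {\<Psi> \<in> carrier (dual (dual V)). vnorm (dual (dual V)) \<Psi> \<le> r}"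
    using eval_in_bidual[OF x(1)] by auto
  obtain \<Psi> where \<Psi>: "\<Psi> \<in> {\<Psi> \<in> carrier (dual (dual V)). vnorm (dual (dual V)) \<Psi> \<le> r}"
    "\<And>U m. openin ?T U \<Longrightarrow> \<Psi> \<in> U \<Longrightarrow> \<exists>n\<ge>m. ?e n \<in> U"
    by (rule compactin_cluster_point[OF D.Banach_Alaoglu[OF r] e]) blast
  have "\<Psi> f \<in> closure ((\<lambda>n. f (x n)) ` {m..})" if f: "f \<in> carrier (dual V)" for f m
    unfolding closure_iff_nhds_not_empty
  proof (intro allI impI)
    fix S U :: "'k set" assume U: "U \<subseteq> S" "open U" "\<Psi> f \<in> U"
    have "openin ?T {g \<in> topspace ?T. g f \<in> U}"
      using continuous_map_product_projection[of f "carrier (dual V)" "\<lambda>_. euclidean"] f U(2)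
      by (intro openin_continuous_map_preimage[where Y = euclidean]) auto
    moreover have "\<Psi> \<in> {g \<in> topspace ?T. g f \<in> U}"
      using \<Psi>(1) U(3) by (simp add: D.in_dual_iff PiE_def)
    ultimately obtain n where "n \<ge> m" "?e n \<in> {g \<in> topspace ?T. g f \<in> U}" using \<Psi>(2) by blast
    then have "f (x n) \<in> U" using f by simp
    then show "(\<lambda>n. f (x n)) ` {m..} \<inter> S \<noteq> {}" using U(1) \<open>n \<ge> m\<close> by auto
  qed
  then show thesis using \<Psi>(1) by (intro that) auto
qed

end

section \<open>Weakly compact norming sets\<close>

text \<open>Call \<open>D\<close> rich if it meets infinitely many \<open>E n\<close> in measure at least some \<open>\<epsilon> > 0\<close>. For a rich \<open>D\<close> some
  \<open>D \<inter> E n\<close> with \<open>n\<close> large is rich again. Otherwise one could pick many of the sets with almost no overlap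
  within \<open>D\<close>, and their total measure would exceed that of \<open>D\<close>. Iterating from \<open>K\<close> gives the subsequence.
  Only finite additivity is available, so an argument by upper limits of sets would not do.\<close>

lemma finitely_additive_intersections:
  fixes \<mu> :: "'y set \<Rightarrow> real" and E :: "nat \<Rightarrow> 'y set"
  assumes add: "\<And>A B. A \<subseteq> K \<Longrightarrow> B \<subseteq> K \<Longrightarrow> A \<inter> B = {} \<Longrightarrow> \<mu> (A \<union> B) = \<mu> A + \<mu> B"
    and nonneg: "\<And>A. A \<subseteq> K \<Longrightarrow> 0 \<le> \<mu> A"
    and E: "\<And>n. E n \<subseteq> K" "\<And>n. \<delta> \<le> \<mu> (E n)" and \<delta>: "\<delta> > 0"
  obtains s :: "nat \<Rightarrow> nat" where "strict_mono s" "\<And>i. (\<Inter>j\<le>i. E (s j)) \<noteq> {}"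
proof -
  have mono: "\<mu> A \<le> \<mu> B" if "A \<subseteq> B" "B \<subseteq> K" for A B
    using add[of A "B - A"] nonneg[of "B - A"] that by (simp add: Un_absorb1 subset_iff)
  have sub: "\<mu> (A \<union> B) = \<mu> A + \<mu> B - \<mu> (A \<inter> B)" if "A \<subseteq> K" "B \<subseteq> K" for A B
  proof -
    have "\<mu> (A \<union> B) = \<mu> A + \<mu> (B - A)" using add[of A "B - A"] that by auto
    moreover have "\<mu> B = \<mu> (B - A) + \<mu> (A \<inter> B)"
    proof -
      have "B - A \<subseteq> K" "A \<inter> B \<subseteq> K" using that by auto
      from add[OF this] have "\<mu> ((B - A) \<union> (A \<inter> B)) = \<mu> (B - A) + \<mu> (A \<inter> B)" by auto
      moreover have "(B - A) \<union> (A \<inter> B) = B" by auto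
      ultimately show ?thesis by simp
    qed
    ultimately show ?thesis by simp
  qed
  define rich where "rich D \<longleftrightarrow> D \<subseteq> K \<and> (\<exists>\<epsilon>>0. infinite {n. \<epsilon> \<le> \<mu> (D \<inter> E n)})" for D
  have step: "\<exists>n\<ge>m. rich (D \<inter> E n)" if D: "rich D" for D m
  proof (rule ccontr)
    assume "\<not> ?thesis"
    then have poor: "\<not> rich (D \<inter> E n)" if "n \<ge> m" for n using that by blast
    obtain \<epsilon> where \<epsilon>: "\<epsilon> > 0" "infinite {n. \<epsilon> \<le> \<mu> (D \<inter> E n)}" and DK: "D \<subseteq> K"
      using D by (auto simp: rich_def)
    have "\<exists>S. finite S \<and> S \<subseteq> {m..} \<and> real L * \<epsilon> / 2 \<le> \<mu> (D \<inter> (\<Union>n\<in>S. E n))" for L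
    proof (induction L)
      case 0
      show ?case by (rule exI[of _ "{}"]) (simp add: nonneg)
    next
      case (Suc L)
      then obtain S where S: "finite S" "S \<subseteq> {m..}" "real L * \<epsilon> / 2 \<le> \<mu> (D \<inter> (\<Union>n\<in>S. E n))" by blast
      \<comment> \<open>an overlap so small that \<open>card S\<close> of them cost at most \<open>\<epsilon> / 2\<close>\<close>
      define c where "c = \<epsilon> / (2 * (real (card S) + 1))"
      have c: "c > 0" using \<epsilon> by (simp add: c_def)
      have "finite {k. c \<le> \<mu> (D \<inter> E n \<inter> E k)}" if "n \<in> S" for n
        using poor[of n] S(2) that c DK by (auto simp: rich_def)
      then have "finite (\<Union>n\<in>S. {k. c \<le> \<mu> (D \<inter> E n \<inter> E k)})" using S(1) by blast
      then have "finite ((\<Union>n\<in>S. {k. c \<le> \<mu> (D \<inter> E n \<inter> E k)}) \<union> {..m})" by simp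
      from infinite_imp_nonempty[OF Diff_infinite_finite[OF this \<epsilon>(2)]]
      obtain k where "k \<in> {n. \<epsilon> \<le> \<mu> (D \<inter> E n)} - ((\<Union>n\<in>S. {k. c \<le> \<mu> (D \<inter> E n \<inter> E k)}) \<union> {..m})"
        by blast
      then have k: "\<epsilon> \<le> \<mu> (D \<inter> E k)" "k > m" "\<And>n. n \<in> S \<Longrightarrow> \<mu> (D \<inter> E n \<inter> E k) < c"
        by auto
      have sum_le: "\<mu> (\<Union>n\<in>F. D \<inter> E n \<inter> E k) \<le> real (card F) * c" if "finite F" "F \<subseteq> S" for F
        using that
      proof (induction F)
        case empty
        have "\<mu> {} = 0" using add[of "{}" "{}"] by simp
        then show ?case by simp
      next
        case (insert n F)
        have "\<mu> (\<Union>n\<in>insert n F. D \<inter> E n \<inter> E k) \<le> \<mu> (D \<inter> E n \<inter> E k) + \<mu> (\<Union>n\<in>F. D \<inter> E n \<inter> E k)"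
          using sub[of "D \<inter> E n \<inter> E k" "\<Union>n\<in>F. D \<inter> E n \<inter> E k"] DK
            nonneg[of "D \<inter> E n \<inter> E k \<inter> (\<Union>n\<in>F. D \<inter> E n \<inter> E k)"] by (simp add: subset_iff)
        also have "\<dots> \<le> c + real (card F) * c" using insert k(3)[of n] by (intro add_mono) auto
        finally show ?case using insert by (simp add: algebra_simps)
      qed
      have "\<mu> (D \<inter> (\<Union>n\<in>insert k S. E n)) = \<mu> (D \<inter> (\<Union>n\<in>S. E n) \<union> D \<inter> E k)"
        by (rule arg_cong[of _ _ \<mu>]) auto
      also have "\<dots> = \<mu> (D \<inter> (\<Union>n\<in>S. E n)) + \<mu> (D \<inter> E k) - \<mu> (\<Union>n\<in>S. D \<inter> E n \<inter> E k)"
      proof -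
        have "(D \<inter> (\<Union>n\<in>S. E n)) \<inter> (D \<inter> E k) = (\<Union>n\<in>S. D \<inter> E n \<inter> E k)" by auto
        then show ?thesis using sub[of "D \<inter> (\<Union>n\<in>S. E n)" "D \<inter> E k"] DK by auto
      qed
      finally have "real L * \<epsilon> / 2 + \<epsilon> - real (card S) * c \<le> \<mu> (D \<inter> (\<Union>n\<in>insert k S. E n))"
        using S(3) k(1) sum_le[OF S(1) order_refl] by linarith
      moreover have "real (card S) * c \<le> \<epsilon> / 2" using \<epsilon> by (simp add: c_def field_simps)
      ultimately have "real (Suc L) * \<epsilon> / 2 \<le> \<mu> (D \<inter> (\<Union>n\<in>insert k S. E n))"
        by (simp add: algebra_simps add_divide_distrib)
      then show ?case using S k(2) by (intro exI[of _ "insert k S"]) auto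
    qed
    note * = this
    obtain L :: nat where L: "\<mu> D < real L * (\<epsilon> / 2)" using reals_Archimedean3[of "\<epsilon> / 2"] \<epsilon> by auto
    from *[of L] obtain S where "real L * \<epsilon> / 2 \<le> \<mu> (D \<inter> (\<Union>n\<in>S. E n))" by blast
    also have "\<dots> \<le> \<mu> D" using DK by (intro mono) auto
    finally show False using L by simp
  qed
  have rich_K: "rich K"
  proof -
    have "{n. \<delta> \<le> \<mu> (K \<inter> E n)} = UNIV" using E by (auto simp: Int_absorb1)
    then show ?thesis using \<delta> by (auto simp: rich_def)
  qed
  have "\<exists>f. \<forall>i. (rich (fst (f i)) \<and> fst (f i) \<subseteq> E (snd (f i))) \<and>
      (snd (f i) < snd (f (Suc i)) \<and> fst (f (Suc i)) \<subseteq> fst (f i))"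
  proof (rule dependent_nat_choice[where P = "\<lambda>_ x. rich (fst x) \<and> fst x \<subseteq> E (snd x)"
        and Q = "\<lambda>_ x y. snd x < snd y \<and> fst y \<subseteq> fst x"])
    obtain n where "rich (K \<inter> E n)" using step[OF rich_K, of 0] by blast
    then show "\<exists>x. rich (fst x) \<and> fst x \<subseteq> E (snd x)" by (intro exI[of _ "(K \<inter> E n, n)"]) auto
  next
    fix x :: "'y set \<times> nat" and i :: nat assume "rich (fst x) \<and> fst x \<subseteq> E (snd x)"
    then obtain n where "n \<ge> Suc (snd x)" "rich (fst x \<inter> E n)" using step by blast
    then show "\<exists>y. (rich (fst y) \<and> fst y \<subseteq> E (snd y)) \<and> snd x < snd y \<and> fst y \<subseteq> fst x"
      by (intro exI[of _ "(fst x \<inter> E n, n)"]) auto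
  qed
  then obtain f where f: "\<And>i. rich (fst (f i))" "\<And>i. fst (f i) \<subseteq> E (snd (f i))"
    "\<And>i. snd (f i) < snd (f (Suc i))" "\<And>i. fst (f (Suc i)) \<subseteq> fst (f i)" by blast
  show thesis
  proof (rule that)
    show "strict_mono (\<lambda>i. snd (f i))" using f(3) by (simp add: strict_mono_Suc_iff)
    fix i
    have "fst (f i) \<subseteq> fst (f j)" if "j \<le> i" for j
      using lift_Suc_antimono_le[of "\<lambda>i. fst (f i)"] f(4) that by blast
    then have "fst (f i) \<subseteq> (\<Inter>j\<le>i. E (snd (f j)))" using f(2) by blast
    moreover have "fst (f i) \<noteq> {}"
    proof
      assume "fst (f i) = {}"
      moreover have "\<mu> {} = 0" using add[of "{}" "{}"] by simp
      ultimately show False using f(1)[of i] by (auto simp: rich_def not_le[symmetric])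
    qed
    ultimately show "(\<Inter>j\<le>i. E (snd (f j))) \<noteq> {}" by blast
  qed
qed

text \<open>Functions are total on the type and bounded on \<open>K\<close>; their values off \<open>K\<close> are arbitrary.\<close>

definition bounded_functions :: "'y set \<Rightarrow> (real, 'y \<Rightarrow> real) module" where
  "bounded_functions K = \<lparr>carrier = {g. bdd_above ((\<lambda>y. \<bar>g y\<bar>) ` K)}, mult = undefined, one = undefined,
     zero = (\<lambda>_. 0), add = (\<lambda>g h y. g y + h y), smult = (\<lambda>t g y. t * g y)\<rparr>"

lemma bounded_functions_simps [simp]:
  "zero (bounded_functions K) = (\<lambda>_. 0)"
  "add (bounded_functions K) g h = (\<lambda>y. g y + h y)"
  "smult (bounded_functions K) t g = (\<lambda>y. t * g y)"
  by (simp_all add: bounded_functions_def)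

lemma in_bounded_functions: "g \<in> carrier (bounded_functions K) \<longleftrightarrow> (\<exists>c. \<forall>y\<in>K. \<bar>g y\<bar> \<le> c)"
  by (auto simp: bounded_functions_def bdd_above_def)

lemma real_module_bounded_functions: "real_module (bounded_functions K)"
proof -
  let ?B = "bounded_functions K"
  have add: "(\<lambda>y. g y + h y) \<in> carrier ?B" if gh: "g \<in> carrier ?B" "h \<in> carrier ?B" for g h
  proof -
    obtain b c where "\<forall>y\<in>K. \<bar>g y\<bar> \<le> b" "\<forall>y\<in>K. \<bar>h y\<bar> \<le> c"
      using gh by (auto simp: in_bounded_functions)
    then have "\<forall>y\<in>K. \<bar>g y + h y\<bar> \<le> b + c" by (meson abs_triangle_ineq add_mono order_trans)
    then show ?thesis by (auto simp: in_bounded_functions)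
  qed
  have smult: "(\<lambda>y. t * g y) \<in> carrier ?B" if g: "g \<in> carrier ?B" for t g
  proof -
    obtain b where "\<forall>y\<in>K. \<bar>g y\<bar> \<le> b" using g by (auto simp: in_bounded_functions)
    then have "\<forall>y\<in>K. \<bar>t * g y\<bar> \<le> \<bar>t\<bar> * b" by (simp add: abs_mult mult_left_mono)
    then show ?thesis by (auto simp: in_bounded_functions)
  qed
  have "abelian_group ?B"
  proof (rule abelian_groupI)
    fix g assume "g \<in> carrier ?B"
    then show "\<exists>h\<in>carrier ?B. h \<oplus>\<^bsub>?B\<^esub> g = \<zero>\<^bsub>?B\<^esub>"
      using smult[of g "-1"] by (intro bexI[of _ "\<lambda>y. - g y"]) auto
  qed (use add in \<open>auto simp: in_bounded_functions[of "\<lambda>_. 0"] algebra_simps\<close>)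
  then have "module scalar_field ?B"
    by (intro moduleI[OF cring_scalar_field]) (auto simp: smult algebra_simps)
  then show ?thesis by (simp add: real_module_def)
qed

text \<open>Integrals with respect to finitely additive probabilities on \<open>K\<close>; \<open>\<Lambda> g \<le> c\<close> for \<open>g \<le> c\<close> expresses
  positivity and total mass one together.\<close>

definition mean_on :: "'y set \<Rightarrow> (('y \<Rightarrow> real) \<Rightarrow> real) \<Rightarrow> bool" where
  "mean_on K \<Lambda> \<longleftrightarrow>
    (\<forall>g\<in>carrier (bounded_functions K). \<forall>h\<in>carrier (bounded_functions K). \<Lambda> (\<lambda>y. g y + h y) = \<Lambda> g + \<Lambda> h) \<and>
    (\<forall>t. \<forall>g\<in>carrier (bounded_functions K). \<Lambda> (\<lambda>y. t * g y) = t * \<Lambda> g) \<and>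
    (\<forall>g\<in>carrier (bounded_functions K). \<forall>c. (\<forall>y\<in>K. g y \<le> c) \<longrightarrow> \<Lambda> g \<le> c)"

text \<open>The pairs of a function \<open>u \<ge> \<bar>x\<bar>\<close> on \<open>K\<close> and the number \<open>Re (\<psi> x) / D\<close>, for all \<open>x\<close>, form a convex cone. That
  \<open>K\<close> is norming says that the number is at most the supremum of \<open>u\<close> if \<open>D\<close> is large, so a linear functional
  below the supremum can be made to respect all these lower bounds.\<close>

lemma (in RC_normed_space) dominating_mean:
  assumes K: "K \<subseteq> carrier (dual V)" and M: "\<And>\<kappa>. \<kappa> \<in> K \<Longrightarrow> vnorm (dual V) \<kappa> \<le> M"
    and C: "C > 0" "\<And>x s. x \<in> carrier V \<Longrightarrow> (\<And>\<kappa>. \<kappa> \<in> K \<Longrightarrow> norm (\<kappa> x) \<le> s) \<Longrightarrow> vnorm V x \<le> C * s"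
    and \<psi>: "\<psi> \<in> carrier (dual V)"
  obtains \<Lambda> D where "D > 0" "mean_on K \<Lambda>"
    "\<And>x. x \<in> carrier V \<Longrightarrow> \<psi> x \<bullet> 1 \<le> D * \<Lambda> (\<lambda>\<kappa>. norm (\<kappa> x))"
proof -
  interpret D: normed_space "dual V" by (rule normed_space_dual)
  interpret B: real_module "bounded_functions K" by (rule real_module_bounded_functions)
  have "K \<noteq> {}" using C(2)[of "\<zero>\<^bsub>V\<^esub>" "-1"] C(1) by auto
  define p where "p g = (SUP \<kappa>\<in>K. g \<kappa>)" for g :: "('a \<Rightarrow> 'k) \<Rightarrow> real"
  have p_upper: "g \<kappa> \<le> p g" if g: "g \<in> carrier (bounded_functions K)" and \<kappa>: "\<kappa> \<in> K" for g \<kappa>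
    unfolding p_def
  proof (rule cSUP_upper[OF \<kappa>])
    obtain c where "\<forall>y\<in>K. \<bar>g y\<bar> \<le> c" using g by (auto simp: in_bounded_functions)
    then show "bdd_above (g ` K)" by (intro bdd_aboveI2[where M = c]) (auto simp: abs_le_iff)
  qed
  have p_least: "p g \<le> c" if "\<And>\<kappa>. \<kappa> \<in> K \<Longrightarrow> g \<kappa> \<le> c" for g c
    unfolding p_def using that \<open>K \<noteq> {}\<close> by (intro cSUP_least) auto
  have p: "sublinear (bounded_functions K) p"
  proof (rule B.sublinearI)
    fix g h assume gh: "g \<in> carrier (bounded_functions K)" "h \<in> carrier (bounded_functions K)"
    show "p (g \<oplus>\<^bsub>bounded_functions K\<^esub> h) \<le> p g + p h"
      using p_upper[OF gh(1)] p_upper[OF gh(2)] by (auto intro!: p_least add_mono)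
  next
    show "p \<zero>\<^bsub>bounded_functions K\<^esub> = 0" using \<open>K \<noteq> {}\<close> by (simp add: p_def)
  next
    fix t :: real and g assume "t > 0" "g \<in> carrier (bounded_functions K)"
    then show "p (t \<odot>\<^bsub>bounded_functions K\<^esub> g) \<le> t * p g"
      using p_upper by (auto intro!: p_least mult_left_mono)
  qed
  define D where "D = (vnorm (dual V) \<psi> + 1) * C"
  have D: "D > 0" using C(1) \<psi> by (simp add: D_def add_nonneg_pos)
  define P where "P = {(u, \<alpha>). u \<in> carrier (bounded_functions K) \<and>
    (\<exists>x\<in>carrier V. \<alpha> = (\<psi> x \<bullet> 1) / D \<and> (\<forall>\<kappa>\<in>K. norm (\<kappa> x) \<le> u \<kappa>))}"
  have KD: "\<kappa> \<in> carrier (dual V)" if "\<kappa> \<in> K" for \<kappa> using K that by auto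
  obtain q where q: "sublinear (bounded_functions K) q"
    "\<And>g. g \<in> carrier (bounded_functions K) \<Longrightarrow> q g \<le> p g"
    "\<And>u \<alpha>. (u, \<alpha>) \<in> P \<Longrightarrow> q (\<ominus>\<^bsub>bounded_functions K\<^esub> u) \<le> - \<alpha>"
  proof (rule B.sublinear_below_cone[OF p, of P])
    fix u \<alpha> assume u: "(u, \<alpha>) \<in> P"
    then show "u \<in> carrier (bounded_functions K)" by (simp add: P_def)
    obtain x where x: "x \<in> carrier V" "\<alpha> = (\<psi> x \<bullet> 1) / D" "\<And>\<kappa>. \<kappa> \<in> K \<Longrightarrow> norm (\<kappa> x) \<le> u \<kappa>"
      using u by (auto simp: P_def)
    have "norm (\<kappa> x) \<le> p u" if "\<kappa> \<in> K" for \<kappa>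
      using x(3)[OF that] p_upper[OF _ that, of u] u by (simp add: P_def)
    then have le: "vnorm V x \<le> C * p u" using C(2) x(1) by blast
    have "\<psi> x \<bullet> 1 \<le> norm (\<psi> x) * norm (1::'k)" by (rule norm_cauchy_schwarz)
    also have "\<dots> \<le> (vnorm (dual V) \<psi> + 1) * vnorm V x"
      using dual_norm_le[OF \<psi> x(1)] x(1) by (simp add: distrib_right add_increasing2)
    also have "\<dots> \<le> (vnorm (dual V) \<psi> + 1) * (C * p u)"
      using le \<psi> by (intro mult_left_mono) auto
    finally show "\<alpha> \<le> p u" using D by (simp add: x(2) D_def field_simps)
  next
    show "(\<zero>\<^bsub>bounded_functions K\<^esub>, 0) \<in> P"
      using B.M.zero_closed dual_zero[OF \<psi>] dual_zero KD
      by (auto simp: P_def intro!: bexI[of _ "\<zero>\<^bsub>V\<^esub>"])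
  next
    fix u \<alpha> v \<beta> assume "(u, \<alpha>) \<in> P" "(v, \<beta>) \<in> P"
    then obtain x y where u: "u \<in> carrier (bounded_functions K)" "v \<in> carrier (bounded_functions K)"
      and x: "x \<in> carrier V" "\<alpha> = (\<psi> x \<bullet> 1) / D" "\<And>\<kappa>. \<kappa> \<in> K \<Longrightarrow> norm (\<kappa> x) \<le> u \<kappa>"
      and y: "y \<in> carrier V" "\<beta> = (\<psi> y \<bullet> 1) / D" "\<And>\<kappa>. \<kappa> \<in> K \<Longrightarrow> norm (\<kappa> y) \<le> v \<kappa>"
      by (auto simp: P_def)
    have "norm (\<kappa> (x \<oplus>\<^bsub>V\<^esub> y)) \<le> u \<kappa> + v \<kappa>" if "\<kappa> \<in> K" for \<kappa>
      using x(3)[OF that] y(3)[OF that] norm_triangle_ineq[of "\<kappa> x" "\<kappa> y"] dual_add[OF KD[OF that] x(1) y(1)] by simp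
    then show "(u \<oplus>\<^bsub>bounded_functions K\<^esub> v, \<alpha> + \<beta>) \<in> P"
      using B.M.a_closed[OF u] x(1,2) y(1,2) dual_add[OF \<psi> x(1) y(1)]
      by (auto simp: P_def inner_add_left add_divide_distrib intro!: bexI[of _ "x \<oplus>\<^bsub>V\<^esub> y"])
  next
    fix t :: real and u \<alpha> assume t: "t > 0" and "(u, \<alpha>) \<in> P"
    then obtain x where u: "u \<in> carrier (bounded_functions K)"
      and x: "x \<in> carrier V" "\<alpha> = (\<psi> x \<bullet> 1) / D" "\<And>\<kappa>. \<kappa> \<in> K \<Longrightarrow> norm (\<kappa> x) \<le> u \<kappa>"
      by (auto simp: P_def)
    have "norm (\<kappa> (of_real t \<odot>\<^bsub>V\<^esub> x)) \<le> t * u \<kappa>" if "\<kappa> \<in> K" for \<kappa>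
      using x(3)[OF that] t dual_smult[OF KD[OF that] x(1)] by (simp add: norm_mult)
    moreover have "\<psi> (of_real t \<odot>\<^bsub>V\<^esub> x) \<bullet> 1 = t * (\<psi> x \<bullet> 1)"
      using dual_smult[OF \<psi> x(1), of "of_real t"] by (simp flip: scaleR_conv_of_real)
    ultimately show "(t \<odot>\<^bsub>bounded_functions K\<^esub> u, t * \<alpha>) \<in> P"
      using B.smult_simps(4)[OF u, of t] x(1,2)
      by (auto simp: P_def intro!: bexI[of _ "of_real t \<odot>\<^bsub>V\<^esub> x"])
  qed blast
  show thesis
  proof (rule B.linear_below_sublinear[OF q(1)])
    fix \<Lambda> :: "(('a \<Rightarrow> 'k) \<Rightarrow> real) \<Rightarrow> real"
    assume add: "\<And>g h. g \<in> carrier (bounded_functions K) \<Longrightarrow> h \<in> carrier (bounded_functions K) \<Longrightarrow>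
        \<Lambda> (g \<oplus>\<^bsub>bounded_functions K\<^esub> h) = \<Lambda> g + \<Lambda> h"
      and smult: "\<And>t g. g \<in> carrier (bounded_functions K) \<Longrightarrow> \<Lambda> (t \<odot>\<^bsub>bounded_functions K\<^esub> g) = t * \<Lambda> g"
      and le: "\<And>g. g \<in> carrier (bounded_functions K) \<Longrightarrow> \<Lambda> g \<le> q g"
    show thesis
    proof (rule that[OF D, of \<Lambda>])
      have "\<Lambda> g \<le> c" if "g \<in> carrier (bounded_functions K)" "\<And>\<kappa>. \<kappa> \<in> K \<Longrightarrow> g \<kappa> \<le> c" for g c
        using le[OF that(1)] q(2)[OF that(1)] p_least[of g c] that(2) by (meson order_trans)
      then show "mean_on K \<Lambda>" using add smult by (simp add: mean_on_def)
    next
      fix x assume x: "x \<in> carrier V"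
      have u: "(\<lambda>\<kappa>. norm (\<kappa> x)) \<in> carrier (bounded_functions K)"
        unfolding in_bounded_functions
      proof (intro exI ballI)
        fix \<kappa> assume \<kappa>: "\<kappa> \<in> K"
        show "\<bar>norm (\<kappa> x)\<bar> \<le> M * vnorm V x"
          using dual_norm_le[OF KD[OF \<kappa>] x] mult_right_mono[OF M[OF \<kappa>] vnorm_nonneg[OF x]] by simp
      qed
      then have "((\<lambda>\<kappa>. norm (\<kappa> x)), (\<psi> x \<bullet> 1) / D) \<in> P" using x by (auto simp: P_def)
      from q(3)[OF this] have "\<Lambda> (\<ominus>\<^bsub>bounded_functions K\<^esub> (\<lambda>\<kappa>. norm (\<kappa> x))) \<le> - ((\<psi> x \<bullet> 1) / D)"
        using le[of "\<ominus>\<^bsub>bounded_functions K\<^esub> (\<lambda>\<kappa>. norm (\<kappa> x))"] u by simp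
      moreover have "\<ominus>\<^bsub>bounded_functions K\<^esub> (\<lambda>\<kappa>. norm (\<kappa> x)) = (- 1) \<odot>\<^bsub>bounded_functions K\<^esub> (\<lambda>\<kappa>. norm (\<kappa> x))"
        using B.minus_smult[OF u, of 1] B.smult_simps(2)[OF u] by simp
      ultimately have "(\<psi> x \<bullet> 1) / D \<le> \<Lambda> (\<lambda>\<kappa>. norm (\<kappa> x))" using smult[OF u, of "- 1"] by simp
      then show "\<psi> x \<bullet> 1 \<le> D * \<Lambda> (\<lambda>\<kappa>. norm (\<kappa> x))" using D by (simp add: field_simps)
    qed
  qed
qed

text \<open>The order of choices matters. The points at which \<open>Q n\<close> is small have to include the later cluster
  sequence, which depends on all \<open>Q\<close>. So for each finite set \<open>A\<close> of indices one point \<open>wit Q A\<close> of \<open>K\<close> is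
  fixed at which all \<open>Q n\<close> with \<open>n \<in> A\<close> are large, if there is one, and \<open>Q n\<close> is chosen small at \<open>wit Q A\<close> for
  all \<open>A\<close> below \<open>n\<close>. The points \<open>\<kappa> i\<close> of the finite intersections are then taken among these.\<close>

theorem (in RC_normed_space) norming_weakly_compact_total:
  assumes K: "K \<subseteq> carrier (dual V)" and M: "\<And>\<kappa>. \<kappa> \<in> K \<Longrightarrow> vnorm (dual V) \<kappa> \<le> M"
    and C: "C > 0" "\<And>x s. x \<in> carrier V \<Longrightarrow> (\<And>\<kappa>. \<kappa> \<in> K \<Longrightarrow> norm (\<kappa> x) \<le> s) \<Longrightarrow> vnorm V x \<le> C * s"
    and cluster: "\<And>y::nat \<Rightarrow> _. range y \<subseteq> K \<Longrightarrow>
      \<exists>\<kappa>\<in>carrier (dual V). \<forall>\<Phi>\<in>carrier (dual (dual V)). \<forall>m. \<Phi> \<kappa> \<in> closure ((\<lambda>n. \<Phi> (y n)) ` {m..})"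
    and \<Phi>: "\<Phi> \<in> carrier (dual (dual V))" "\<And>\<kappa>. \<kappa> \<in> K \<Longrightarrow> \<Phi> \<kappa> = 0"
    and \<psi>: "\<psi> \<in> carrier (dual V)"
  shows "\<Phi> \<psi> = 0"
proof (rule ccontr)
  assume nz: "\<Phi> \<psi> \<noteq> 0"
  interpret D: RC_normed_space "dual V" by (simp add: RC_normed_space_def normed_space_dual)
  interpret DD: normed_space "dual (dual V)" by (rule D.normed_space_dual)
  have KD: "\<kappa> \<in> carrier (dual V)" if "\<kappa> \<in> K" for \<kappa> using K that by auto
  define \<psi>' where "\<psi>' = inverse (\<Phi> \<psi>) \<odot>\<^bsub>dual V\<^esub> \<psi>"
  have \<psi>': "\<psi>' \<in> carrier (dual V)" "\<Phi> \<psi>' = 1"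
    using \<psi> nz D.dual_smult[OF \<Phi>(1) \<psi>] by (simp_all add: \<psi>'_def)
  define r where "r = vnorm (dual (dual V)) \<Phi> + 1"
  have r: "r > 0" "vnorm (dual (dual V)) \<Phi> \<le> r" using \<Phi>(1) by (simp_all add: r_def add_nonneg_pos)
  obtain \<Lambda> D where D: "D > 0" and \<Lambda>: "mean_on K \<Lambda>"
    and \<Lambda>_ge: "\<And>x. x \<in> carrier V \<Longrightarrow> \<psi>' x \<bullet> 1 \<le> D * \<Lambda> (\<lambda>\<kappa>. norm (\<kappa> x))"
    using dominating_mean[OF K M C \<psi>'(1)] by blast
  have \<Lambda>_add: "\<Lambda> (\<lambda>y. g y + h y) = \<Lambda> g + \<Lambda> h"
    if "g \<in> carrier (bounded_functions K)" "h \<in> carrier (bounded_functions K)" for g h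
    using \<Lambda> that by (simp add: mean_on_def)
  have \<Lambda>_smult: "\<Lambda> (\<lambda>y. t * g y) = t * \<Lambda> g" if "g \<in> carrier (bounded_functions K)" for t g
    using \<Lambda> that by (simp add: mean_on_def)
  have \<Lambda>_le: "\<Lambda> g \<le> c"
    if "g \<in> carrier (bounded_functions K)" "\<And>\<kappa>. \<kappa> \<in> K \<Longrightarrow> g \<kappa> \<le> c" for g c
    using \<Lambda> that by (simp add: mean_on_def)
  define \<epsilon> where "\<epsilon> = 1 / (2 * D)"
  have \<epsilon>: "\<epsilon> > 0" using D by (simp add: \<epsilon>_def)
  define wit where "wit Q A = (SOME \<kappa>. \<kappa> \<in> K \<and> (\<forall>n\<in>A. \<epsilon> / 2 \<le> norm (\<kappa> (Q n))))" for Q :: "nat \<Rightarrow> 'a" and A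
  have "\<exists>Q. \<forall>n. Q n \<in> carrier V \<and> vnorm V (Q n) \<le> r \<and> 1 / 2 \<le> \<psi>' (Q n) \<bullet> 1 \<and>
      (\<forall>A\<subseteq>{..<n}. wit Q A \<in> K \<longrightarrow> norm (wit Q A (Q n)) < 1 / (real n + 1))"
  proof (rule dependent_wellorder_choice)
    fix x and Q Q' :: "nat \<Rightarrow> 'a" and n :: nat assume "\<And>m. m < n \<Longrightarrow> Q m = Q' m"
    then have "wit Q A = wit Q' A" if "A \<subseteq> {..<n}" for A
    proof -
      have "(\<forall>n\<in>A. \<epsilon> / 2 \<le> norm (\<kappa> (Q n))) \<longleftrightarrow> (\<forall>n\<in>A. \<epsilon> / 2 \<le> norm (\<kappa> (Q' n)))" for \<kappa> :: "'a \<Rightarrow> 'k"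
        using that \<open>\<And>m. m < n \<Longrightarrow> Q m = Q' m\<close> by (intro ball_cong) auto
      then show ?thesis by (simp add: wit_def)
    qed
    then show "(x \<in> carrier V \<and> vnorm V x \<le> r \<and> 1 / 2 \<le> \<psi>' x \<bullet> 1 \<and>
        (\<forall>A\<subseteq>{..<n}. wit Q A \<in> K \<longrightarrow> norm (wit Q A x) < 1 / (real n + 1))) =
      (x \<in> carrier V \<and> vnorm V x \<le> r \<and> 1 / 2 \<le> \<psi>' x \<bullet> 1 \<and>
        (\<forall>A\<subseteq>{..<n}. wit Q' A \<in> K \<longrightarrow> norm (wit Q' A x) < 1 / (real n + 1)))" by simp
  next
    fix n and Q :: "nat \<Rightarrow> 'a"
    define T where "T = insert \<psi>' (wit Q ` Pow {..<n} \<inter> K)"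
    have "finite T" "T \<subseteq> carrier (dual V)" using K \<psi>'(1) by (auto simp: T_def)
    then obtain x where x: "x \<in> carrier V" "vnorm V x \<le> r"
      "\<And>\<tau>. \<tau> \<in> T \<Longrightarrow> norm (\<Phi> \<tau> - \<tau> x) < min (1 / 2) (1 / (real n + 1))"
      using Goldstine[OF \<Phi>(1) _ _ r, of T "min (1 / 2) (1 / (real n + 1))"] by auto
    have "1 / 2 \<le> \<psi>' x \<bullet> 1"
    proof -
      have "(1 - \<psi>' x) \<bullet> 1 \<le> norm (1 - \<psi>' x) * norm (1::'k)" by (rule norm_cauchy_schwarz)
      also have "\<dots> < 1 / 2" using x(3)[of \<psi>'] \<psi>'(2) by (simp add: T_def)
      finally show ?thesis by (simp add: inner_diff_left)
    qed
    moreover have "norm (wit Q A x) < 1 / (real n + 1)" if "A \<subseteq> {..<n}" "wit Q A \<in> K" for A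
      using x(3)[of "wit Q A"] \<Phi>(2)[OF that(2)] that by (simp add: T_def)
    ultimately show "\<exists>x. x \<in> carrier V \<and> vnorm V x \<le> r \<and> 1 / 2 \<le> \<psi>' x \<bullet> 1 \<and>
        (\<forall>A\<subseteq>{..<n}. wit Q A \<in> K \<longrightarrow> norm (wit Q A x) < 1 / (real n + 1))"
      using x by blast
  qed
  then obtain Q where Q: "\<And>n. Q n \<in> carrier V" "\<And>n. vnorm V (Q n) \<le> r" "\<And>n. 1 / 2 \<le> \<psi>' (Q n) \<bullet> 1"
    and Q_wit: "\<And>n A. A \<subseteq> {..<n} \<Longrightarrow> wit Q A \<in> K \<Longrightarrow> norm (wit Q A (Q n)) < 1 / (real n + 1)"
    by metis
  define b where "b = M * r + 1"
  have M0: "M \<ge> 0" if "\<kappa> \<in> K" for \<kappa> using M[OF that] D.vnorm_nonneg[OF KD[OF that]] by simp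
  have u_le: "norm (\<kappa> (Q n)) \<le> M * r" if "\<kappa> \<in> K" for \<kappa> n
    using dual_norm_le[OF KD[OF that] Q(1)[of n]] mult_mono[OF M[OF that] Q(2)[of n] M0[OF that] vnorm_nonneg[OF Q(1)]]
    by simp
  define E where "E n = {\<kappa> \<in> K. \<epsilon> / 2 \<le> norm (\<kappa> (Q n))}" for n
  define \<mu> where "\<mu> A = \<Lambda> (indicat_real A)" for A
  have ind: "indicat_real A \<in> carrier (bounded_functions K)" for A
    by (auto simp: in_bounded_functions indicator_def intro!: exI[of _ 1])
  have const: "(\<lambda>_. c) \<in> carrier (bounded_functions K)" for c
    by (auto simp: in_bounded_functions)
  \<comment> \<open>\<open>\<bar>Q n\<bar> \<le> \<epsilon> / 2 + (\<bar>b\<bar> + 1) * indicator\<close> on \<open>K\<close>, which bounds the mean of \<open>E n\<close> below\<close>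
  obtain s :: "nat \<Rightarrow> nat" where s: "strict_mono s" "\<And>i. (\<Inter>j\<le>i. E (s j)) \<noteq> {}"
  proof (rule finitely_additive_intersections[of K \<mu> E "\<epsilon> / (2 * \<bar>b\<bar> + 2)"])
    fix A B :: "('a \<Rightarrow> 'k) set" assume "A \<inter> B = {}"
    then have "indicat_real (A \<union> B) = (\<lambda>y. indicat_real A y + indicat_real B y)"
      by (auto simp: fun_eq_iff indicator_def)
    then show "\<mu> (A \<union> B) = \<mu> A + \<mu> B" using \<Lambda>_add[OF ind ind] by (simp add: \<mu>_def)
  next
    fix A :: "('a \<Rightarrow> 'k) set"
    have "\<Lambda> (\<lambda>y. (- 1) * indicat_real A y) \<le> 0"
      using real_module.smult_simps(4)[OF real_module_bounded_functions ind[of A], of "- 1"]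
      by (intro \<Lambda>_le) (auto simp: indicator_def)
    then show "0 \<le> \<mu> A" using \<Lambda>_smult[OF ind[of A], of "-1"] by (simp add: \<mu>_def)
  next
    fix n
    let ?u = "\<lambda>\<kappa>. norm (\<kappa> (Q n))"
    have u: "?u \<in> carrier (bounded_functions K)"
      using u_le by (auto simp: in_bounded_functions)
    have B: "real_module (bounded_functions K)" by (rule real_module_bounded_functions)
    have bE: "(\<lambda>\<kappa>. (- (\<bar>b\<bar> + 1)) * indicat_real (E n) \<kappa>) \<in> carrier (bounded_functions K)"
      using real_module.smult_simps(4)[OF B ind[of "E n"], of "- (\<bar>b\<bar> + 1)"] by simp
    have "\<Lambda> (\<lambda>\<kappa>. ?u \<kappa> + (- (\<bar>b\<bar> + 1)) * indicat_real (E n) \<kappa>) \<le> \<epsilon> / 2"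
    proof (rule \<Lambda>_le)
      show "(\<lambda>\<kappa>. ?u \<kappa> + (- (\<bar>b\<bar> + 1)) * indicat_real (E n) \<kappa>) \<in> carrier (bounded_functions K)"
        using abelian_monoid.a_closed[OF abelian_group.axioms(1)[OF module.axioms(2)[OF B[unfolded real_module_def]]] u bE]
        by simp
      fix \<kappa> assume \<kappa>: "\<kappa> \<in> K"
      show "?u \<kappa> + (- (\<bar>b\<bar> + 1)) * indicat_real (E n) \<kappa> \<le> \<epsilon> / 2"
        using u_le[OF \<kappa>, of n] \<kappa> \<epsilon> by (cases "\<kappa> \<in> E n") (auto simp: E_def b_def)
    qed
    moreover have "\<Lambda> (\<lambda>\<kappa>. ?u \<kappa> + (- (\<bar>b\<bar> + 1)) * indicat_real (E n) \<kappa>) = \<Lambda> ?u - (\<bar>b\<bar> + 1) * \<mu> (E n)"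
      using \<Lambda>_add[OF u bE] \<Lambda>_smult[OF ind[of "E n"], of "- (\<bar>b\<bar> + 1)"]
      unfolding \<mu>_def by linarith
    moreover have "\<epsilon> \<le> \<Lambda> ?u" using \<Lambda>_ge[OF Q(1)[of n]] Q(3)[of n] D by (simp add: \<epsilon>_def field_simps)
    ultimately show "\<epsilon> / (2 * \<bar>b\<bar> + 2) \<le> \<mu> (E n)" by (simp add: field_simps)
  qed (use \<epsilon> in \<open>auto simp: E_def\<close>)
  define \<kappa> where "\<kappa> i = wit Q (s ` {..i})" for i
  have \<kappa>: "\<kappa> i \<in> K" "j \<le> i \<Longrightarrow> \<epsilon> / 2 \<le> norm (\<kappa> i (Q (s j)))" for i j
  proof -
    have "\<exists>\<tau>. \<tau> \<in> K \<and> (\<forall>n\<in>s ` {..i}. \<epsilon> / 2 \<le> norm (\<tau> (Q n)))"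
      using s(2)[of i] by (auto simp: E_def)
    from someI_ex[OF this] show "\<kappa> i \<in> K" "j \<le> i \<Longrightarrow> \<epsilon> / 2 \<le> norm (\<kappa> i (Q (s j)))"
      by (auto simp: \<kappa>_def wit_def)
  qed
  have \<kappa>_small: "norm (\<kappa> i (Q (s j))) < 1 / (real (s j) + 1)" if "i < j" for i j
    unfolding \<kappa>_def
  proof (rule Q_wit)
    show "s ` {..i} \<subseteq> {..<s j}" using that strict_monoD[OF s(1)] by auto
    show "wit Q (s ` {..i}) \<in> K" using \<kappa>(1)[of i] by (simp add: \<kappa>_def)
  qed
  obtain \<kappa>' where \<kappa>': "\<kappa>' \<in> carrier (dual V)"
    "\<And>\<Psi> m. \<Psi> \<in> carrier (dual (dual V)) \<Longrightarrow> \<Psi> \<kappa>' \<in> closure ((\<lambda>n. \<Psi> (\<kappa> n)) ` {m..})"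
    using cluster[of \<kappa>] \<kappa>(1) by blast
  obtain \<Psi> where \<Psi>: "\<Psi> \<in> carrier (dual (dual V))"
    "\<And>\<tau> m. \<tau> \<in> carrier (dual V) \<Longrightarrow> \<Psi> \<tau> \<in> closure ((\<lambda>j. \<tau> (Q (s j))) ` {m..})"
    using bidual_cluster_point[of "\<lambda>j. Q (s j)" r] Q(1,2) r by blast
  have "\<Psi> (\<kappa> i) = 0" for i
  proof -
    have "norm (\<Psi> (\<kappa> i)) \<le> e" if e: "e > 0" for e
    proof -
      obtain m where m: "1 / (real m + 1) < e" using e reals_Archimedean[of e] by (auto simp: inverse_eq_divide add.commute)
      have "norm (\<kappa> i (Q (s j))) \<le> e" if "j \<ge> max m (Suc i)" for j
      proof -
        have "m \<le> s j" using that seq_suble[OF s(1), of j] by simp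
        then have "1 / (real (s j) + 1) \<le> 1 / (real m + 1)" by (intro divide_left_mono) auto
        then show ?thesis using \<kappa>_small[of i j] that m by simp
      qed
      then have "(\<lambda>j. \<kappa> i (Q (s j))) ` {max m (Suc i)..} \<subseteq> cball 0 e" by auto
      then have "closure ((\<lambda>j. \<kappa> i (Q (s j))) ` {max m (Suc i)..}) \<subseteq> cball 0 e"
        by (rule closure_minimal) simp
      then show ?thesis using \<Psi>(2)[OF KD[OF \<kappa>(1)], of i "max m (Suc i)"] by auto
    qed
    from this[of "norm (\<Psi> (\<kappa> i)) / 2"] show ?thesis by (cases "\<Psi> (\<kappa> i) = 0") auto
  qed
  then have "\<Psi> \<kappa>' = 0" using \<kappa>'(2)[OF \<Psi>(1), of 0] by (simp add: image_constant_conv)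
  moreover have "\<epsilon> / 2 \<le> norm (\<Psi> \<kappa>')"
  proof -
    have closed: "closed {c::'k. \<epsilon> / 2 \<le> norm c}" by (intro closed_Collect_le continuous_intros)
    have "\<epsilon> / 2 \<le> norm (\<kappa>' (Q (s j)))" for j
    proof -
      have "closure ((\<lambda>i. \<kappa> i (Q (s j))) ` {j..}) \<subseteq> {c. \<epsilon> / 2 \<le> norm c}"
        by (rule closure_minimal[OF _ closed]) (use \<kappa>(2) in auto)
      then show ?thesis
        using \<kappa>'(2)[OF eval_in_bidual[OF Q(1)[of "s j"]], of j] \<kappa>'(1) KD[OF \<kappa>(1)] by (auto simp: image_iff)
    qed
    then have "closure ((\<lambda>j. \<kappa>' (Q (s j))) ` {0..}) \<subseteq> {c. \<epsilon> / 2 \<le> norm c}"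
      by (intro closure_minimal[OF _ closed]) auto
    then show ?thesis using \<Psi>(2)[OF \<kappa>'(1), of 0] by auto
  qed
  ultimately show False using \<epsilon> by simp
qed

section \<open>Multilinear maps and homogeneous polynomials\<close>

lemma multilinear_mapD:
  assumes "multilinear_map k V W A" "u \<in> {..<k} \<rightarrow>\<^sub>E carrier V"
  shows "A u \<in> carrier W" "i < k \<Longrightarrow> linear_map V W (\<lambda>x. A (u(i := x)))"
  using assms by (auto simp: multilinear_map_def)

context normed_space
begin

lemma multilinear_scale:
  assumes A: "multilinear_map k V W A" and W: "normed_space W" and u: "u \<in> {..<k} \<rightarrow>\<^sub>E carrier V"
  shows "A (\<lambda>i\<in>{..<k}. c i \<odot>\<^bsub>V\<^esub> u i) = (\<Prod>i<k. c i) \<odot>\<^bsub>W\<^esub> A u"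
proof -
  interpret W: normed_space W by fact
  define T where "T n = (\<lambda>i\<in>{..<k}. if i < n then c i \<odot>\<^bsub>V\<^esub> u i else u i)" for n
  have uV: "u i \<in> carrier V" if "i < k" for i using u that by auto
  have T: "T n \<in> {..<k} \<rightarrow>\<^sub>E carrier V" for n using uV by (auto simp: T_def)
  have "A (T n) = (\<Prod>i<n. c i) \<odot>\<^bsub>W\<^esub> A u" if "n \<le> k" for n
    using that
  proof (induction n)
    case 0
    have "T 0 = u" using u by (auto simp: T_def fun_eq_iff PiE_iff extensional_def)
    then show ?case using multilinear_mapD(1)[OF A u] by simp
  next
    case (Suc n)
    have "T (Suc n) = (T n)(n := c n \<odot>\<^bsub>V\<^esub> u n)" "(T n)(n := u n) = T n"
      using Suc.prems by (auto simp: T_def fun_eq_iff)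
    then have "A (T (Suc n)) = c n \<odot>\<^bsub>W\<^esub> A (T n)"
      using linear_mapD(3)[OF multilinear_mapD(2)[OF A T[of n], of n], of "u n" "c n"] uV[of n] Suc.prems by simp
    then show ?case using Suc multilinear_mapD(1)[OF A u] by (simp add: W.smult_smult mult.commute)
  qed
  moreover have "T k = (\<lambda>i\<in>{..<k}. c i \<odot>\<^bsub>V\<^esub> u i)" by (auto simp: T_def fun_eq_iff)
  ultimately show ?thesis by (metis order_refl)
qed

lemma homogeneous_polynomial_smult:
  assumes P: "homogeneous_polynomial k V W P" and W: "normed_space W" and x: "x \<in> carrier V"
  shows "P (c \<odot>\<^bsub>V\<^esub> x) = (c ^ k) \<odot>\<^bsub>W\<^esub> P x"
proof -
  obtain A where A: "multilinear_map k V W A" "\<And>x. x \<in> carrier V \<Longrightarrow> P x = A (\<lambda>i\<in>{..<k}. x)"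
    using P by (auto simp: homogeneous_polynomial_def)
  have "(\<lambda>i\<in>{..<k}. c \<odot>\<^bsub>V\<^esub> x) = (\<lambda>i\<in>{..<k}. c \<odot>\<^bsub>V\<^esub> (\<lambda>i\<in>{..<k}. x) i)" by auto
  then show ?thesis
    using multilinear_scale[OF A(1) W, of "\<lambda>i\<in>{..<k}. x" "\<lambda>_. c"] x by (simp add: A(2))
qed

lemma homogeneous_polynomial_carrier:
  assumes P: "homogeneous_polynomial k V W P"
  shows "P \<in> carrier V \<rightarrow> carrier W"
proof
  fix x assume x: "x \<in> carrier V"
  obtain A where A: "multilinear_map k V W A" "\<And>x. x \<in> carrier V \<Longrightarrow> P x = A (\<lambda>i\<in>{..<k}. x)"
    using P by (auto simp: homogeneous_polynomial_def)
  show "P x \<in> carrier W" using multilinear_mapD(1)[OF A(1), of "\<lambda>i\<in>{..<k}. x"] A(2) x by simp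
qed

text \<open>Scaling by arbitrary \<open>\<rho> i > 0\<close> above the norms, in place of the norms, avoids dividing by zero.\<close>

lemma multilinear_norm_le:
  assumes A: "multilinear_map k V W A" and W: "normed_space W"
    and C: "\<And>u. u \<in> {..<k} \<rightarrow>\<^sub>E carrier V \<Longrightarrow> (\<And>i. i < k \<Longrightarrow> vnorm V (u i) \<le> 1) \<Longrightarrow> vnorm W (A u) \<le> C"
    and u: "u \<in> {..<k} \<rightarrow>\<^sub>E carrier V" and \<rho>: "\<And>i. i < k \<Longrightarrow> 0 < \<rho> i" "\<And>i. i < k \<Longrightarrow> vnorm V (u i) \<le> \<rho> i"
  shows "vnorm W (A u) \<le> C * (\<Prod>i<k. \<rho> i)"
proof -
  interpret W: normed_space W by fact
  have uV: "u i \<in> carrier V" if "i < k" for i using u that by auto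
  define v where "v = (\<lambda>i\<in>{..<k}. of_real (inverse (\<rho> i)) \<odot>\<^bsub>V\<^esub> u i)"
  have v: "v \<in> {..<k} \<rightarrow>\<^sub>E carrier V" using uV by (auto simp: v_def)
  have "(\<lambda>i\<in>{..<k}. of_real (\<rho> i) \<odot>\<^bsub>V\<^esub> v i) = u"
  proof
    fix i
    show "(\<lambda>i\<in>{..<k}. of_real (\<rho> i) \<odot>\<^bsub>V\<^esub> v i) i = u i"
    proof (cases "i < k")
      case True
      then show ?thesis using \<rho>(1)[OF True] uV[OF True] by (simp add: v_def smult_smult)
    next
      case False
      then show ?thesis using u by (simp add: PiE_iff extensional_def)
    qed
  qed
  then have "A u = (\<Prod>i<k. of_real (\<rho> i)) \<odot>\<^bsub>W\<^esub> A v"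
    using multilinear_scale[OF A W v, of "\<lambda>i. of_real (\<rho> i)"] by simp
  then have "vnorm W (A u) = (\<Prod>i<k. \<bar>\<rho> i\<bar>) * vnorm W (A v)"
    using multilinear_mapD(1)[OF A v] by (simp add: W.vnorm_smult prod_norm[symmetric])
  also have "(\<Prod>i<k. \<bar>\<rho> i\<bar>) = (\<Prod>i<k. \<rho> i)" by (intro prod.cong refl) (simp add: abs_of_pos \<rho>(1))
  also have "(\<Prod>i<k. \<rho> i) * vnorm W (A v) \<le> (\<Prod>i<k. \<rho> i) * C"
  proof (intro mult_left_mono C v)
    fix i assume i: "i < k"
    show "vnorm V (v i) \<le> 1"
      using \<rho>[OF i] uV[OF i] by (simp add: v_def i vnorm_smult norm_inverse) (simp add: field_simps)
  next
    show "0 \<le> (\<Prod>i<k. \<rho> i)" using \<rho>(1) by (intro prod_nonneg) (auto intro: less_imp_le)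
  qed
  finally show ?thesis by (simp add: mult.commute)
qed

text \<open>Replacing \<open>x\<close> by \<open>y\<close> one slot at a time, each step is the value at a tuple with \<open>y - x\<close> in one slot.\<close>

lemma multilinear_diagonal_continuous:
  assumes A: "multilinear_map k V W A" and W: "normed_space W"
    and C: "\<And>u. u \<in> {..<k} \<rightarrow>\<^sub>E carrier V \<Longrightarrow> (\<And>i. i < k \<Longrightarrow> vnorm V (u i) \<le> 1) \<Longrightarrow> vnorm W (A u) \<le> C"
  shows "continuous_map (norm_topology V) (norm_topology W) (\<lambda>x. A (\<lambda>i\<in>{..<k}. x))"
proof -
  interpret W: normed_space W by fact
  have PW: "(\<lambda>x. A (\<lambda>i\<in>{..<k}. x)) \<in> carrier V \<rightarrow> carrier W"
    using multilinear_mapD(1)[OF A] by auto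
  have C0: "C \<ge> 0"
    using C[of "\<lambda>i\<in>{..<k}. \<zero>\<^bsub>V\<^esub>"] W.vnorm_nonneg[OF multilinear_mapD(1)[OF A, of "\<lambda>i\<in>{..<k}. \<zero>\<^bsub>V\<^esub>"]]
    by simp
  show ?thesis unfolding continuous_map_norm_topology[OF W PW]
  proof (intro ballI allI impI)
    fix x and e :: real assume x: "x \<in> carrier V" and e: "e > 0"
    define R where "R = vnorm V x + 1"
    have R: "R \<ge> 1" using x by (simp add: R_def)
    define d where "d = min 1 (e / (real k * (C * R ^ k) + 1))"
    have K0: "real k * (C * R ^ k) \<ge> 0" using C0 R by simp
    have d: "d > 0" "d \<le> 1" "real k * (C * R ^ k) * d < e"
    proof -
      show "d > 0" "d \<le> 1" using e K0 by (auto simp: d_def)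
      have "real k * (C * R ^ k) * d \<le> real k * (C * R ^ k) * (e / (real k * (C * R ^ k) + 1))"
        using K0 by (intro mult_left_mono) (auto simp: d_def)
      also have "\<dots> < e" using e K0 by (simp add: field_simps add_nonneg_pos)
      finally show "real k * (C * R ^ k) * d < e" .
    qed
    show "\<exists>d>0. \<forall>y\<in>carrier V. vnorm V (y \<ominus>\<^bsub>V\<^esub> x) < d \<longrightarrow>
        vnorm W (A (\<lambda>i\<in>{..<k}. y) \<ominus>\<^bsub>W\<^esub> A (\<lambda>i\<in>{..<k}. x)) < e"
    proof (intro exI[of _ d] conjI ballI impI d)
      fix y assume y: "y \<in> carrier V" and yx: "vnorm V (y \<ominus>\<^bsub>V\<^esub> x) < d"
      have yR: "vnorm V y \<le> R" using vnorm_le_diff[OF y x] yx d(2) by (simp add: R_def)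
      define z where "z n = (\<lambda>i\<in>{..<k}. if i < n then y else x)" for n
      have z: "z n \<in> {..<k} \<rightarrow>\<^sub>E carrier V" for n using x y by (auto simp: z_def)
      have Az: "A (z n) \<in> carrier W" for n by (rule multilinear_mapD(1)[OF A z])
      have step: "vnorm W (A (z (Suc n)) \<ominus>\<^bsub>W\<^esub> A (z n)) \<le> C * R ^ k * d" if n: "n < k" for n
      proof -
        have "z (Suc n) = (z n)(n := y)" "z n = (z n)(n := x)" using n by (auto simp: z_def fun_eq_iff)
        then have "A (z (Suc n)) \<ominus>\<^bsub>W\<^esub> A (z n) = A ((z n)(n := y \<ominus>\<^bsub>V\<^esub> x))"
          using linear_map_diff[OF multilinear_mapD(2)[OF A z n] W y x] by metis
        also have "vnorm W \<dots> \<le> C * (\<Prod>i<k. if i = n then d else R)"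
        proof (rule multilinear_norm_le[OF A W C])
          show "(z n)(n := y \<ominus>\<^bsub>V\<^esub> x) \<in> {..<k} \<rightarrow>\<^sub>E carrier V"
            using x y n by (auto simp: z_def PiE_iff extensional_def)
          show "vnorm V (((z n)(n := y \<ominus>\<^bsub>V\<^esub> x)) i) \<le> (if i = n then d else R)" if "i < k" for i
            using that yx yR by (auto simp: z_def R_def)
        qed (use d R in auto)
        also have "(\<Prod>i<k. if i = n then d else R) = d * R ^ (k - 1)"
        proof -
          have "(\<Prod>i<k. if i = n then d else R) = d * (\<Prod>i\<in>{..<k} - {n}. if i = n then d else R)"
            using n by (subst prod.remove[of _ n]) auto
          also have "(\<Prod>i\<in>{..<k} - {n}. if i = n then d else R) = (\<Prod>i\<in>{..<k} - {n}. R)"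
            by (rule prod.cong) auto
          finally show ?thesis using n by simp
        qed
        also have "C * (d * R ^ (k - 1)) \<le> C * (d * R ^ k)"
          using C0 d R by (intro mult_left_mono power_increasing) auto
        finally show ?thesis by (simp add: mult_ac)
      qed
      have "vnorm W (A (z n) \<ominus>\<^bsub>W\<^esub> A (z 0)) \<le> real n * (C * R ^ k * d)" if "n \<le> k" for n
        using that
      proof (induction n)
        case 0
        show ?case using W.vnorm_diff_eq_zero[OF Az Az, of 0 0] by simp
      next
        case (Suc n)
        then show ?case
          using W.vnorm_diff_triangle[OF Az Az Az, of "Suc n" 0 n] step[of n] by (simp add: algebra_simps)
      qed
      from this[of k] have "vnorm W (A (z k) \<ominus>\<^bsub>W\<^esub> A (z 0)) < e" using d(3) by (simp add: mult_ac)
      moreover have "z k = (\<lambda>i\<in>{..<k}. y)" "z 0 = (\<lambda>i\<in>{..<k}. x)" by (auto simp: z_def fun_eq_iff)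
      ultimately show "vnorm W (A (\<lambda>i\<in>{..<k}. y) \<ominus>\<^bsub>W\<^esub> A (\<lambda>i\<in>{..<k}. x)) < e" by simp
    qed
  qed
qed

lemma diagonal_in_poly_space:
  assumes A: "multilinear_map k V W A" and W: "normed_space W"
    and C: "\<And>u. u \<in> {..<k} \<rightarrow>\<^sub>E carrier V \<Longrightarrow> (\<And>i. i < k \<Longrightarrow> vnorm V (u i) \<le> 1) \<Longrightarrow> vnorm W (A u) \<le> C"
  shows "(\<lambda>x\<in>carrier V. A (\<lambda>i\<in>{..<k}. x)) \<in> carrier (poly_space k V W)"
  using multilinear_diagonal_continuous[OF A W C] A
  by (auto simp: poly_space_def homogeneous_polynomial_def intro: continuous_map_eq)

lemma poly_space_simps:
  "\<zero>\<^bsub>poly_space k V scalar_space\<^esub> = (\<lambda>x\<in>carrier V. 0)"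
  "P \<oplus>\<^bsub>poly_space k V scalar_space\<^esub> Q = (\<lambda>x\<in>carrier V. P x + Q x)"
  "c \<odot>\<^bsub>poly_space k V scalar_space\<^esub> P = (\<lambda>x\<in>carrier V. c * P x)"
  "vnorm (poly_space k V scalar_space) P = (SUP x\<in>unit_ball V. norm (P x))"
  by (simp_all add: poly_space_def)

lemma poly_space_bounded:
  assumes P: "P \<in> carrier (poly_space k V W)" and W: "normed_space W" and k: "k \<ge> 1"
  obtains C where "C \<ge> 0" "\<And>x. x \<in> carrier V \<Longrightarrow> vnorm W (P x) \<le> C * vnorm V x ^ k"
proof -
  have P': "homogeneous_polynomial k V W P" "continuous_map (norm_topology V) (norm_topology W) P"
    using P by (auto simp: poly_space_def)
  show thesis
    by (rule homogeneous_continuous_imp_bounded[OF W homogeneous_polynomial_carrier[OF P'(1)] k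
          homogeneous_polynomial_smult[OF P'(1) W] P'(2)]) (use that in blast)+
qed

lemma poly_bounded_homogeneous:
  assumes P: "P \<in> carrier (poly_space k V scalar_space)" and k: "k \<ge> 1"
  shows "bounded_homogeneous k V P"
proof -
  obtain C where "C \<ge> 0" "\<And>x. x \<in> carrier V \<Longrightarrow> norm (P x) \<le> C * vnorm V x ^ k"
    using poly_space_bounded[OF P normed_space_scalar_space k] by auto
  moreover have "homogeneous_polynomial k V scalar_space P" using P by (simp add: poly_space_def)
  ultimately show ?thesis
    using homogeneous_polynomial_smult[OF _ normed_space_scalar_space] by (auto simp: bounded_homogeneous_def)
qed

lemma poly_norm_le:
  assumes "P \<in> carrier (poly_space k V scalar_space)" "k \<ge> 1" "x \<in> carrier V"
  shows "norm (P x) \<le> vnorm (poly_space k V scalar_space) P * vnorm V x ^ k"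
  using norm_le_sup_norm[OF poly_bounded_homogeneous] assms by (simp add: poly_space_simps)

lemma normed_space_poly_space:
  assumes k: "k \<ge> 1"
  shows "normed_space (poly_space k V scalar_space)"
proof -
  let ?S = "carrier (poly_space k V scalar_space)"
  have mem: "P \<in> ?S \<longleftrightarrow> P \<in> extensional (carrier V) \<and>
      (\<exists>A. multilinear_map k V scalar_space A \<and> (\<forall>x\<in>carrier V. P x = A (\<lambda>i\<in>{..<k}. x))) \<and>
      continuous_map (norm_topology V) euclidean P" for P :: "'a \<Rightarrow> 'k"
    by (simp add: poly_space_def homogeneous_polynomial_def)
  have cong: "continuous_map (norm_topology V) euclidean (\<lambda>x\<in>carrier V. P x)"
    if "continuous_map (norm_topology V) euclidean P" for P :: "'a \<Rightarrow> 'k"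
    using that by (rule continuous_map_eq) simp
  have carr: "poly_space k V scalar_space = map_space ?S V scalar_space" by (simp add: poly_space_def)
  show ?thesis
  proof (subst carr, rule normed_space_map_space[where k = k])
    have "multilinear_map k V scalar_space (\<lambda>_. 0)" by (simp add: multilinear_map_def linear_map_def)
    then show "(\<lambda>x\<in>carrier V. 0) \<in> ?S" by (auto simp: mem intro!: exI[of _ "\<lambda>_. 0"] cong)
  next
    fix P Q assume "P \<in> ?S" "Q \<in> ?S"
    then obtain A B where A: "multilinear_map k V scalar_space A" "\<forall>x\<in>carrier V. P x = A (\<lambda>i\<in>{..<k}. x)"
      and B: "multilinear_map k V scalar_space B" "\<forall>x\<in>carrier V. Q x = B (\<lambda>i\<in>{..<k}. x)"
      and c: "continuous_map (norm_topology V) euclidean P" "continuous_map (norm_topology V) euclidean Q"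
      by (auto simp: mem)
    have "multilinear_map k V scalar_space (\<lambda>u. A u + B u)"
      using A(1) B(1) by (simp add: multilinear_map_def linear_map_def algebra_simps)
    then show "(\<lambda>x\<in>carrier V. P x + Q x) \<in> ?S"
      using A(2) B(2) by (auto simp: mem intro!: exI[of _ "\<lambda>u. A u + B u"] cong continuous_map_add c)
  next
    fix c P assume "P \<in> ?S"
    then obtain A where A: "multilinear_map k V scalar_space A" "\<forall>x\<in>carrier V. P x = A (\<lambda>i\<in>{..<k}. x)"
      and P: "continuous_map (norm_topology V) euclidean P"
      by (auto simp: mem)
    have "multilinear_map k V scalar_space (\<lambda>u. c * A u)"
      using A(1) by (simp add: multilinear_map_def linear_map_def algebra_simps)
    moreover have "continuous_map (norm_topology V) euclidean (\<lambda>x. c * P x)"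
      using continuous_map_compose[OF P, of euclidean "(*) c"] by (simp add: comp_def continuous_on_mult_left)
    ultimately show "(\<lambda>x\<in>carrier V. c * P x) \<in> ?S"
      using A(2) by (auto simp: mem intro!: exI[of _ "\<lambda>u. c * A u"] cong)
  next
    show "?S \<subseteq> extensional (carrier V)" by (auto simp: mem)
  qed (rule poly_bounded_homogeneous[OF _ k])
qed

end

subsection \<open>Polarization\<close>

text \<open>Adding or removing a point of \<open>T\<close> outside \<open>R\<close> pairs the sets with opposite signs.\<close>

lemma alternating_sum_supersets:
  fixes T R :: "'i set"
  assumes T: "finite T" and R: "R \<subseteq> T"
  shows "(\<Sum>S | R \<subseteq> S \<and> S \<subseteq> T. (-1) ^ (card T - card S)) = (if R = T then 1 else 0 :: 'k::{idom, ring_char_0})"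
proof (cases "R = T")
  case True
  then have "{S. R \<subseteq> S \<and> S \<subseteq> T} = {T}" by auto
  then show ?thesis using True by simp
next
  case False
  then obtain t where t: "t \<in> T" "t \<notin> R" using R by auto
  let ?F = "{S. R \<subseteq> S \<and> S \<subseteq> T}"
  let ?i = "\<lambda>S. if t \<in> S then S - {t} else insert t S"
  let ?s = "\<lambda>S. (-1) ^ (card T - card S) :: 'k"
  have flip: "?s (?i S) = - ?s S" if "S \<in> ?F" for S
  proof -
    have S: "finite S" "S \<subseteq> T" using that T by (auto intro: finite_subset)
    have *: "?s (insert t S') = - ?s S'" if "S' \<subseteq> T" "t \<notin> S'" for S'
    proof -
      have "card (insert t S') \<le> card T" using that t T by (intro card_mono) auto
      moreover have "card (insert t S') = Suc (card S')" using that(2) finite_subset[OF that(1) T] by simp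
      ultimately have "card T - card S' = Suc (card T - card (insert t S'))" by simp
      then show ?thesis by simp
    qed
    have "S - {t} \<subseteq> T" using S by blast
    show ?thesis
    proof (cases "t \<in> S")
      case True
      have "?s (insert t (S - {t})) = - ?s (S - {t})" using *[OF \<open>S - {t} \<subseteq> T\<close>] by blast
      then have "?s S = - ?s (S - {t})" unfolding insert_Diff[OF True] .
      then show ?thesis using True by (simp only: if_True minus_minus)
    next
      case False
      then show ?thesis using *[OF S(2)] by simp
    qed
  qed
  have "sum ?s ?F = (\<Sum>S\<in>?F. - ?s S)"
    by (rule sum.reindex_bij_witness[of _ ?i ?i]) (use t flip in \<open>auto\<close>)
  then have "sum ?s ?F + sum ?s ?F = 0" by (simp add: sum_negf eq_neg_iff_add_eq_0)
  then have "2 * sum ?s ?F = 0" unfolding mult_2 .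
  then show ?thesis using False by simp
qed

text \<open>These are the permutations of \<open>{..<k}\<close>, in the extensional form in which index assignments occur when
  a multilinear map is expanded. The polar form divides by their number, which therefore has to be nonzero.\<close>

definition surjections :: "nat \<Rightarrow> (nat \<Rightarrow> nat) set" where
  "surjections k = {g \<in> {..<k} \<rightarrow>\<^sub>E {..<k}. g ` {..<k} = {..<k}}"

lemma finite_surjections: "finite (surjections k)"
  unfolding surjections_def by (rule finite_subset[OF _ finite_PiE[of "{..<k}" "\<lambda>_. {..<k}"]]) auto

lemma card_surjections_pos: "card (surjections k) > 0"
proof -
  have "(\<lambda>i\<in>{..<k}. i) \<in> surjections k" by (auto simp: surjections_def)
  then show ?thesis using finite_surjections card_gt_0_iff by blast
qed

context normed_space
begin

text \<open>Only the first \<open>n\<close> slots are expanded, and \<open>z\<close> fills the others; this is the form that an induction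
  on the number of slots can prove.\<close>

lemma multilinear_expand:
  assumes A: "multilinear_map k V scalar_space A" and I: "finite I" and v: "v \<in> I \<rightarrow> carrier V"
    and "n \<le> k" "z \<in> {..<k} \<rightarrow>\<^sub>E carrier V"
  shows "A (\<lambda>j\<in>{..<k}. if j < n then \<Oplus>\<^bsub>V\<^esub>i\<in>I. v i else z j) =
    (\<Sum>g\<in>{..<n} \<rightarrow>\<^sub>E I. A (\<lambda>j\<in>{..<k}. if j < n then v (g j) else z j))"
  using assms(4,5)
proof (induction n arbitrary: z)
  case 0
  then show ?case by simp
next
  case (Suc n)
  let ?s = "\<Oplus>\<^bsub>V\<^esub>i\<in>I. v i"
  have s: "?s \<in> carrier V" by (rule M.finsum_closed[OF v])
  let ?T = "\<lambda>j\<in>{..<k}. if j < n then ?s else z j"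
  let ?F = "\<lambda>h. A (\<lambda>j\<in>{..<k}. if j < Suc n then v (h j) else z j)"
  have zV: "z j \<in> carrier V" if "j < k" for j using Suc.prems(2) that by (simp add: PiE_iff)
  have T: "?T \<in> {..<k} \<rightarrow>\<^sub>E carrier V" using s zV by (simp add: restrict_PiE_iff)
  have "(\<lambda>j\<in>{..<k}. if j < Suc n then ?s else z j) = ?T(n := ?s)"
    using Suc.prems by (auto simp: fun_eq_iff)
  then have "A (\<lambda>j\<in>{..<k}. if j < Suc n then ?s else z j) = (\<Sum>i\<in>I. A (?T(n := v i)))"
    using linear_map_finsum[OF multilinear_mapD(2)[OF A T, of n] normed_space_scalar_space v I] Suc.prems I by simp
  also have "\<dots> = (\<Sum>i\<in>I. \<Sum>g\<in>{..<n} \<rightarrow>\<^sub>E I. ?F (g(n := i)))"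
  proof (rule sum.cong[OF refl])
    fix i assume i: "i \<in> I"
    have zi: "z(n := v i) \<in> {..<k} \<rightarrow>\<^sub>E carrier V"
      using Suc.prems v i by (auto simp: PiE_iff extensional_def)
    have "?T(n := v i) = (\<lambda>j\<in>{..<k}. if j < n then ?s else (z(n := v i)) j)"
      using Suc.prems by (auto simp: fun_eq_iff)
    then have "A (?T(n := v i)) = (\<Sum>g\<in>{..<n} \<rightarrow>\<^sub>E I. A (\<lambda>j\<in>{..<k}. if j < n then v (g j) else (z(n := v i)) j))"
      using Suc.IH[OF _ zi] Suc.prems(1) by (metis Suc_leD)
    also have "\<dots> = (\<Sum>g\<in>{..<n} \<rightarrow>\<^sub>E I. ?F (g(n := i)))"
      by (intro sum.cong refl arg_cong[of _ _ A]) (auto simp: fun_eq_iff less_Suc_eq)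
    finally show "A (?T(n := v i)) = (\<Sum>g\<in>{..<n} \<rightarrow>\<^sub>E I. ?F (g(n := i)))" .
  qed
  also have "\<dots> = (\<Sum>(i, g)\<in>I \<times> ({..<n} \<rightarrow>\<^sub>E I). ?F (g(n := i)))"
    by (rule sum.cartesian_product)
  also have "\<dots> = (\<Sum>h\<in>(\<lambda>(i, g). g(n := i)) ` (I \<times> ({..<n} \<rightarrow>\<^sub>E I)). ?F h)"
    using inj_combinator[of n "{..<n}" "\<lambda>_. I"] by (subst sum.reindex) (auto simp: case_prod_unfold)
  also have "(\<lambda>(i, g). g(n := i)) ` (I \<times> ({..<n} \<rightarrow>\<^sub>E I)) = {..<Suc n} \<rightarrow>\<^sub>E I"
    by (simp add: lessThan_Suc PiE_insert_eq)
  finally show ?case .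
qed

text \<open>Expand every diagonal value over the assignments \<open>g\<close> of slots to \<open>u 0, \<dots>, u (k - 1), w\<close>, where \<open>w\<close> gets
  the index \<open>k\<close>. The signs cancel unless \<open>g\<close> uses all the \<open>u i\<close>, and then no slot is left for \<open>w\<close>. The base
  point \<open>w\<close> is \<open>0\<close> for the polar form; a nonzero one serves to reach the points of a hyperplane.\<close>

theorem polarization:
  assumes A: "multilinear_map k V scalar_space A" and Q: "\<And>x. x \<in> carrier V \<Longrightarrow> Q x = A (\<lambda>i\<in>{..<k}. x)"
    and u: "\<And>i. i < k \<Longrightarrow> u i \<in> carrier V" and w: "w \<in> carrier V"
  shows "(\<Sum>S\<in>Pow {..<k}. (-1) ^ (k - card S) * Q (w \<oplus>\<^bsub>V\<^esub> (\<Oplus>\<^bsub>V\<^esub>i\<in>S. u i))) =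
    (\<Sum>g\<in>surjections k. A (\<lambda>j\<in>{..<k}. u (g j)))"
proof -
  define v where "v j = (if j = k then w else u j)" for j
  have v: "v \<in> I \<rightarrow> carrier V" if "I \<subseteq> {..k}" for I
    using that u w by (auto simp: v_def subset_iff le_less)
  define a where "a g = A (\<lambda>j\<in>{..<k}. v (g j))" for g
  let ?G = "{..<k} \<rightarrow>\<^sub>E {..k}"
  have G: "finite ?G" by (intro finite_PiE) auto
  have Q_S: "Q (w \<oplus>\<^bsub>V\<^esub> (\<Oplus>\<^bsub>V\<^esub>i\<in>S. u i)) = (\<Sum>g\<in>?G. if g ` {..<k} \<subseteq> insert k S then a g else 0)"
    if S: "S \<in> Pow {..<k}" for S
  proof -
    have fS: "finite S" "k \<notin> S" using S by (auto intro: finite_subset)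
    have vS: "v \<in> insert k S \<rightarrow> carrier V" using S by (intro v) auto
    have "(\<Oplus>\<^bsub>V\<^esub>i\<in>S. u i) = (\<Oplus>\<^bsub>V\<^esub>i\<in>S. v i)"
      using fS vS by (intro M.finsum_cong') (auto simp: v_def)
    then have eq: "w \<oplus>\<^bsub>V\<^esub> (\<Oplus>\<^bsub>V\<^esub>i\<in>S. u i) = (\<Oplus>\<^bsub>V\<^esub>i\<in>insert k S. v i)"
    proof -
      have "(\<Oplus>\<^bsub>V\<^esub>i\<in>insert k S. v i) = v k \<oplus>\<^bsub>V\<^esub> (\<Oplus>\<^bsub>V\<^esub>i\<in>S. v i)"
        using fS vS by (intro M.finsum_insert) auto
      moreover have "v k = w" by (simp add: v_def)
      ultimately show ?thesis using \<open>(\<Oplus>\<^bsub>V\<^esub>i\<in>S. u i) = (\<Oplus>\<^bsub>V\<^esub>i\<in>S. v i)\<close> by metis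
    qed
    have c: "(\<Oplus>\<^bsub>V\<^esub>i\<in>insert k S. v i) \<in> carrier V" by (rule M.finsum_closed[OF vS])
    have "Q (\<Oplus>\<^bsub>V\<^esub>i\<in>insert k S. v i) = (\<Sum>g\<in>{..<k} \<rightarrow>\<^sub>E insert k S. a g)"
    proof -
      have z: "(\<lambda>i\<in>{..<k}. w) \<in> {..<k} \<rightarrow>\<^sub>E carrier V" using w by auto
      have "(\<lambda>i\<in>{..<k}. \<Oplus>\<^bsub>V\<^esub>i\<in>insert k S. v i) =
          (\<lambda>j\<in>{..<k}. if j < k then \<Oplus>\<^bsub>V\<^esub>i\<in>insert k S. v i else (\<lambda>i\<in>{..<k}. w) j)" by auto
      moreover have "(\<lambda>j\<in>{..<k}. if j < k then v (g j) else (\<lambda>i\<in>{..<k}. w) j) = (\<lambda>j\<in>{..<k}. v (g j))" for g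
        by auto
      ultimately show ?thesis
        using multilinear_expand[OF A _ vS order_refl z] fS by (simp add: Q[OF c] a_def del: restrict_apply)
    qed
    also have "\<dots> = (\<Sum>g\<in>?G. if g ` {..<k} \<subseteq> insert k S then a g else 0)"
    proof -
      have "{..<k} \<rightarrow>\<^sub>E insert k S = {g \<in> ?G. g ` {..<k} \<subseteq> insert k S}"
      proof (intro equalityI subsetI)
        fix g assume g: "g \<in> {..<k} \<rightarrow>\<^sub>E insert k S"
        have "insert k S \<subseteq> {..k}" using S by auto
        then have "g \<in> ?G" using g PiE_mono[of "{..<k}" "\<lambda>_. insert k S" "\<lambda>_. {..k}"] by blast
        moreover have "g ` {..<k} \<subseteq> insert k S" using g by (auto dest: PiE_mem)
        ultimately show "g \<in> {g \<in> ?G. g ` {..<k} \<subseteq> insert k S}" by simp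
      next
        fix g assume "g \<in> {g \<in> ?G. g ` {..<k} \<subseteq> insert k S}"
        then have g: "g \<in> ?G" "g ` {..<k} \<subseteq> insert k S" by blast+
        show "g \<in> {..<k} \<rightarrow>\<^sub>E insert k S"
          by (rule PiE_I) (use g(2) in blast, rule PiE_arb[OF g(1)])
      qed
      then show ?thesis by (simp only: sum.inter_filter[OF G])
    qed
    finally show ?thesis by (simp only: eq)
  qed
  have "(\<Sum>S\<in>Pow {..<k}. (-1) ^ (k - card S) * Q (w \<oplus>\<^bsub>V\<^esub> (\<Oplus>\<^bsub>V\<^esub>i\<in>S. u i))) =
      (\<Sum>S\<in>Pow {..<k}. \<Sum>g\<in>?G. if g ` {..<k} \<subseteq> insert k S then (-1) ^ (k - card S) * a g else 0)"
    by (intro sum.cong refl) (simp add: Q_S sum_distrib_left if_distrib cong: if_cong)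
  also have "\<dots> = (\<Sum>g\<in>?G. \<Sum>S\<in>Pow {..<k}. if g ` {..<k} \<subseteq> insert k S then (-1) ^ (k - card S) * a g else 0)"
    by (rule sum.swap)
  also have "\<dots> = (\<Sum>g\<in>?G. if {..<k} \<subseteq> g ` {..<k} then a g else 0)"
  proof (rule sum.cong[OF refl])
    fix g assume g: "g \<in> ?G"
    have R: "g ` {..<k} - {k} \<subseteq> {..<k}" using g by (auto simp: PiE_iff le_less)
    have sets: "{S \<in> Pow {..<k}. g ` {..<k} \<subseteq> insert k S} = {S. g ` {..<k} - {k} \<subseteq> S \<and> S \<subseteq> {..<k}}"
      by auto
    have "(\<Sum>S\<in>Pow {..<k}. if g ` {..<k} \<subseteq> insert k S then (-1) ^ (k - card S) * a g else 0) =
        (\<Sum>S | g ` {..<k} - {k} \<subseteq> S \<and> S \<subseteq> {..<k}. (-1) ^ (card {..<k} - card S)) * a g"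
      unfolding sets[symmetric] sum_distrib_right card_lessThan
      by (rule sum.inter_filter[symmetric]) simp
    also have "\<dots> = (if g ` {..<k} - {k} = {..<k} then a g else 0)"
      by (subst alternating_sum_supersets[OF finite_lessThan R]) simp
    also have "g ` {..<k} - {k} = {..<k} \<longleftrightarrow> {..<k} \<subseteq> g ` {..<k}" using R by auto
    finally show "(\<Sum>S\<in>Pow {..<k}. if g ` {..<k} \<subseteq> insert k S then (-1) ^ (k - card S) * a g else 0) =
        (if {..<k} \<subseteq> g ` {..<k} then a g else 0)" .
  qed
  also have "\<dots> = (\<Sum>g\<in>{g \<in> ?G. {..<k} \<subseteq> g ` {..<k}}. a g)"
    using G by (simp add: sum.inter_filter)
  also have "{g \<in> ?G. {..<k} \<subseteq> g ` {..<k}} = surjections k"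
  proof -
    have "g \<in> {..<k} \<rightarrow>\<^sub>E {..<k} \<and> g ` {..<k} = {..<k}" if "g \<in> ?G" "{..<k} \<subseteq> g ` {..<k}" for g
    proof -
      have "card (g ` {..<k}) \<le> card {..<k}" by (intro card_image_le) auto
      then have "g ` {..<k} = {..<k}" using that(2) card_seteq[of "g ` {..<k}" "{..<k}"] by auto
      then show ?thesis using that(1) by (auto simp: PiE_iff)
    qed
    then show ?thesis by (auto simp: surjections_def PiE_iff intro: less_imp_le)
  qed
  also have "(\<Sum>g\<in>surjections k. a g) = (\<Sum>g\<in>surjections k. A (\<lambda>j\<in>{..<k}. u (g j)))"
    unfolding a_def by (intro sum.cong refl arg_cong[of _ _ A]) (auto simp: surjections_def v_def fun_eq_iff PiE_iff)
  finally show ?thesis .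
qed

end

text \<open>The symmetric multilinear form of \<open>Q\<close>, given by a formula that is linear in \<open>Q\<close>. The multilinear map
  that witnesses homogeneity is not unique and need not depend linearly on \<open>Q\<close>.\<close>

definition polar_form :: "nat \<Rightarrow> ('k::real_normed_field, 'a) normed_module \<Rightarrow> (nat \<Rightarrow> 'a) \<Rightarrow> ('a \<Rightarrow> 'k) \<Rightarrow> 'k" where
  "polar_form k V u Q =
    (\<Sum>S\<in>Pow {..<k}. (-1) ^ (k - card S) * Q (\<Oplus>\<^bsub>V\<^esub>i\<in>S. u i)) / of_nat (card (surjections k))"

definition point_evaluation :: "nat \<Rightarrow> ('k::real_normed_field, 'a) normed_module \<Rightarrow> 'a \<Rightarrow> ('a \<Rightarrow> 'k) \<Rightarrow> 'k" where
  "point_evaluation k V x = (\<lambda>Q\<in>carrier (poly_space k V scalar_space). Q x)"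

definition polar_evaluation :: "nat \<Rightarrow> ('k::real_normed_field, 'a) normed_module \<Rightarrow> (nat \<Rightarrow> 'a) \<Rightarrow> ('a \<Rightarrow> 'k) \<Rightarrow> 'k" where
  "polar_evaluation k V u = (\<lambda>Q\<in>carrier (poly_space k V scalar_space). polar_form k V u Q)"

context normed_space
begin

lemma vnorm_finsum_le:
  assumes "finite S" "\<And>i. i \<in> S \<Longrightarrow> u i \<in> carrier V" "\<And>i. i \<in> S \<Longrightarrow> vnorm V (u i) \<le> c"
  shows "vnorm V (\<Oplus>\<^bsub>V\<^esub>i\<in>S. u i) \<le> real (card S) * c"
  using assms
proof (induction S)
  case (insert i S)
  have uS: "u \<in> S \<rightarrow> carrier V" "u i \<in> carrier V" using insert.prems by auto
  have "vnorm V (\<Oplus>\<^bsub>V\<^esub>i\<in>insert i S. u i) \<le> vnorm V (u i) + vnorm V (\<Oplus>\<^bsub>V\<^esub>i\<in>S. u i)"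
    using vnorm_triangle[OF uS(2) M.finsum_closed[OF uS(1)]] uS insert.hyps by (simp add: M.finsum_insert)
  also have "\<dots> \<le> c + real (card S) * c" using insert by (intro add_mono) auto
  finally show ?case using insert.hyps by (simp add: algebra_simps)
qed simp

lemma polar_form_eq:
  assumes Q: "Q \<in> carrier (poly_space k V scalar_space)"
  obtains A where "multilinear_map k V scalar_space A" "\<And>x. x \<in> carrier V \<Longrightarrow> Q x = A (\<lambda>i\<in>{..<k}. x)"
    "\<And>u. u \<in> {..<k} \<rightarrow>\<^sub>E carrier V \<Longrightarrow>
      polar_form k V u Q = (\<Sum>g\<in>surjections k. A (\<lambda>j\<in>{..<k}. u (g j))) / of_nat (card (surjections k))"
proof -
  obtain A where A: "multilinear_map k V scalar_space A" "\<And>x. x \<in> carrier V \<Longrightarrow> Q x = A (\<lambda>i\<in>{..<k}. x)"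
    using Q by (auto simp: poly_space_def homogeneous_polynomial_def)
  show thesis
  proof (rule that[OF A])
    fix u assume u: "u \<in> {..<k} \<rightarrow>\<^sub>E carrier V"
    have uV: "u i \<in> carrier V" if "i < k" for i using u that by auto
    have "(\<Oplus>\<^bsub>V\<^esub>i\<in>S. u i) \<in> carrier V" if "S \<in> Pow {..<k}" for S
      using that uV by (intro M.finsum_closed) auto
    then have "polar_form k V u Q =
        (\<Sum>S\<in>Pow {..<k}. (-1) ^ (k - card S) * Q (\<zero>\<^bsub>V\<^esub> \<oplus>\<^bsub>V\<^esub> (\<Oplus>\<^bsub>V\<^esub>i\<in>S. u i))) / of_nat (card (surjections k))"
      unfolding polar_form_def by (intro arg_cong2[of _ _ _ _ "(/)"] sum.cong refl) (simp add: M.l_zero)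
    also have "(\<Sum>S\<in>Pow {..<k}. (-1) ^ (k - card S) * Q (\<zero>\<^bsub>V\<^esub> \<oplus>\<^bsub>V\<^esub> (\<Oplus>\<^bsub>V\<^esub>i\<in>S. u i))) =
        (\<Sum>g\<in>surjections k. A (\<lambda>j\<in>{..<k}. u (g j)))"
      by (rule polarization[OF A uV M.zero_closed])
    finally show "polar_form k V u Q = (\<Sum>g\<in>surjections k. A (\<lambda>j\<in>{..<k}. u (g j))) / of_nat (card (surjections k))" .
  qed
qed

lemma polar_form_diagonal:
  assumes Q: "Q \<in> carrier (poly_space k V scalar_space)" and x: "x \<in> carrier V"
  shows "polar_form k V (\<lambda>i\<in>{..<k}. x) Q = Q x"
proof -
  obtain A where A: "multilinear_map k V scalar_space A" "\<And>x. x \<in> carrier V \<Longrightarrow> Q x = A (\<lambda>i\<in>{..<k}. x)"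
    "\<And>u. u \<in> {..<k} \<rightarrow>\<^sub>E carrier V \<Longrightarrow>
      polar_form k V u Q = (\<Sum>g\<in>surjections k. A (\<lambda>j\<in>{..<k}. u (g j))) / of_nat (card (surjections k))"
    by (rule polar_form_eq[OF Q]) (rule that)
  have "(\<lambda>j\<in>{..<k}. (\<lambda>i\<in>{..<k}. x) (g j)) = (\<lambda>i\<in>{..<k}. x)" if "g \<in> surjections k" for g
    using that by (auto simp: surjections_def fun_eq_iff)
  then have "(\<Sum>g\<in>surjections k. A (\<lambda>j\<in>{..<k}. (\<lambda>i\<in>{..<k}. x) (g j))) = (\<Sum>g\<in>surjections k. Q x)"
    using A(2)[OF x] by (intro sum.cong) simp_all
  then show ?thesis using A(3)[of "\<lambda>i\<in>{..<k}. x"] x card_surjections_pos[of k] by simp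
qed

lemma polar_form_linear:
  assumes Q: "Q \<in> carrier (poly_space k V scalar_space)" and u: "u \<in> {..<k} \<rightarrow>\<^sub>E carrier V" and i: "i < k"
  shows "linear_map V scalar_space (\<lambda>x. polar_form k V (u(i := x)) Q)"
proof -
  obtain A where A: "multilinear_map k V scalar_space A" "\<And>x. x \<in> carrier V \<Longrightarrow> Q x = A (\<lambda>i\<in>{..<k}. x)"
    "\<And>u. u \<in> {..<k} \<rightarrow>\<^sub>E carrier V \<Longrightarrow>
      polar_form k V u Q = (\<Sum>g\<in>surjections k. A (\<lambda>j\<in>{..<k}. u (g j))) / of_nat (card (surjections k))"
    by (rule polar_form_eq[OF Q]) (rule that)
  have uV: "u j \<in> carrier V" if "j < k" for j using u that by auto
  have upd: "u(i := x) \<in> {..<k} \<rightarrow>\<^sub>E carrier V" if "x \<in> carrier V" for x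
    using u i that by (auto simp: PiE_iff extensional_def)
  have lin: "linear_map V scalar_space (\<lambda>x. A (\<lambda>j\<in>{..<k}. (u(i := x)) (g j)))" if g: "g \<in> surjections k" for g
  proof -
    have gk: "g ` {..<k} = {..<k}" using g by (simp add: surjections_def)
    have inj: "inj_on g {..<k}" by (rule eq_card_imp_inj_on) (simp_all add: gk)
    obtain j0 where j0: "j0 < k" "g j0 = i" using gk i by (metis imageE lessThan_iff)
    have eq: "(\<lambda>j\<in>{..<k}. (u(i := x)) (g j)) = (\<lambda>j\<in>{..<k}. u (g j))(j0 := x)" for x
    proof
      fix j
      show "(\<lambda>j\<in>{..<k}. (u(i := x)) (g j)) j = ((\<lambda>j\<in>{..<k}. u (g j))(j0 := x)) j"
      proof (cases "j < k")
        case True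
        then have "g j = i \<longleftrightarrow> j = j0" using j0 inj_on_eq_iff[OF inj, of j j0] by simp
        then show ?thesis using True by simp
      next
        case False
        then show ?thesis using j0 by simp
      qed
    qed
    have "(\<lambda>j\<in>{..<k}. u (g j)) \<in> {..<k} \<rightarrow>\<^sub>E carrier V" using uV gk by (auto simp: restrict_PiE_iff)
    from multilinear_mapD(2)[OF A(1) this j0(1)] show ?thesis by (simp only: eq)
  qed
  show ?thesis
    unfolding linear_map_def
  proof (intro conjI ballI allI)
    fix x y assume x: "x \<in> carrier V" and y: "y \<in> carrier V"
    have "A (\<lambda>j\<in>{..<k}. (u(i := x \<oplus>\<^bsub>V\<^esub> y)) (g j)) =
        A (\<lambda>j\<in>{..<k}. (u(i := x)) (g j)) + A (\<lambda>j\<in>{..<k}. (u(i := y)) (g j))" if "g \<in> surjections k" for g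
      using linear_mapD(2)[OF lin[OF that] x y] by simp
    then show "polar_form k V (u(i := x \<oplus>\<^bsub>V\<^esub> y)) Q =
        polar_form k V (u(i := x)) Q \<oplus>\<^bsub>scalar_space\<^esub> polar_form k V (u(i := y)) Q"
      using x y by (simp add: A(3)[OF upd] sum.distrib add_divide_distrib del: fun_upd_apply cong: sum.cong)
  next
    fix c x assume x: "x \<in> carrier V"
    have "A (\<lambda>j\<in>{..<k}. (u(i := c \<odot>\<^bsub>V\<^esub> x)) (g j)) = c * A (\<lambda>j\<in>{..<k}. (u(i := x)) (g j))"
      if "g \<in> surjections k" for g
      using linear_mapD(3)[OF lin[OF that] x, of c] by simp
    then show "polar_form k V (u(i := c \<odot>\<^bsub>V\<^esub> x)) Q = c \<odot>\<^bsub>scalar_space\<^esub> polar_form k V (u(i := x)) Q"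
      using x by (simp add: A(3)[OF upd] sum_distrib_left del: fun_upd_apply cong: sum.cong)
  qed simp
qed

lemma alternating_sum_norm_le:
  fixes a :: "nat set \<Rightarrow> 'k"
  assumes "\<And>S. S \<subseteq> {..<k} \<Longrightarrow> norm (a S) \<le> c"
  shows "norm ((\<Sum>S\<in>Pow {..<k}. (-1) ^ (k - card S) * a S) / of_nat (card (surjections k))) \<le>
    2 ^ k / real (card (surjections k)) * c"
proof -
  have "norm (\<Sum>S\<in>Pow {..<k}. (-1) ^ (k - card S) * a S) \<le> of_nat (card (Pow {..<k})) * c"
    using assms by (intro sum_norm_bound) (simp add: norm_mult norm_power)
  then show ?thesis using card_surjections_pos[of k]
    by (simp add: norm_divide card_Pow divide_right_mono)
qed

lemma point_evaluation_in_dual: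
  assumes k: "k \<ge> 1" and x: "x \<in> carrier V"
  shows "point_evaluation k V x \<in> carrier (dual (poly_space k V scalar_space))"
    and "vnorm (dual (poly_space k V scalar_space)) (point_evaluation k V x) \<le> vnorm V x ^ k"
proof -
  interpret X: normed_space "poly_space k V scalar_space" by (rule normed_space_poly_space[OF k])
  have le: "norm (Q x) \<le> vnorm V x ^ k * vnorm (poly_space k V scalar_space) Q"
    if "Q \<in> carrier (poly_space k V scalar_space)" for Q
    using poly_norm_le[OF that k x] by (simp add: mult.commute)
  show "point_evaluation k V x \<in> carrier (dual (poly_space k V scalar_space))"
    unfolding point_evaluation_def by (rule X.dualI[OF _ _ le]) (simp_all add: poly_space_simps x)
  show "vnorm (dual (poly_space k V scalar_space)) (point_evaluation k V x) \<le> vnorm V x ^ k"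
  proof (rule X.dual_norm_least)
    fix Q assume "Q \<in> unit_ball (poly_space k V scalar_space)"
    then have Q: "Q \<in> carrier (poly_space k V scalar_space)" "vnorm (poly_space k V scalar_space) Q \<le> 1"
      by (auto simp: unit_ball_def)
    have "norm (Q x) \<le> vnorm V x ^ k * 1"
      using le[OF Q(1)] mult_left_mono[OF Q(2), of "vnorm V x ^ k"] x by simp
    then show "norm (point_evaluation k V x Q) \<le> vnorm V x ^ k" using Q by (simp add: point_evaluation_def)
  qed
qed

text \<open>So the point evaluations are the diagonal of a bounded multilinear map into the dual of the space of
  polynomials.\<close>

lemma polar_evaluation:
  assumes k: "k \<ge> 1"
  shows "multilinear_map k V (dual (poly_space k V scalar_space)) (polar_evaluation k V)"
    and "x \<in> carrier V \<Longrightarrow> polar_evaluation k V (\<lambda>i\<in>{..<k}. x) = point_evaluation k V x"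
    and "\<exists>C\<ge>0. \<forall>u\<in>{..<k} \<rightarrow>\<^sub>E carrier V. (\<forall>i<k. vnorm V (u i) \<le> 1) \<longrightarrow>
      vnorm (dual (poly_space k V scalar_space)) (polar_evaluation k V u) \<le> C"
proof -
  let ?X = "poly_space k V scalar_space"
  interpret X: normed_space ?X by (rule normed_space_poly_space[OF k])
  interpret D: normed_space "dual ?X" by (rule X.normed_space_dual)
  let ?N = "real (card (surjections k))"
  have bound: "norm (polar_form k V u Q) \<le> 2 ^ k / ?N * (real k * c) ^ k * vnorm ?X Q"
    if Q: "Q \<in> carrier ?X" and u: "u \<in> {..<k} \<rightarrow>\<^sub>E carrier V" and c: "\<And>i. i < k \<Longrightarrow> vnorm V (u i) \<le> c" for Q u c
  proof -
    have uV: "u i \<in> carrier V" if "i < k" for i using u that by auto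
    have c0: "c \<ge> 0" using c[of 0] vnorm_nonneg[OF uV[of 0]] k by simp
    have "norm (Q (\<Oplus>\<^bsub>V\<^esub>i\<in>S. u i)) \<le> vnorm ?X Q * (real k * c) ^ k" if S: "S \<subseteq> {..<k}" for S
    proof -
      have fS: "finite S" using S finite_subset by blast
      have sV: "(\<Oplus>\<^bsub>V\<^esub>i\<in>S. u i) \<in> carrier V" using S uV by (intro M.finsum_closed) auto
      have "card S \<le> k" using card_mono[OF finite_lessThan S] by simp
      have "vnorm V (\<Oplus>\<^bsub>V\<^esub>i\<in>S. u i) \<le> real (card S) * c"
        using S uV c by (intro vnorm_finsum_le fS) auto
      also have "\<dots> \<le> real k * c" using \<open>card S \<le> k\<close> c0 by (intro mult_right_mono) auto
      finally have "vnorm V (\<Oplus>\<^bsub>V\<^esub>i\<in>S. u i) ^ k \<le> (real k * c) ^ k" using sV by (intro power_mono) auto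
      then show ?thesis
        using poly_norm_le[OF Q k sV] mult_left_mono[OF _ X.vnorm_nonneg[OF Q]] order_trans by blast
    qed
    from alternating_sum_norm_le[OF this] show ?thesis unfolding polar_form_def by (simp add: mult_ac)
  qed
  have pe: "polar_evaluation k V u \<in> carrier (dual ?X)" if u: "u \<in> {..<k} \<rightarrow>\<^sub>E carrier V" for u
    unfolding polar_evaluation_def
  proof (rule X.dualI)
    have uV: "u i \<in> carrier V" if "i < k" for i using u that by auto
    have sV: "(\<Oplus>\<^bsub>V\<^esub>i\<in>S. u i) \<in> carrier V" if "S \<in> Pow {..<k}" for S
      using that uV by (intro M.finsum_closed) auto
    fix P Q c assume P: "P \<in> carrier ?X" and Q: "Q \<in> carrier ?X"
    show "polar_form k V u (P \<oplus>\<^bsub>?X\<^esub> Q) = polar_form k V u P + polar_form k V u Q"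
      unfolding polar_form_def add_divide_distrib[symmetric] sum.distrib[symmetric]
      by (intro arg_cong2[of _ _ _ _ "(/)"] sum.cong refl) (simp add: sV poly_space_simps distrib_left)
    show "polar_form k V u (c \<odot>\<^bsub>?X\<^esub> P) = c * polar_form k V u P"
      unfolding polar_form_def times_divide_eq_right sum_distrib_left
      by (intro arg_cong2[of _ _ _ _ "(/)"] sum.cong refl) (simp add: sV poly_space_simps mult.left_commute)
    show "norm (polar_form k V u P) \<le> 2 ^ k / ?N * (real k * (\<Sum>i<k. vnorm V (u i))) ^ k * vnorm ?X P"
      using uV by (intro bound[OF P u] member_le_sum) auto
  qed
  show "multilinear_map k V (dual ?X) (polar_evaluation k V)"
    unfolding multilinear_map_def
  proof (intro conjI ballI allI impI)
    show "polar_evaluation k V \<in> ({..<k} \<rightarrow>\<^sub>E carrier V) \<rightarrow> carrier (dual ?X)" using pe by blast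
    fix u i assume u: "u \<in> {..<k} \<rightarrow>\<^sub>E carrier V" and i: "i < k"
    have upd: "u(i := x) \<in> {..<k} \<rightarrow>\<^sub>E carrier V" if "x \<in> carrier V" for x
      using u i that by (auto simp: PiE_iff extensional_def)
    have lin: "linear_map V scalar_space (\<lambda>x. polar_form k V (u(i := x)) Q)" if "Q \<in> carrier ?X" for Q
      by (rule polar_form_linear[OF that u i])
    show "linear_map V (dual ?X) (\<lambda>x. polar_evaluation k V (u(i := x)))"
      using pe[OF upd] linear_mapD(2)[OF lin] linear_mapD(3)[OF lin]
      by (auto simp: linear_map_def X.dual_simps polar_evaluation_def fun_eq_iff)
  qed
  show "polar_evaluation k V (\<lambda>i\<in>{..<k}. x) = point_evaluation k V x" if "x \<in> carrier V"
    using polar_form_diagonal[OF _ that] by (auto simp: polar_evaluation_def point_evaluation_def fun_eq_iff)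
  show "\<exists>C\<ge>0. \<forall>u\<in>{..<k} \<rightarrow>\<^sub>E carrier V. (\<forall>i<k. vnorm V (u i) \<le> 1) \<longrightarrow>
      vnorm (dual ?X) (polar_evaluation k V u) \<le> C"
  proof (intro exI[of _ "2 ^ k / ?N * (real k * 1) ^ k"] conjI ballI impI)
    fix u assume u: "u \<in> {..<k} \<rightarrow>\<^sub>E carrier V" "\<forall>i<k. vnorm V (u i) \<le> 1"
    show "vnorm (dual ?X) (polar_evaluation k V u) \<le> 2 ^ k / ?N * (real k * 1) ^ k"
    proof (rule X.dual_norm_least)
      fix Q assume "Q \<in> unit_ball ?X"
      then have Q: "Q \<in> carrier ?X" "vnorm ?X Q \<le> 1" by (auto simp: unit_ball_def)
      have "norm (polar_form k V u Q) \<le> 2 ^ k / ?N * (real k * 1) ^ k * vnorm ?X Q"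
        using u by (intro bound[OF Q(1)]) auto
      also have "\<dots> \<le> 2 ^ k / ?N * (real k * 1) ^ k * 1"
        using Q by (intro mult_left_mono) auto
      finally show "norm (polar_evaluation k V u Q) \<le> 2 ^ k / ?N * (real k * 1) ^ k"
        using Q by (simp add: polar_evaluation_def)
    qed
  qed simp
qed

text \<open>Polarization with base point \<open>w\<close> and all arguments equal to \<open>x\<close> expresses \<open>Q x\<close> by the values of \<open>Q\<close> at
  \<open>w + j x\<close>. If \<open>w\<close> is a large multiple of \<open>e\<close>, then \<open>f\<close> is bounded away from zero at these points, and
  homogeneity moves them to the hyperplane \<open>f x = 1\<close>.\<close>

lemma hyperplane_norming:
  assumes k: "k \<ge> 1" and f: "f \<in> carrier (dual V)" and e: "e \<in> carrier V" "f e = 1"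
  obtains r C where "C > 0"
    "\<And>Q s. Q \<in> carrier (poly_space k V scalar_space) \<Longrightarrow>
      (\<And>x. x \<in> carrier V \<Longrightarrow> vnorm V x \<le> r \<Longrightarrow> f x = 1 \<Longrightarrow> norm (Q x) \<le> s) \<Longrightarrow>
      vnorm (poly_space k V scalar_space) Q \<le> C * s"
proof -
  interpret D: normed_space "dual V" by (rule normed_space_dual)
  let ?N = "real (card (surjections k))"
  define F where "F = real k * vnorm (dual V) f"
  have F: "F \<ge> 0" using f by (simp add: F_def)
  define \<tau> where "\<tau> = F + 1"
  define L where "L = \<tau> + F"
  have L: "L > 0" using F by (simp add: L_def \<tau>_def)
  define r where "r = \<tau> * vnorm V e + real k"
  define w where "w = of_real \<tau> \<odot>\<^bsub>V\<^esub> e"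
  have w: "w \<in> carrier V" using e by (simp add: w_def)
  show thesis
  proof (rule that[of "2 ^ k / ?N * L ^ k" r])
    show "2 ^ k / ?N * L ^ k > 0" using L card_surjections_pos[of k] by simp
    fix Q s
    assume Q: "Q \<in> carrier (poly_space k V scalar_space)"
      and s: "\<And>x. x \<in> carrier V \<Longrightarrow> vnorm V x \<le> r \<Longrightarrow> f x = 1 \<Longrightarrow> norm (Q x) \<le> s"
    obtain A where A: "multilinear_map k V scalar_space A" "\<And>x. x \<in> carrier V \<Longrightarrow> Q x = A (\<lambda>i\<in>{..<k}. x)"
      by (rule polar_form_eq[OF Q]) (rule that)
    have "(SUP x\<in>unit_ball V. norm (Q x)) \<le> 2 ^ k / ?N * (L ^ k * s)"
    proof (rule sup_norm_least)
      fix x assume "x \<in> unit_ball V"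
      then have x: "x \<in> carrier V" "vnorm V x \<le> 1" by (auto simp: unit_ball_def)
      let ?v = "\<lambda>S. w \<oplus>\<^bsub>V\<^esub> (\<Oplus>\<^bsub>V\<^esub>i\<in>S. x)"
      have "(\<Sum>S\<in>Pow {..<k}. (-1) ^ (k - card S) * Q (?v S)) = (\<Sum>g\<in>surjections k. A (\<lambda>j\<in>{..<k}. x))"
        by (rule polarization[OF A x(1) w])
      also have "\<dots> = of_nat (card (surjections k)) * Q x"
        unfolding A(2)[OF x(1)] by (rule sum_constant)
      finally have Qx: "Q x = (\<Sum>S\<in>Pow {..<k}. (-1) ^ (k - card S) * Q (?v S)) / of_nat (card (surjections k))"
        using card_surjections_pos[of k] by simp
      have "norm (Q (?v S)) \<le> L ^ k * s" if S: "S \<subseteq> {..<k}" for S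
      proof -
        have fS: "finite S" using S finite_subset by blast
        have cS: "card S \<le> k" using card_mono[OF finite_lessThan S] by simp
        have sum: "(\<Oplus>\<^bsub>V\<^esub>i\<in>S. x) \<in> carrier V" using x by (intro M.finsum_closed) auto
        have v: "?v S \<in> carrier V" using w sum by simp
        have fv: "f (?v S) = of_real \<tau> + of_nat (card S) * f x"
          using dual_finsum[OF f fS, of "\<lambda>_. x"] x e f w sum
          by (simp add: dual_add[OF f w sum]) (simp add: w_def dual_smult)
        have "norm (of_nat (card S) * f x) \<le> F"
        proof -
          have "norm (f x) \<le> vnorm (dual V) f"
            using dual_norm_le[OF f x(1)] mult_left_mono[OF x(2) D.vnorm_nonneg[OF f]] by simp
          then show ?thesis unfolding F_def norm_mult using cS by (intro mult_mono) auto
        qed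
        then have n1: "1 \<le> norm (f (?v S))" "norm (f (?v S)) \<le> L"
          using norm_triangle_ineq[of "of_real \<tau>" "of_nat (card S) * f x"]
            norm_diff_ineq[of "of_real \<tau>" "of_nat (card S) * f x"] F
          unfolding fv L_def \<tau>_def by (simp_all del: of_real_add)
        then have nz: "f (?v S) \<noteq> 0" by auto
        define x' where "x' = inverse (f (?v S)) \<odot>\<^bsub>V\<^esub> ?v S"
        have x': "x' \<in> carrier V" "f x' = 1" using v nz dual_smult[OF f v] by (simp_all add: x'_def)
        have "vnorm V (?v S) \<le> vnorm V w + vnorm V (\<Oplus>\<^bsub>V\<^esub>i\<in>S. x)" by (rule vnorm_triangle[OF w sum])
        also have "\<dots> \<le> \<tau> * vnorm V e + real k"
        proof (rule add_mono)
          show "vnorm V w \<le> \<tau> * vnorm V e" using e F by (simp add: w_def vnorm_smult \<tau>_def)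
          show "vnorm V (\<Oplus>\<^bsub>V\<^esub>i\<in>S. x) \<le> real k"
            using vnorm_finsum_le[OF fS, of "\<lambda>_. x" 1] x cS by simp
        qed
        finally have vr: "vnorm V (?v S) \<le> r" by (simp add: r_def)
        have "inverse (norm (f (?v S))) \<le> 1" using n1(1) by (simp add: inverse_le_1_iff)
        then have "vnorm V x' \<le> 1 * vnorm V (?v S)"
          unfolding x'_def vnorm_smult[OF v] norm_inverse using v by (intro mult_right_mono) auto
        then have Qx': "norm (Q x') \<le> s" using s[OF x'(1) _ x'(2)] vr by simp
        have "?v S = f (?v S) \<odot>\<^bsub>V\<^esub> x'" using v nz by (simp add: x'_def smult_smult)
        then have "Q (?v S) = f (?v S) ^ k * Q x'"
          using poly_bounded_homogeneous[OF Q k] x'(1) unfolding bounded_homogeneous_def by metis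
        then have "norm (Q (?v S)) = norm (f (?v S)) ^ k * norm (Q x')" by (simp add: norm_mult norm_power)
        also have "\<dots> \<le> L ^ k * s" using n1 Qx' L by (intro mult_mono power_mono) auto
        finally show ?thesis .
      qed
      from alternating_sum_norm_le[OF this] show "norm (Q x) \<le> 2 ^ k / ?N * (L ^ k * s)" unfolding Qx .
    qed
    then show "vnorm (poly_space k V scalar_space) Q \<le> 2 ^ k / ?N * L ^ k * s"
      by (simp add: poly_space_simps mult.assoc)
  qed
qed

end

section \<open>The polynomial property (V) implies reflexivity\<close>

text \<open>The dual of the space of polynomials enters the property (V) only as a copy whose points have the
  type over which \<open>F\<close> ranges.\<close>

definition isometric_copy :: "('a \<Rightarrow> 'b) \<Rightarrow> ('k, 'a) normed_module \<Rightarrow> ('k, 'b) normed_module" where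
  "isometric_copy h V = \<lparr>carrier = h ` carrier V, mult = undefined, one = undefined, zero = h \<zero>\<^bsub>V\<^esub>,
     add = (\<lambda>x y. h (the_inv h x \<oplus>\<^bsub>V\<^esub> the_inv h y)), smult = (\<lambda>c x. h (c \<odot>\<^bsub>V\<^esub> the_inv h x)),
     vnorm = (\<lambda>x. vnorm V (the_inv h x))\<rparr>"

context normed_space
begin

context
  fixes h :: "'a \<Rightarrow> 'b"
  assumes h: "inj h"
begin

lemma isometric_copy_simps [simp]:
  "carrier (isometric_copy h V) = h ` carrier V"
  "zero (isometric_copy h V) = h \<zero>\<^bsub>V\<^esub>"
  "add (isometric_copy h V) (h x) (h y) = h (x \<oplus>\<^bsub>V\<^esub> y)"
  "smult (isometric_copy h V) c (h x) = h (c \<odot>\<^bsub>V\<^esub> x)"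
  "vnorm (isometric_copy h V) (h x) = vnorm V x"
  by (simp_all add: isometric_copy_def the_inv_f_f[OF h])

lemma normed_space_isometric_copy: "normed_space (isometric_copy h V)"
proof -
  have "abelian_group (isometric_copy h V)"
  proof (rule abelian_groupI)
    fix x assume "x \<in> carrier (isometric_copy h V)"
    then obtain a where a: "a \<in> carrier V" "x = h a" by auto
    then show "\<exists>y\<in>carrier (isometric_copy h V). y \<oplus>\<^bsub>isometric_copy h V\<^esub> x = \<zero>\<^bsub>isometric_copy h V\<^esub>"
      by (intro bexI[of _ "h (\<ominus>\<^bsub>V\<^esub> a)"]) (auto simp: M.l_neg)
  qed (auto simp: M.a_ac)
  then have "module scalar_field (isometric_copy h V)"
    by (intro moduleI[OF cring_scalar_field]) (auto simp: add_smult smult_add smult_smult)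
  then show ?thesis
    by (auto simp: normed_space_def normed_space_axioms_def vnorm_eq_zero inj_eq[OF h] vnorm_triangle vnorm_smult)
qed

lemma linear_map_isometric_copy: "linear_map V (isometric_copy h V) h"
  by (simp add: linear_map_def)

lemma dual_isometric_copy:
  assumes f: "f \<in> carrier (dual V)"
  shows "(\<lambda>y\<in>carrier (isometric_copy h V). f (the_inv h y)) \<in> carrier (dual (isometric_copy h V))"
proof -
  interpret I: normed_space "isometric_copy h V" by (rule normed_space_isometric_copy)
  show ?thesis
  proof (rule I.dualI[where C = "vnorm (dual V) f"])
    fix x y assume "x \<in> carrier (isometric_copy h V)" "y \<in> carrier (isometric_copy h V)"
    then show "f (the_inv h (x \<oplus>\<^bsub>isometric_copy h V\<^esub> y)) = f (the_inv h x) + f (the_inv h y)"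
      by (auto simp: the_inv_f_f[OF h] dual_add[OF f])
  next
    fix c x assume x: "x \<in> carrier (isometric_copy h V)"
    then show "f (the_inv h (c \<odot>\<^bsub>isometric_copy h V\<^esub> x)) = c * f (the_inv h x)"
      by (auto simp: the_inv_f_f[OF h] dual_smult[OF f])
    show "norm (f (the_inv h x)) \<le> vnorm (dual V) f * vnorm (isometric_copy h V) x"
      using x by (auto simp: the_inv_f_f[OF h] dual_norm_le[OF f])
  qed
qed

end

end

lemma (in banach_space) banach_space_isometric_copy:
  assumes h: "inj h"
  shows "banach_space (isometric_copy h V)"
proof -
  interpret I: normed_space "isometric_copy h V" by (rule normed_space_isometric_copy[OF h])
  have diff: "h x \<ominus>\<^bsub>isometric_copy h V\<^esub> h y = h (x \<ominus>\<^bsub>V\<^esub> y)" if "x \<in> carrier V" "y \<in> carrier V" for x y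
    using linear_map_diff[OF linear_map_isometric_copy[OF h] I.normed_space_axioms that] by simp
  have "\<exists>l. limitin (norm_topology (isometric_copy h V)) s l sequentially"
    if s: "Metric_space.MCauchy (carrier (isometric_copy h V)) (vdist (isometric_copy h V)) s" for s
  proof -
    have ran: "range s \<subseteq> carrier (isometric_copy h V)"
      using s by (simp add: Metric_space.MCauchy_def[OF I.Metric_space_vdist])
    then have "\<exists>a. a \<in> carrier V \<and> s n = h a" for n using h by (auto simp: image_subset_iff image_iff)
    then obtain a where a: "\<And>n. a n \<in> carrier V" "\<And>n. s n = h (a n)" by metis
    have sh: "s = (\<lambda>n. h (a n))" using a(2) by auto
    obtain l where l: "l \<in> carrier V" "(\<lambda>n. vnorm V (a n \<ominus>\<^bsub>V\<^esub> l)) \<longlonglongrightarrow> 0"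
    proof (rule MCauchy_imp_limit[of a])
      show "\<exists>N. \<forall>m\<ge>N. \<forall>n\<ge>N. vnorm V (a m \<ominus>\<^bsub>V\<^esub> a n) < e" if "e > 0" for e
        using s that unfolding I.MCauchy_vdist[OF ran] by (simp add: sh diff a(1) isometric_copy_simps[OF h])
    qed (use a in auto)
    have "limitin (norm_topology (isometric_copy h V)) s (h l) sequentially"
      unfolding I.limitin_norm_topology[OF ran] using l
      by (simp add: sh diff a(1) isometric_copy_simps[OF h])
    then show ?thesis by blast
  qed
  then show ?thesis
    unfolding banach_space_def banach_space_axioms_def Metric_space.mcomplete_def[OF I.Metric_space_vdist]
    using I.normed_space_axioms by (auto simp: norm_topology_def)
qed

context RC_normed_space
begin

lemma weakly_unconditionally_Cauchy_bounded:
  assumes x: "weakly_unconditionally_Cauchy V x"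
  obtains c where "c \<ge> 0" "\<And>i. vnorm V (x i) \<le> c"
proof -
  have "\<exists>c. \<forall>i. norm (f (x i)) \<le> c" if "f \<in> carrier (dual V)" for f
  proof -
    have "summable (\<lambda>i. norm (f (x i)))" using x that by (simp add: weakly_unconditionally_Cauchy_def)
    then have "Bseq (\<lambda>i. norm (f (x i)))" by (intro convergent_imp_Bseq convergentI[OF summable_LIMSEQ_zero])
    then show ?thesis by (auto simp: Bseq_def)
  qed
  then obtain c where c: "\<And>i. vnorm V (x i) \<le> c"
    using pointwise_bounded_imp_bounded[of x] x unfolding weakly_unconditionally_Cauchy_def by blast
  moreover have "c \<ge> 0" using c[of 0] vnorm_nonneg[of "x 0"] x
    unfolding weakly_unconditionally_Cauchy_def by (meson order_trans range_subsetD)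
  ultimately show thesis by (rule that[rotated])
qed

text \<open>The polynomial \<open>x \<mapsto> f x \<cdot> \<delta>\<^sub>x\<close> takes weakly unconditionally Cauchy series to absolutely convergent
  ones: \<open>f (x i)\<close> is absolutely summable, and the evaluations are bounded because the \<open>x i\<close> are. Property
  (V) makes it weakly compact, and at each \<open>y n\<close> its value is the point evaluation itself.\<close>

lemma point_evaluations_cluster:
  fixes h :: "(('a \<Rightarrow> 'k) \<Rightarrow> 'k) \<Rightarrow> 'b" and y :: "nat \<Rightarrow> 'a"
  assumes pv: "\<And>W :: ('k, 'b) normed_module. banach_space W \<Longrightarrow> poly_uc (Suc k) V W \<subseteq> poly_wco (Suc k) V W"
    and h: "inj h" and k: "k \<ge> 1" and f: "f \<in> carrier (dual V)"
    and y: "\<And>n. y n \<in> carrier V" "\<And>n. vnorm V (y n) \<le> r" "\<And>n. f (y n) = 1"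
  obtains \<kappa> where "\<kappa> \<in> carrier (dual (poly_space k V scalar_space))"
    "\<And>\<Phi> m. \<Phi> \<in> carrier (dual (dual (poly_space k V scalar_space))) \<Longrightarrow>
      \<Phi> \<kappa> \<in> closure ((\<lambda>n. \<Phi> (point_evaluation k V (y n))) ` {m..})"
proof -
  let ?X = "poly_space k V scalar_space"
  let ?Y = "dual ?X"
  define W where "W = isometric_copy h ?Y"
  interpret X: normed_space ?X by (rule normed_space_poly_space[OF k])
  interpret Y: banach_space ?Y by (rule X.banach_space_dual[OF complete_UNIV])
  interpret W: banach_space W unfolding W_def by (rule Y.banach_space_isometric_copy[OF h])
  interpret D: normed_space "dual V" by (rule normed_space_dual)
  note W_simps = Y.isometric_copy_simps[OF h, folded W_def]
  define T where "T u = f (u k) \<odot>\<^bsub>?Y\<^esub> polar_evaluation k V (\<lambda>i\<in>{..<k}. u i)" for u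
  have restr: "(\<lambda>i\<in>{..<k}. u i) \<in> {..<k} \<rightarrow>\<^sub>E carrier V" if "u \<in> {..<Suc k} \<rightarrow>\<^sub>E carrier V" for u
    using that by (simp add: restrict_PiE_iff PiE_iff)
  note pe = polar_evaluation(1)[OF k]
  have pe_in: "polar_evaluation k V (\<lambda>i\<in>{..<k}. u i) \<in> carrier ?Y" if "u \<in> {..<Suc k} \<rightarrow>\<^sub>E carrier V" for u
    by (rule multilinear_mapD(1)[OF pe restr[OF that]])
  have TY: "T u \<in> carrier ?Y" if "u \<in> {..<Suc k} \<rightarrow>\<^sub>E carrier V" for u
    using pe_in[OF that] by (simp add: T_def)
  have A: "multilinear_map (Suc k) V W (\<lambda>u. h (T u))"
    unfolding multilinear_map_def
  proof (intro conjI ballI allI impI)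
    show "(\<lambda>u. h (T u)) \<in> ({..<Suc k} \<rightarrow>\<^sub>E carrier V) \<rightarrow> carrier W" using TY by (simp add: W_simps)
    fix u i assume u: "u \<in> {..<Suc k} \<rightarrow>\<^sub>E carrier V" and i: "i < Suc k"
    have uk: "u k \<in> carrier V" using u by (simp add: PiE_iff)
    have upd: "u(i := x) \<in> {..<Suc k} \<rightarrow>\<^sub>E carrier V" if "x \<in> carrier V" for x
      using u i that by (auto simp: PiE_iff extensional_def)
    show "linear_map V W (\<lambda>x. h (T (u(i := x))))"
    proof (cases "i = k")
      case True
      have "T (u(i := x)) = f x \<odot>\<^bsub>?Y\<^esub> polar_evaluation k V (\<lambda>i\<in>{..<k}. u i)" for x
      proof -
        have "(\<lambda>j\<in>{..<k}. (u(i := x)) j) = (\<lambda>i\<in>{..<k}. u i)" using True by (auto simp: fun_eq_iff)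
        then show ?thesis using True by (simp add: T_def del: fun_upd_apply) simp
      qed
      then show ?thesis using pe_in[OF u]
        by (simp add: linear_map_def W_simps dual_add[OF f] dual_smult[OF f] Y.add_smult Y.smult_smult)
    next
      case False
      then have ik: "i < k" using i by simp
      have eq: "T (u(i := x)) = f (u k) \<odot>\<^bsub>?Y\<^esub> polar_evaluation k V ((\<lambda>i\<in>{..<k}. u i)(i := x))" for x
      proof -
        have "(\<lambda>j\<in>{..<k}. (u(i := x)) j) = (\<lambda>i\<in>{..<k}. u i)(i := x)" using ik by (auto simp: fun_eq_iff)
        then show ?thesis using False by (simp only: T_def) simp
      qed
      note lin = multilinear_mapD(2)[OF pe restr[OF u] ik]
      show ?thesis
        unfolding linear_map_def eq
        using linear_mapD[OF lin]
        by (auto simp: W_simps Y.smult_add Y.smult_smult mult.commute)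
    qed
  qed
  obtain C where C: "C \<ge> 0" "\<And>u. u \<in> {..<k} \<rightarrow>\<^sub>E carrier V \<Longrightarrow> (\<And>i. i < k \<Longrightarrow> vnorm V (u i) \<le> 1) \<Longrightarrow>
      vnorm ?Y (polar_evaluation k V u) \<le> C"
    using polar_evaluation(3)[OF k] by auto
  have bound: "vnorm W (h (T u)) \<le> vnorm (dual V) f * C"
    if u: "u \<in> {..<Suc k} \<rightarrow>\<^sub>E carrier V" "\<And>i. i < Suc k \<Longrightarrow> vnorm V (u i) \<le> 1" for u
  proof -
    have uk: "u k \<in> carrier V" using u(1) by (simp add: PiE_iff)
    have "norm (f (u k)) \<le> vnorm (dual V) f"
      using dual_norm_le[OF f uk] mult_left_mono[OF u(2)[of k] D.vnorm_nonneg[OF f]] by simp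
    moreover have "vnorm ?Y (polar_evaluation k V (\<lambda>i\<in>{..<k}. u i)) \<le> C"
      by (rule C(2)[OF restr[OF u(1)]]) (use u(2) in simp)
    ultimately show ?thesis
      using pe_in[OF u(1)] by (simp add: W_simps T_def Y.vnorm_smult mult_mono f)
  qed
  define P where "P = (\<lambda>x\<in>carrier V. h (T (\<lambda>i\<in>{..<Suc k}. x)))"
  have P: "P \<in> carrier (poly_space (Suc k) V W)"
    unfolding P_def by (rule diagonal_in_poly_space[OF A W.normed_space_axioms bound])
  have P_eq: "P x = h (f x \<odot>\<^bsub>?Y\<^esub> point_evaluation k V x)" if x: "x \<in> carrier V" for x
  proof -
    have "(\<lambda>i\<in>{..<k}. (\<lambda>i\<in>{..<Suc k}. x) i) = (\<lambda>i\<in>{..<k}. x)" by (auto simp: fun_eq_iff)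
    then have "T (\<lambda>i\<in>{..<Suc k}. x) = f x \<odot>\<^bsub>?Y\<^esub> polar_evaluation k V (\<lambda>i\<in>{..<k}. x)"
      unfolding T_def by (simp only: restrict_apply' lessThan_iff lessI)
    then show ?thesis unfolding polar_evaluation(2)[OF k x] using x by (simp add: P_def)
  qed
  note \<delta> = point_evaluation_in_dual[OF k]
  have "P \<in> poly_uc (Suc k) V W"
    unfolding poly_uc_def
  proof (intro CollectI conjI P allI impI)
    fix x assume x: "weakly_unconditionally_Cauchy V x"
    obtain c where c: "c \<ge> 0" "\<And>i. vnorm V (x i) \<le> c"
      by (rule weakly_unconditionally_Cauchy_bounded[OF x]) (rule that)
    have xV: "x i \<in> carrier V" for i using x by (auto simp: weakly_unconditionally_Cauchy_def)
    have sum: "summable (\<lambda>i. norm (f (x i)) * c ^ k)"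
      using x f by (intro summable_mult2) (simp add: weakly_unconditionally_Cauchy_def)
    have norm_P: "vnorm W (P (x i)) \<le> norm (f (x i)) * c ^ k" for i
    proof -
      have "vnorm ?Y (point_evaluation k V (x i)) \<le> c ^ k"
        using \<delta>(2)[OF xV[of i]] power_mono[OF c(2)[of i] vnorm_nonneg[OF xV]] by (rule order_trans)
      then show ?thesis using \<delta>(1)[OF xV[of i]]
        by (simp add: P_eq[OF xV] W_simps Y.vnorm_smult mult_left_mono)
    qed
    have PW: "P (x i) \<in> carrier W" for i using \<delta>(1)[OF xV] by (simp add: P_eq[OF xV] W_simps)
    show "unconditionally_converging W (\<lambda>i. P (x i))"
    proof (rule W.absolutely_summable_imp_unconditionally_converging)
      show "summable (\<lambda>i. vnorm W (P (x i)))"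
        by (rule summable_comparison_test'[OF sum, of 0]) (simp add: norm_P W.vnorm_nonneg[OF PW])
    qed (use PW in auto)
  qed
  then have "P \<in> poly_wco (Suc k) V W" using pv[OF W.banach_space_axioms] by blast
  define B where "B = {x \<in> carrier V. vnorm V x \<le> r}"
  have "Metric_space.mbounded (carrier V) (vdist V) B"
    unfolding Metric_space.mbounded[OF Metric_space_vdist]
  proof (intro disjI2 conjI exI ballI)
    show "\<zero>\<^bsub>V\<^esub> \<in> carrier V" by simp
    show "vdist V \<zero>\<^bsub>V\<^esub> x \<le> r" if "x \<in> B" for x
      using that vnorm_diff_commute[of "\<zero>\<^bsub>V\<^esub>" x] by (simp add: vdist_def B_def)
  qed (simp add: B_def)
  moreover have "B \<subseteq> carrier V" by (auto simp: B_def)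
  ultimately have "relatively_weakly_compact W (P ` B)"
    using \<open>P \<in> poly_wco (Suc k) V W\<close> by (simp add: poly_wco_def)
  moreover have "range (\<lambda>n. P (y n)) \<subseteq> P ` B" using y by (auto simp: B_def)
  ultimately obtain z where z: "z \<in> carrier W"
    "\<And>g m. g \<in> carrier (dual W) \<Longrightarrow> g z \<in> closure ((\<lambda>n. g (P (y n))) ` {m..})"
    by (rule W.weak_cluster_point) (rule that)
  obtain \<kappa> where \<kappa>: "\<kappa> \<in> carrier ?Y" "z = h \<kappa>" using z(1) by (auto simp: W_simps)
  show thesis
  proof (rule that[OF \<kappa>(1)])
    fix \<Phi> and m :: nat assume \<Phi>: "\<Phi> \<in> carrier (dual ?Y)"
    let ?g = "\<lambda>y\<in>carrier W. \<Phi> (the_inv h y)"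
    have "?g \<in> carrier (dual W)" using Y.dual_isometric_copy[OF h \<Phi>] by (simp add: W_def)
    then have "?g z \<in> closure ((\<lambda>n. ?g (P (y n))) ` {m..})" by (rule z(2))
    moreover have "?g z = \<Phi> \<kappa>" using \<kappa> z(1) by (simp add: the_inv_f_f[OF h])
    moreover have "?g (P (y n)) = \<Phi> (point_evaluation k V (y n))" for n
      using \<delta>(1)[OF y(1)] by (simp add: P_eq[OF y(1)] y(3) W_simps the_inv_f_f[OF h])
    ultimately show "\<Phi> \<kappa> \<in> closure ((\<lambda>n. \<Phi> (point_evaluation k V (y n))) ` {m..})" by (simp only:)
  qed
qed

text \<open>For \<open>\<Phi>\<close> in the bidual, \<open>P x = \<Phi> \<delta>\<^sub>x\<close> is the polynomial that represents it: the difference between \<open>\<Phi>\<close>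
  and evaluation at \<open>P\<close> vanishes at all point evaluations, hence everywhere. If it were nonzero somewhere, then some polynomial
  would be nonzero at some vector, which provides a functional \<open>f\<close> and a point \<open>e\<close> where \<open>f e = 1\<close>.\<close>

theorem property_V_imp_reflexive:
  fixes h :: "(('a \<Rightarrow> 'k) \<Rightarrow> 'k) \<Rightarrow> 'b"
  assumes pv: "\<And>W :: ('k, 'b) normed_module. banach_space W \<Longrightarrow> poly_uc (Suc k) V W \<subseteq> poly_wco (Suc k) V W"
    and h: "inj h" and k: "k \<ge> 1"
  shows "reflexive (poly_space k V scalar_space)"
proof -
  let ?X = "poly_space k V scalar_space"
  interpret X: RC_normed_space ?X by (simp add: RC_normed_space_def normed_space_poly_space[OF k])
  interpret Y: normed_space "dual ?X" by (rule X.normed_space_dual)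
  interpret Z: normed_space "dual (dual ?X)" by (rule Y.normed_space_dual)
  note \<delta> = point_evaluation_in_dual[OF k]
  have zero: "\<Psi> \<psi> = 0" if \<Psi>: "\<Psi> \<in> carrier (dual (dual ?X))"
    "\<And>x. x \<in> carrier V \<Longrightarrow> \<Psi> (point_evaluation k V x) = 0" and \<psi>: "\<psi> \<in> carrier (dual ?X)" for \<Psi> \<psi>
  proof (rule ccontr)
    assume nz: "\<Psi> \<psi> \<noteq> 0"
    have "\<exists>Q\<in>carrier ?X. \<psi> Q \<noteq> 0"
    proof (rule ccontr)
      assume "\<not> ?thesis"
      then have "\<psi> = \<zero>\<^bsub>dual ?X\<^esub>" using \<psi> by (auto simp: X.dual_simps X.in_dual_iff extensional_def)
      then show False using nz Y.dual_zero[OF \<Psi>(1)] by simp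
    qed
    then obtain Q where Q: "Q \<in> carrier ?X" "\<psi> Q \<noteq> 0" by blast
    have "\<exists>x\<in>carrier V. Q x \<noteq> 0"
    proof (rule ccontr)
      assume "\<not> ?thesis"
      then have "Q = \<zero>\<^bsub>?X\<^esub>" using Q(1) by (auto simp: poly_space_simps poly_space_def extensional_def)
      then show False using Q(2) X.dual_zero[OF \<psi>] by simp
    qed
    then obtain x0 where x0: "x0 \<in> carrier V" "Q x0 \<noteq> 0" by blast
    have "vnorm V x0 \<noteq> 0" using poly_norm_le[OF Q(1) k x0(1)] x0(2) k by (auto simp: power_0_left)
    obtain f where f: "f \<in> carrier (dual V)" "f x0 = of_real (vnorm V x0)"
      by (rule norming_functional[OF x0(1)]) (rule that)
    define e where "e = inverse (f x0) \<odot>\<^bsub>V\<^esub> x0"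
    have e: "e \<in> carrier V" "f e = 1"
      using x0(1) dual_smult[OF f(1) x0(1)] f(2) \<open>vnorm V x0 \<noteq> 0\<close> by (simp_all add: e_def)
    obtain r C where C: "C > 0" and norming: "\<And>Q s. Q \<in> carrier ?X \<Longrightarrow>
        (\<And>x. x \<in> carrier V \<Longrightarrow> vnorm V x \<le> r \<Longrightarrow> f x = 1 \<Longrightarrow> norm (Q x) \<le> s) \<Longrightarrow> vnorm ?X Q \<le> C * s"
    proof (rule hyperplane_norming[OF k f(1) e])
      fix C r :: real
      assume "C > 0" "\<And>Q s. Q \<in> carrier ?X \<Longrightarrow>
        (\<And>x. x \<in> carrier V \<Longrightarrow> vnorm V x \<le> r \<Longrightarrow> f x = 1 \<Longrightarrow> norm (Q x) \<le> s) \<Longrightarrow> vnorm ?X Q \<le> C * s"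
      then show thesis by (rule that)
    qed
    define H where "H = {x \<in> carrier V. vnorm V x \<le> r \<and> f x = 1}"
    have "\<Psi> \<psi> = 0"
    proof (rule X.norming_weakly_compact_total[where K = "point_evaluation k V ` H" and M = "\<bar>r\<bar> ^ k"
          and C = C and \<Phi> = \<Psi> and \<psi> = \<psi>])
      show "point_evaluation k V ` H \<subseteq> carrier (dual ?X)" using \<delta>(1) by (auto simp: H_def)
      show "vnorm (dual ?X) \<kappa> \<le> \<bar>r\<bar> ^ k" if \<kappa>: "\<kappa> \<in> point_evaluation k V ` H" for \<kappa>
      proof -
        obtain x where x: "x \<in> carrier V" "vnorm V x \<le> r" "\<kappa> = point_evaluation k V x" using \<kappa> by (auto simp: H_def)
        have "vnorm V x ^ k \<le> \<bar>r\<bar> ^ k" using x by (intro power_mono) auto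
        then show ?thesis using \<delta>(2)[OF x(1)] x(3) by simp
      qed
      show "vnorm ?X Q \<le> C * s"
        if Qs: "Q \<in> carrier ?X" "\<And>\<kappa>. \<kappa> \<in> point_evaluation k V ` H \<Longrightarrow> norm (\<kappa> Q) \<le> s" for Q s
      proof (rule norming[OF Qs(1)])
        fix x assume "x \<in> carrier V" "vnorm V x \<le> r" "f x = 1"
        then have "point_evaluation k V x \<in> point_evaluation k V ` H" by (auto simp: H_def)
        from Qs(2)[OF this] show "norm (Q x) \<le> s" using Qs(1) by (simp add: point_evaluation_def)
      qed
      show "\<exists>\<kappa>\<in>carrier (dual ?X). \<forall>\<Phi>\<in>carrier (dual (dual ?X)). \<forall>m. \<Phi> \<kappa> \<in> closure ((\<lambda>n. \<Phi> (y n)) ` {m..})"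
        if y: "range y \<subseteq> point_evaluation k V ` H" for y :: "nat \<Rightarrow> _"
      proof -
        have "\<exists>x. x \<in> H \<and> y n = point_evaluation k V x" for n using y by blast
        then obtain x where x: "\<And>n. x n \<in> H" "\<And>n. y n = point_evaluation k V (x n)" by metis
        obtain \<kappa> where "\<kappa> \<in> carrier (dual ?X)"
          "\<And>\<Phi> m. \<Phi> \<in> carrier (dual (dual ?X)) \<Longrightarrow> \<Phi> \<kappa> \<in> closure ((\<lambda>n. \<Phi> (point_evaluation k V (x n))) ` {m..})"
          by (rule point_evaluations_cluster[OF pv h k f(1), of x r]) (use x(1) in \<open>auto simp: H_def\<close>)
        then show ?thesis unfolding x(2) by blast
      qed
      show "\<Psi> \<kappa> = 0" if "\<kappa> \<in> point_evaluation k V ` H" for \<kappa>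
        using that \<Psi>(2) by (auto simp: H_def)
    qed (rule C \<Psi>(1) \<psi>)+
    then show False using nz by simp
  qed
  show ?thesis
    unfolding reflexive_def
  proof (intro equalityI subsetI)
    fix \<Phi> assume "\<Phi> \<in> (\<lambda>x. \<lambda>f\<in>carrier (dual ?X). f x) ` carrier ?X"
    then show "\<Phi> \<in> carrier (dual (dual ?X))" using X.eval_in_bidual by auto
  next
    fix \<Phi> assume \<Phi>: "\<Phi> \<in> carrier (dual (dual ?X))"
    define P where "P = (\<lambda>x\<in>carrier V. \<Phi> (polar_evaluation k V (\<lambda>i\<in>{..<k}. x)))"
    note pe = polar_evaluation(1)[OF k]
    obtain C where C: "C \<ge> 0" "\<And>u. u \<in> {..<k} \<rightarrow>\<^sub>E carrier V \<Longrightarrow> (\<And>i. i < k \<Longrightarrow> vnorm V (u i) \<le> 1) \<Longrightarrow>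
        vnorm (dual ?X) (polar_evaluation k V u) \<le> C"
      using polar_evaluation(3)[OF k] by auto
    have "multilinear_map k V scalar_space (\<lambda>u. \<Phi> (polar_evaluation k V u))"
      unfolding multilinear_map_def
    proof (intro conjI ballI allI impI)
      fix u i assume "u \<in> {..<k} \<rightarrow>\<^sub>E carrier V" "i < k"
      note lin = multilinear_mapD(2)[OF pe this]
      show "linear_map V scalar_space (\<lambda>x. \<Phi> (polar_evaluation k V (u(i := x))))"
        using linear_mapD[OF lin] by (simp add: linear_map_def Y.dual_add[OF \<Phi>] Y.dual_smult[OF \<Phi>])
    qed simp
    moreover have "vnorm scalar_space (\<Phi> (polar_evaluation k V u)) \<le> vnorm (dual (dual ?X)) \<Phi> * C"
      if "u \<in> {..<k} \<rightarrow>\<^sub>E carrier V" "\<And>i. i < k \<Longrightarrow> vnorm V (u i) \<le> 1" for u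
      using Y.dual_norm_le[OF \<Phi> multilinear_mapD(1)[OF pe that(1)]]
        mult_left_mono[OF C(2)[OF that] Z.vnorm_nonneg[OF \<Phi>]] by simp
    ultimately have P: "P \<in> carrier ?X"
      unfolding P_def by (rule diagonal_in_poly_space[OF _ normed_space_scalar_space])
    define E where "E = (\<lambda>\<psi>\<in>carrier (dual ?X). \<psi> P)"
    have E: "E \<in> carrier (dual (dual ?X))" unfolding E_def by (rule X.eval_in_bidual[OF P])
    have "(\<Phi> \<ominus>\<^bsub>dual (dual ?X)\<^esub> E) \<psi> = 0" if "\<psi> \<in> carrier (dual ?X)" for \<psi>
    proof (rule zero[OF _ _ that])
      show "\<Phi> \<ominus>\<^bsub>dual (dual ?X)\<^esub> E \<in> carrier (dual (dual ?X))" using \<Phi> E by simp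
      fix x assume x: "x \<in> carrier V"
      have "P x = \<Phi> (point_evaluation k V x)"
        unfolding polar_evaluation(2)[OF k x, symmetric] using x by (simp add: P_def)
      then show "(\<Phi> \<ominus>\<^bsub>dual (dual ?X)\<^esub> E) (point_evaluation k V x) = 0"
        using Y.dual_diff_apply[OF \<Phi> E \<delta>(1)[OF x]] \<delta>(1)[OF x] P by (simp add: E_def point_evaluation_def)
    qed
    then have "\<Phi> \<psi> = E \<psi>" if "\<psi> \<in> carrier (dual ?X)" for \<psi>
      using Y.dual_diff_apply[OF \<Phi> E that] that by simp
    then have "\<Phi> = E"
      using \<Phi> E by (intro extensionalityI[of _ "carrier (dual ?X)"]) (auto simp: Y.in_dual_iff)
    then show "\<Phi> \<in> (\<lambda>x. \<lambda>f\<in>carrier (dual ?X). f x) ` carrier ?X" using P by (auto simp: E_def)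
  qed
qed

end

section \<open>Reflexivity implies weak compactness of polynomials\<close>

lemma (in RC_normed_space) Hausdorff_weak_topology: "Hausdorff_space (weak_topology V)"
  unfolding Hausdorff_space_def
proof (intro allI impI)
  fix x y assume "x \<in> topspace (weak_topology V) \<and> y \<in> topspace (weak_topology V) \<and> x \<noteq> y"
  then have xy: "x \<in> carrier V" "y \<in> carrier V" "x \<noteq> y" by auto
  then obtain f where f: "f \<in> carrier (dual V)" "f x \<noteq> f y" using dual_separates by blast
  obtain S T where ST: "open S" "open T" "f x \<in> S" "f y \<in> T" "S \<inter> T = {}" using hausdorff[OF f(2)] by blast
  show "\<exists>S T. openin (weak_topology V) S \<and> openin (weak_topology V) T \<and> x \<in> S \<and> y \<in> T \<and> disjnt S T"
  proof (intro exI conjI)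
    show "openin (weak_topology V) {x \<in> carrier V. f x \<in> S}" "openin (weak_topology V) {x \<in> carrier V. f x \<in> T}"
      using openin_weak_topology[OF f(1)] ST by auto
  qed (use ST xy in \<open>auto simp: disjnt_def\<close>)
qed

lemma (in normed_space) functional_o_polynomial:
  assumes W: "normed_space W" and k: "k \<ge> 1" and P: "P \<in> carrier (poly_space k V W)" and \<phi>: "\<phi> \<in> carrier (dual W)"
  shows "(\<lambda>x\<in>carrier V. \<phi> (P x)) \<in> carrier (poly_space k V scalar_space)"
proof -
  interpret W: normed_space W by fact
  obtain A where A: "multilinear_map k V W A" "\<And>x. x \<in> carrier V \<Longrightarrow> P x = A (\<lambda>i\<in>{..<k}. x)"
    using P by (auto simp: poly_space_def homogeneous_polynomial_def)
  have "multilinear_map k V scalar_space (\<lambda>u. \<phi> (A u))"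
    unfolding multilinear_map_def
  proof (intro conjI ballI allI impI)
    fix u i assume "u \<in> {..<k} \<rightarrow>\<^sub>E carrier V" "i < k"
    note lin = multilinear_mapD(2)[OF A(1) this]
    show "linear_map V scalar_space (\<lambda>x. \<phi> (A (u(i := x))))"
      using linear_mapD[OF lin] by (simp add: linear_map_def W.dual_add[OF \<phi>] W.dual_smult[OF \<phi>])
  qed simp
  then have "homogeneous_polynomial k V scalar_space (\<lambda>x\<in>carrier V. \<phi> (P x))"
    using A(2) by (auto simp: homogeneous_polynomial_def intro!: exI[of _ "\<lambda>u. \<phi> (A u)"])
  moreover have "continuous_map (norm_topology V) euclidean (\<lambda>x\<in>carrier V. \<phi> (P x))"
  proof (rule continuous_map_eq)
    show "continuous_map (norm_topology V) euclidean (\<phi> \<circ> P)"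
      using P \<phi> by (intro continuous_map_compose[where X' = "norm_topology W"]) (auto simp: poly_space_def dual_def)
  qed simp
  ultimately show ?thesis by (simp add: poly_space_def)
qed

text \<open>Let \<open>M\<close> be the set of those \<open>\<mu>\<close> that have such a \<open>y\<close>. It is a subspace, it contains the evaluation at each
  \<open>x\<close>, with \<open>y = P x\<close>, and it is closed because \<open>y\<close> depends boundedly on \<open>\<mu>\<close> and \<open>W\<close> is complete. A functional
  that vanishes on \<open>M\<close> is, by reflexivity, the evaluation at a polynomial that vanishes at every \<open>x\<close>.\<close>

lemma (in RC_normed_space) reflexive_bidual_transpose:
  fixes W :: "('k, 'b) normed_module"
  assumes W: "banach_space W" and k: "k \<ge> 1" and P: "P \<in> carrier (poly_space k V W)"
    and refl: "reflexive (poly_space k V scalar_space)"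
    and \<mu>: "\<mu> \<in> carrier (dual (poly_space k V scalar_space))"
  shows "\<exists>y\<in>carrier W. \<forall>\<phi>\<in>carrier (dual W). \<phi> y = \<mu> (\<lambda>x\<in>carrier V. \<phi> (P x))"
proof -
  let ?X = "poly_space k V scalar_space"
  let ?Y = "dual ?X"
  interpret X: RC_normed_space ?X by (simp add: RC_normed_space_def normed_space_poly_space[OF k])
  interpret Y: RC_normed_space ?Y by (simp add: RC_normed_space_def X.normed_space_dual)
  interpret W: banach_space W by fact
  interpret RW: RC_normed_space W by (simp add: RC_normed_space_def W.normed_space_axioms)
  interpret DW: normed_space "dual W" by (rule W.normed_space_dual)
  define t where "t \<phi> = (\<lambda>x\<in>carrier V. \<phi> (P x))" for \<phi> :: "'b \<Rightarrow> 'k"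
  have t: "t \<phi> \<in> carrier ?X" if "\<phi> \<in> carrier (dual W)" for \<phi>
    unfolding t_def by (rule functional_o_polynomial[OF W.normed_space_axioms k P that])
  have PW: "P x \<in> carrier W" if "x \<in> carrier V" for x
    using P that homogeneous_polynomial_carrier[of k W P] by (auto simp: poly_space_def)
  obtain C where C: "C \<ge> 0" "\<And>x. x \<in> carrier V \<Longrightarrow> vnorm W (P x) \<le> C * vnorm V x ^ k"
    by (rule poly_space_bounded[OF P W.normed_space_axioms k]) (rule that)
  have t_le: "vnorm ?X (t \<phi>) \<le> C" if \<phi>: "\<phi> \<in> carrier (dual W)" "vnorm (dual W) \<phi> \<le> 1" for \<phi>
    unfolding poly_space_simps
  proof (rule sup_norm_least)
    fix x assume "x \<in> unit_ball V"
    then have x: "x \<in> carrier V" "vnorm V x \<le> 1" by (auto simp: unit_ball_def)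
    have "norm (\<phi> (P x)) \<le> 1 * vnorm W (P x)"
      using W.dual_norm_le[OF \<phi>(1) PW[OF x(1)]] mult_right_mono[OF \<phi>(2) W.vnorm_nonneg[OF PW[OF x(1)]]]
      by simp
    also have "\<dots> \<le> C * vnorm V x ^ k" using C(2)[OF x(1)] by simp
    also have "\<dots> \<le> C * 1" using C(1) x by (intro mult_left_mono power_le_one) auto
    finally show "norm (t \<phi> x) \<le> C" using x by (simp add: t_def)
  qed
  define M where "M = {\<mu> \<in> carrier ?Y. \<exists>y\<in>carrier W. \<forall>\<phi>\<in>carrier (dual W). \<phi> y = \<mu> (t \<phi>)}"
  have M: "M \<subseteq> carrier ?Y" by (auto simp: M_def)
  have \<delta>: "point_evaluation k V x \<in> M" if x: "x \<in> carrier V" for x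
    using point_evaluation_in_dual(1)[OF k x] PW[OF x] x t
    by (auto simp: M_def point_evaluation_def t_def intro!: bexI[of _ "P x"])
  have closed: "\<mu> \<in> M" if \<mu>: "\<mu> \<in> carrier ?Y" and near: "\<And>e. e > 0 \<Longrightarrow> \<exists>m\<in>M. vnorm ?Y (\<mu> \<ominus>\<^bsub>?Y\<^esub> m) < e" for \<mu>
  proof -
    have "\<exists>m y. m \<in> M \<and> y \<in> carrier W \<and> (\<forall>\<phi>\<in>carrier (dual W). \<phi> y = m (t \<phi>)) \<and>
        vnorm ?Y (\<mu> \<ominus>\<^bsub>?Y\<^esub> m) < 1 / (real n + 1)" for n
    proof -
      obtain m where "m \<in> M" "vnorm ?Y (\<mu> \<ominus>\<^bsub>?Y\<^esub> m) < 1 / (real n + 1)" using near[of "1 / (real n + 1)"] by auto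
      then show ?thesis unfolding M_def by blast
    qed
    then obtain m y where m: "\<And>n. m n \<in> M" "\<And>n. vnorm ?Y (\<mu> \<ominus>\<^bsub>?Y\<^esub> m n) < 1 / (real n + 1)"
      and y: "\<And>n. y n \<in> carrier W" "\<And>n \<phi>. \<phi> \<in> carrier (dual W) \<Longrightarrow> \<phi> (y n) = m n (t \<phi>)"
      by metis
    have mY: "m n \<in> carrier ?Y" for n using m(1) M by auto
    have y_le: "vnorm W (y i \<ominus>\<^bsub>W\<^esub> y j) \<le> C * (1 / (real i + 1) + 1 / (real j + 1))" for i j
    proof (rule RW.vnorm_le_if_dual_le)
      show "y i \<ominus>\<^bsub>W\<^esub> y j \<in> carrier W" using y(1) by simp
      fix \<phi> assume \<phi>: "\<phi> \<in> carrier (dual W)" "vnorm (dual W) \<phi> \<le> 1"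
      have "\<phi> (y i \<ominus>\<^bsub>W\<^esub> y j) = (m i \<ominus>\<^bsub>?Y\<^esub> m j) (t \<phi>)"
        using W.dual_diff[OF \<phi>(1) y(1) y(1)] y(2)[OF \<phi>(1)] X.dual_diff_apply[OF mY mY t[OF \<phi>(1)]] by simp
      also have "norm \<dots> \<le> vnorm ?Y (m i \<ominus>\<^bsub>?Y\<^esub> m j) * vnorm ?X (t \<phi>)"
        using mY by (intro X.dual_norm_le t \<phi>) auto
      also have "\<dots> \<le> (1 / (real i + 1) + 1 / (real j + 1)) * C"
      proof (rule mult_mono)
        show "vnorm ?Y (m i \<ominus>\<^bsub>?Y\<^esub> m j) \<le> 1 / (real i + 1) + 1 / (real j + 1)"
          using Y.vnorm_diff_triangle[OF mY \<mu> mY, of i j] m(2)[of i] m(2)[of j] Y.vnorm_diff_commute[OF mY \<mu>, of i]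
          by linarith
      qed (use t_le[OF \<phi>] X.vnorm_nonneg[OF t[OF \<phi>(1)]] in auto)
      finally show "norm (\<phi> (y i \<ominus>\<^bsub>W\<^esub> y j)) \<le> C * (1 / (real i + 1) + 1 / (real j + 1))" by (simp add: mult.commute)
    qed
    have inv0: "(\<lambda>n. 1 / (real n + 1)) \<longlonglongrightarrow> 0"
      using LIMSEQ_inverse_real_of_nat by (simp add: inverse_eq_divide add.commute)
    obtain l where l: "l \<in> carrier W" "(\<lambda>n. vnorm W (y n \<ominus>\<^bsub>W\<^esub> l)) \<longlonglongrightarrow> 0"
    proof (rule W.MCauchy_imp_limit[of y])
      fix e :: real assume e: "e > 0"
      have "(\<lambda>n. 2 * C * (1 / (real n + 1))) \<longlonglongrightarrow> 2 * C * 0" by (intro tendsto_mult_left inv0)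
      then have "(\<lambda>n. 2 * C * (1 / (real n + 1))) \<longlonglongrightarrow> 0" by simp
      from order_tendstoD(2)[OF this e]
      obtain N where N: "2 * C * (1 / (real N + 1)) < e" by (auto simp: eventually_sequentially)
      have "vnorm W (y i \<ominus>\<^bsub>W\<^esub> y j) < e" if "i \<ge> N" "j \<ge> N" for i j
      proof -
        have "1 / (real i + 1) \<le> 1 / (real N + 1)" "1 / (real j + 1) \<le> 1 / (real N + 1)"
          using that by (auto intro!: divide_left_mono)
        then have "C * (1 / (real i + 1) + 1 / (real j + 1)) \<le> C * (2 * (1 / (real N + 1)))"
          using C(1) by (intro mult_left_mono) auto
        then show ?thesis using y_le[of i j] N by (simp add: mult_ac)
      qed
      then show "\<exists>N. \<forall>i\<ge>N. \<forall>j\<ge>N. vnorm W (y i \<ominus>\<^bsub>W\<^esub> y j) < e" by blast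
    qed (use y(1) in auto)
    have "\<phi> l = \<mu> (t \<phi>)" if \<phi>: "\<phi> \<in> carrier (dual W)" for \<phi>
    proof (rule LIMSEQ_unique)
      have "(\<lambda>n. \<phi> (y n) - \<phi> l) \<longlonglongrightarrow> 0"
      proof (rule Lim_null_comparison)
        show "(\<lambda>n. vnorm (dual W) \<phi> * vnorm W (y n \<ominus>\<^bsub>W\<^esub> l)) \<longlonglongrightarrow> 0"
          using tendsto_mult_left[OF l(2), of "vnorm (dual W) \<phi>"] by simp
        show "\<forall>\<^sub>F n in sequentially. norm (\<phi> (y n) - \<phi> l) \<le> vnorm (dual W) \<phi> * vnorm W (y n \<ominus>\<^bsub>W\<^esub> l)"
          using W.dual_norm_le[OF \<phi>, of "y _ \<ominus>\<^bsub>W\<^esub> l"] y(1) l(1) by (simp add: W.dual_diff[OF \<phi>])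
      qed
      then show "(\<lambda>n. \<phi> (y n)) \<longlonglongrightarrow> \<phi> l" by (simp add: LIM_zero_iff)
      have "(\<lambda>n. m n (t \<phi>) - \<mu> (t \<phi>)) \<longlonglongrightarrow> 0"
      proof (rule Lim_null_comparison)
        show "(\<lambda>n. 1 / (real n + 1) * vnorm ?X (t \<phi>)) \<longlonglongrightarrow> 0"
          using tendsto_mult_right[OF inv0, of "vnorm ?X (t \<phi>)"] by simp
        have "norm (m n (t \<phi>) - \<mu> (t \<phi>)) \<le> 1 / (real n + 1) * vnorm ?X (t \<phi>)" for n
        proof -
          have "norm (m n (t \<phi>) - \<mu> (t \<phi>)) = norm ((\<mu> \<ominus>\<^bsub>?Y\<^esub> m n) (t \<phi>))"
            using X.dual_diff_apply[OF \<mu> mY t[OF \<phi>]] by (simp add: norm_minus_commute)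
          also have "\<dots> \<le> vnorm ?Y (\<mu> \<ominus>\<^bsub>?Y\<^esub> m n) * vnorm ?X (t \<phi>)"
            using \<mu> mY by (intro X.dual_norm_le t \<phi>) auto
          also have "\<dots> \<le> 1 / (real n + 1) * vnorm ?X (t \<phi>)"
            using m(2)[of n] X.vnorm_nonneg[OF t[OF \<phi>]] by (intro mult_right_mono) auto
          finally show ?thesis .
        qed
        then show "\<forall>\<^sub>F n in sequentially. norm (m n (t \<phi>) - \<mu> (t \<phi>)) \<le> 1 / (real n + 1) * vnorm ?X (t \<phi>)"
          by simp
      qed
      then show "(\<lambda>n. \<phi> (y n)) \<longlonglongrightarrow> \<mu> (t \<phi>)" by (simp add: LIM_zero_iff y(2)[OF \<phi>])
    qed
    then show ?thesis using \<mu> l(1) by (auto simp: M_def)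
  qed
  have "\<mu> \<in> M"
  proof (rule ccontr)
    assume "\<mu> \<notin> M"
    then obtain e where e: "e > 0" "\<And>m. m \<in> M \<Longrightarrow> e \<le> vnorm ?Y (\<mu> \<ominus>\<^bsub>?Y\<^esub> m)"
      using closed[OF \<mu>] by (meson not_le)
    obtain \<Phi> where \<Phi>: "\<Phi> \<in> carrier (dual ?Y)" "\<And>m. m \<in> M \<Longrightarrow> \<Phi> m = 0" "\<Phi> \<mu> \<noteq> 0"
    proof (rule Y.functional_vanishing_on_subspace[OF M _ _ _ \<mu> e])
      show "\<zero>\<^bsub>?Y\<^esub> \<in> M"
        using t by (auto simp: M_def X.dual_simps W.dual_zero intro!: bexI[of _ "\<zero>\<^bsub>W\<^esub>"])
           (use Y.M.zero_closed in \<open>simp add: X.dual_simps\<close>)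
    next
      fix \<mu> \<nu> assume "\<mu> \<in> M" "\<nu> \<in> M"
      then obtain y z where "y \<in> carrier W" "\<forall>\<phi>\<in>carrier (dual W). \<phi> y = \<mu> (t \<phi>)"
        "z \<in> carrier W" "\<forall>\<phi>\<in>carrier (dual W). \<phi> z = \<nu> (t \<phi>)" and "\<mu> \<in> carrier ?Y" "\<nu> \<in> carrier ?Y"
        by (auto simp: M_def)
      then show "\<mu> \<oplus>\<^bsub>?Y\<^esub> \<nu> \<in> M"
        using t Y.M.a_closed[of \<mu> \<nu>] by (auto simp: M_def X.dual_simps W.dual_add intro!: bexI[of _ "y \<oplus>\<^bsub>W\<^esub> z"])
    next
      fix c \<mu> assume "\<mu> \<in> M"
      then obtain y where "y \<in> carrier W" "\<forall>\<phi>\<in>carrier (dual W). \<phi> y = \<mu> (t \<phi>)" and "\<mu> \<in> carrier ?Y"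
        by (auto simp: M_def)
      then show "c \<odot>\<^bsub>?Y\<^esub> \<mu> \<in> M"
        using t Y.smult_simps(4)[of \<mu> c] by (auto simp: M_def X.dual_simps W.dual_smult intro!: bexI[of _ "c \<odot>\<^bsub>W\<^esub> y"])
    next
      fix \<Phi> assume "\<Phi> \<in> carrier (dual ?Y)" "\<And>m. m \<in> M \<Longrightarrow> \<Phi> m = 0" "\<Phi> \<mu> \<noteq> 0"
      then show thesis by (rule that)
    qed
    obtain Q where Q: "Q \<in> carrier ?X" "\<Phi> = (\<lambda>f\<in>carrier ?Y. f Q)"
      using refl \<Phi>(1) unfolding reflexive_def by blast
    have "Q x = 0" if x: "x \<in> carrier V" for x
      using \<Phi>(2)[OF \<delta>[OF x]] point_evaluation_in_dual(1)[OF k x] Q by (simp add: point_evaluation_def)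
    then have "Q = \<zero>\<^bsub>?X\<^esub>" using Q(1) by (auto simp: poly_space_simps poly_space_def extensional_def)
    then show False using \<Phi>(3) Q(2) \<mu> X.dual_zero[OF \<mu>] by simp
  qed
  then show ?thesis by (auto simp: M_def t_def)
qed

text \<open>The map \<open>G\<close>, which sends \<open>\<mu>\<close> to the \<open>y\<close> of \<open>reflexive_bidual_transpose\<close>, is continuous from the pointwise to the
  weak topology, because \<open>\<phi> (G \<mu>)\<close> is the value of \<open>\<mu>\<close> at a fixed polynomial.\<close>

theorem (in RC_normed_space) reflexive_imp_weakly_compact:
  fixes W :: "('k, 'b) normed_module"
  assumes W: "banach_space W" and k: "k \<ge> 1" and P: "P \<in> carrier (poly_space k V W)"
    and refl: "reflexive (poly_space k V scalar_space)"
  shows "P \<in> poly_wco k V W"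
  unfolding poly_wco_def
proof (intro CollectI conjI P allI impI, elim conjE)
  fix B assume B: "B \<subseteq> carrier V" "Metric_space.mbounded (carrier V) (vdist V) B"
  let ?X = "poly_space k V scalar_space"
  let ?Y = "dual ?X"
  let ?T = "product_topology (\<lambda>_. euclidean :: 'k topology) (carrier ?X)"
  interpret X: RC_normed_space ?X by (simp add: RC_normed_space_def normed_space_poly_space[OF k])
  interpret W: banach_space W by fact
  interpret RW: RC_normed_space W by (simp add: RC_normed_space_def W.normed_space_axioms)
  obtain r where r: "r > 0" "\<And>x. x \<in> B \<Longrightarrow> vnorm V x \<le> r"
    by (rule mbounded_imp_vnorm_bounded[OF B(2)]) (rule that)
  define t where "t \<phi> = (\<lambda>x\<in>carrier V. \<phi> (P x))" for \<phi> :: "'b \<Rightarrow> 'k"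
  have t: "t \<phi> \<in> carrier ?X" if "\<phi> \<in> carrier (dual W)" for \<phi>
    unfolding t_def by (rule functional_o_polynomial[OF W.normed_space_axioms k P that])
  define C where "C = {\<mu> \<in> carrier ?Y. vnorm ?Y \<mu> \<le> r ^ k}"
  have C: "compactin ?T C" unfolding C_def using r by (intro X.Banach_Alaoglu) simp
  obtain G where G: "\<And>\<mu>. \<mu> \<in> carrier ?Y \<Longrightarrow> G \<mu> \<in> carrier W"
    "\<And>\<mu> \<phi>. \<mu> \<in> carrier ?Y \<Longrightarrow> \<phi> \<in> carrier (dual W) \<Longrightarrow> \<phi> (G \<mu>) = \<mu> (t \<phi>)"
    using reflexive_bidual_transpose[OF W k P refl] unfolding t_def by metis
  have CT: "C \<subseteq> topspace ?T" using compactin_subset_topspace[OF C] .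
  have "continuous_map (subtopology ?T C) (weak_topology W) G"
    unfolding weak_topology_def
  proof (rule continuous_on_generated_topo)
    fix U assume "U \<in> {{x \<in> carrier W. f x \<in> U} |f U. f \<in> carrier (dual W) \<and> openin (norm_topology scalar_space) U}"
    then obtain \<phi> U' where \<phi>: "\<phi> \<in> carrier (dual W)" and U': "openin euclidean U'" and U: "U = {x \<in> carrier W. \<phi> x \<in> U'}"
      by auto
    have "openin ?T {\<mu> \<in> topspace ?T. \<mu> (t \<phi>) \<in> U'}"
      using continuous_map_product_projection[of "t \<phi>" "carrier ?X" "\<lambda>_. euclidean"] t[OF \<phi>] U'
      by (intro openin_continuous_map_preimage[where Y = euclidean]) auto
    moreover have "G -` U \<inter> topspace (subtopology ?T C) = {\<mu> \<in> topspace ?T. \<mu> (t \<phi>) \<in> U'} \<inter> C"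
    proof -
      have "\<mu> \<in> carrier ?Y" if "\<mu> \<in> C" for \<mu> using that by (simp add: C_def)
      then show ?thesis using G(1) G(2)[OF _ \<phi>] CT unfolding topspace_subtopology U by auto
    qed
    ultimately show "openin (subtopology ?T C) (G -` U \<inter> topspace (subtopology ?T C))"
      by (auto simp: openin_subtopology)
  next
    have "G ` topspace (subtopology ?T C) \<subseteq> carrier W" using G(1) by (auto simp: C_def)
    then show "G ` topspace (subtopology ?T C) \<subseteq>
        \<Union>{{x \<in> carrier W. f x \<in> U} |f U. f \<in> carrier (dual W) \<and> openin (norm_topology scalar_space) U}"
      using W.topspace_weak_topology unfolding weak_topology_def topology_generated_by_topspace by blast
  qed
  moreover have "compactin (subtopology ?T C) C" using C by (simp add: compactin_subtopology)
  ultimately have GC: "compactin (weak_topology W) (G ` C)" by (rule image_compactin[rotated])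
  have PG: "P ` B \<subseteq> G ` C"
  proof
    fix z assume "z \<in> P ` B"
    then obtain x where x: "x \<in> B" "z = P x" by blast
    then have xV: "x \<in> carrier V" "vnorm V x \<le> r" using B r by auto
    let ?\<delta> = "point_evaluation k V x"
    have \<delta>: "?\<delta> \<in> carrier ?Y" by (rule point_evaluation_in_dual(1)[OF k xV(1)])
    have "vnorm ?Y ?\<delta> \<le> r ^ k"
      using point_evaluation_in_dual(2)[OF k xV(1)] power_mono[OF xV(2) vnorm_nonneg[OF xV(1)]] by (rule order_trans)
    then have "?\<delta> \<in> C" using \<delta> by (simp add: C_def)
    moreover have "P x = G ?\<delta>"
    proof (rule RW.dual_separates)
      show "P x \<in> carrier W" using P xV homogeneous_polynomial_carrier[of k W P] by (auto simp: poly_space_def)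
      show "G ?\<delta> \<in> carrier W" by (rule G(1)[OF \<delta>])
      fix \<phi> assume \<phi>: "\<phi> \<in> carrier (dual W)"
      show "\<phi> (P x) = \<phi> (G ?\<delta>)" using G(2)[OF \<delta> \<phi>] t[OF \<phi>] xV(1) by (simp add: point_evaluation_def t_def)
    qed
    ultimately show "z \<in> G ` C" using x by blast
  qed
  have closed: "closedin (weak_topology W) (G ` C)"
    by (rule compactin_imp_closedin[OF RW.Hausdorff_weak_topology GC])
  have "compactin (weak_topology W) (weak_topology W closure_of P ` B)"
    by (rule closed_compactin[OF GC closure_of_minimal[OF PG closed]]) simp
  moreover have "P ` B \<subseteq> carrier W"
    using PG G(1) by (auto simp: C_def)
  ultimately show "relatively_weakly_compact W (P ` B)" by (simp add: relatively_weakly_compact_def)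
qed

section \<open>The characterization\<close>

theorem (in RC_normed_space) property_V_iff_reflexive:
  "polynomial_property_V TYPE(('k, 'a, 'u) universe) V \<longleftrightarrow> (\<forall>k\<ge>1. reflexive (poly_space k V scalar_space))"
proof
  assume pv: "polynomial_property_V TYPE(('k, 'a, 'u) universe) V"
  show "\<forall>k\<ge>1. reflexive (poly_space k V scalar_space)"
  proof (intro allI impI)
    fix k :: nat assume k: "k \<ge> 1"
    show "reflexive (poly_space k V scalar_space)"
    proof (rule property_V_imp_reflexive[OF _ _ k])
      show "inj (Inl :: (('a \<Rightarrow> 'k) \<Rightarrow> 'k) \<Rightarrow> ('k, 'a, 'u) universe)" by simp
      show "poly_uc (Suc k) V W \<subseteq> poly_wco (Suc k) V W" if "banach_space W"
        for W :: "('k, ('k, 'a, 'u) universe) normed_module"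
        using pv that by (simp add: polynomial_property_V_def)
    qed
  qed
next
  assume "\<forall>k\<ge>1. reflexive (poly_space k V scalar_space)"
  then show "polynomial_property_V TYPE(('k, 'a, 'u) universe) V"
    using reflexive_imp_weakly_compact by (auto simp: polynomial_property_V_def poly_uc_def)
qed

theorem corollary11:
  shows "(\<forall>E :: (real, 'e) normed_module. banach_space E \<longrightarrow>
           (polynomial_property_V TYPE((real, 'e, 'u) universe) E \<longleftrightarrow>
             (\<forall>k\<ge>1. reflexive (poly_space k E scalar_space)))) \<and>
         (\<forall>E :: (complex, 'e) normed_module. banach_space E \<longrightarrow>
           (polynomial_property_V TYPE((complex, 'e, 'u) universe) E \<longleftrightarrow>
             (\<forall>k\<ge>1. reflexive (poly_space k E scalar_space))))"
proof (intro conjI allI impI)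
  fix E :: "(real, 'e) normed_module" assume "banach_space E"
  then show "polynomial_property_V TYPE((real, 'e, 'u) universe) E \<longleftrightarrow>
      (\<forall>k\<ge>1. reflexive (poly_space k E scalar_space))"
    by (intro RC_normed_space.property_V_iff_reflexive) (simp add: RC_normed_space_def banach_space_def)
next
  fix E :: "(complex, 'e) normed_module" assume "banach_space E"
  then show "polynomial_property_V TYPE((complex, 'e, 'u) universe) E \<longleftrightarrow>
      (\<forall>k\<ge>1. reflexive (poly_space k E scalar_space))"
    by (intro RC_normed_space.property_V_iff_reflexive) (simp add: RC_normed_space_def banach_space_def)
qed

end
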